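(* Let $n\ge 1$ and $\lambda\ge 2$ be integers, let $\Lambda:=\{0,1,\dots,\lambda-1\}^n$, and let $N\le\lambda^n$ be a positive integer. For each $1\le l\le N$, suppose that there exist $r_l\in\mathbb{N}$ and trigonometric polynomials $p_l$ and $g_l^{(r)}$, $1\le r\le r_l$, on $\mathbb{T}^n$ satisfying $$1-|p_l(\xi)|^2=\lambda^n\sum_{r=1}^{r_l}|g_l^{(r)}(\xi)|^2,\qquad \xi\in\mathbb{T}^n,$$ with $p_l(0)=1$. In case $N<\lambda^n$, for $l=N+1,\dots,\lambda^n$ let $p_l$ be a trigonometric polynomial satisfying $|p_l|^2=1$ on $\mathbb{T}^n$. Define the trigonometric polynomial $$\tau(\xi)=\lambda^{-n}\sum_{l=1}^{\lambda^n}p_l(\lambda\xi)e^{i\nu_l\cdot\xi},$$ where $\nu_1,\dots,\nu_{\lambda^n}$ are the distinct elements of $\Lambda$ (in some order), and assume $\tau(0)=1$. Define the $\left(\sum_{l=1}^N r_l\right)+\lambda^n$ functions $$q_{1,l}^{(r)}(\xi)=\tau(\xi)\overline{g_l^{(r)}(\lambda\xi)},\qquad l=1,\dots,N,\ r=1,\dots,r_l,$$ $$q_{2,m}(\xi)=\lambda^{-n/2}\left(e^{i\nu_m\cdot\xi}-\tau(\xi)\overline{p_m(\lambda\xi)}\right),\qquad m=1,\dots,\lambda^n.$$ Then the wavelet system $$X\left(\tau,(q_{1,l}^{(r)}:l=1,\dots,N,\ r=1,\dots,r_l),(q_{2,m}:m=1,\dots,\lambda^n)\right)$$ is a compactly supported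 tight wavelet frame for $L^2(\mathbb{R}^n)$.
   Context: A trigonometric polynomial on $\mathbb{T}^n=\mathbb{R}^n/(2\pi\mathbb{Z})^n$ is a finite sum $\sum_{k\in\mathbb{Z}^n}h(k)e^{-ik\cdot\xi}$ with complex coefficients. The Fourier transform is normalized by $\widehat f(\xi)=\int_{\mathbb{R}^n}f(x)e^{-ix\cdot\xi}\,dx$ for $f\in L^1(\mathbb{R}^n)\cap L^2(\mathbb{R}^n)$. For a finite set $\Psi\subset L^2(\mathbb{R}^n)$ (of mother wavelets), the wavelet system generated by $\Psi$ is $X(\Psi)=\{\psi_{j,k}:=\lambda^{jn/2}\psi(\lambda^j\cdot-k):\psi\in\Psi,\ j\in\mathbb{Z},\ k\in\mathbb{Z}^n\}$. It is a tight wavelet frame (TWF) for $L^2(\mathbb{R}^n)$ if $\sum_{\psi\in\Psi}\sum_{j\in\mathbb{Z},k\in\mathbb{Z}^n}|\langle f,\psi_{j,k}\rangle|^2=\|f\|_{L^2(\mathbb{R}^n)}^2$ for all $f\in L^2(\mathbb{R}^n)$; it is compactly supported if all the mother wavelets have compact support. For a mask $\tau$ with $\tau(0)=1$, $\phi_\tau$ is defined by $\widehat{\phi_\tau}(\xi)=\prod_{j=1}^\infty\tau(\lambda^{-j}\xi)$; it serves as the refinable function, satisfying $\widehat{\phi_\tau}(\lambda\xi)=\tau(\xi)\widehat{\phi_\tau}(\xi)$. For functions $q_1,\dots,q_L$, the wavelet system $X(\tau,q_1,\dots,q_L)$ is $X(\psi^{(1)},\dots,\psi^{(L)})$, where $\widehat{\psi^{(l)}}(\lambda\xi)=q_l(\xi)\widehat{\phi_\tau}(\xi)$,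 $1\le l\le L$ (the generators are indexed by $l$ and counted with multiplicity). *)

theory Defs
  imports "HOL-Analysis.Analysis"
begin

text \<open>The dimension is \<open>n = CARD('n)\<close>. Functions on the torus are functions on \<open>real^'n\<close>;
  trigonometric polynomials are automatically \<open>2\<pi>\<close>-periodic in every coordinate.\<close>

definition ivec :: "int^'n \<Rightarrow> real^'n" where
  "ivec k = (\<chi> i. real_of_int (k $ i))"

definition trig_poly :: "(real^'n \<Rightarrow> complex) \<Rightarrow> bool" where
  "trig_poly p \<longleftrightarrow> (\<exists>K h. finite K \<and>
     (\<forall>\<xi>. p \<xi> = (\<Sum>k\<in>K. h k * exp (- \<i> * complex_of_real (ivec k \<bullet> \<xi>)))))"

text \<open>Elements of \<open>L\<^sup>p\<close> are represented by Borel functions; every Lebesgue measurable function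
  agrees almost everywhere with one.\<close>

definition L1_fun :: "(real^'n \<Rightarrow> complex) \<Rightarrow> bool" where
  "L1_fun f \<longleftrightarrow> integrable lborel f"

definition L2_fun :: "(real^'n \<Rightarrow> complex) \<Rightarrow> bool" where
  "L2_fun f \<longleftrightarrow> f \<in> borel_measurable lborel \<and> integrable lborel (\<lambda>x. (cmod (f x))\<^sup>2)"

definition L2_inner :: "(real^'n \<Rightarrow> complex) \<Rightarrow> (real^'n \<Rightarrow> complex) \<Rightarrow> complex" where
  "L2_inner f g = (LINT x|lborel. f x * cnj (g x))"

definition L2_norm_fun :: "(real^'n \<Rightarrow> complex) \<Rightarrow> real" where
  "L2_norm_fun f = sqrt (LINT x|lborel. (cmod (f x))\<^sup>2)"

definition fourier :: "(real^'n \<Rightarrow> complex) \<Rightarrow> real^'n \<Rightarrow> complex" where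
  "fourier f \<xi> = (LINT x|lborel. f x * exp (- \<i> * complex_of_real (x \<bullet> \<xi>)))"

text \<open>Compact support of an \<open>L\<^sup>2\<close> class, hence only up to a null set.\<close>

definition compactly_supported :: "(real^'n \<Rightarrow> complex) \<Rightarrow> bool" where
  "compactly_supported f \<longleftrightarrow> (\<exists>K. compact K \<and> (AE x in lborel. x \<notin> K \<longrightarrow> f x = 0))"

definition wavelet :: "nat \<Rightarrow> (real^'n \<Rightarrow> complex) \<Rightarrow> int \<Rightarrow> int^'n \<Rightarrow> real^'n \<Rightarrow> complex" where
  "wavelet lam \<psi> j k = (\<lambda>x.
     complex_of_real (real lam powr (real_of_int j * real CARD('n) / 2)) *
     \<psi> ((real lam powi j) *\<^sub>R x - ivec k))"

text \<open>The mother wavelets form a family \<open>\<psi>\<close> over an index set \<open>I\<close>, so that they are counted with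
  multiplicity.\<close>

definition tight_wavelet_frame :: "nat \<Rightarrow> 'i set \<Rightarrow> ('i \<Rightarrow> real^'n \<Rightarrow> complex) \<Rightarrow> bool" where
  "tight_wavelet_frame lam I \<psi> \<longleftrightarrow>
     finite I \<and> (\<forall>i\<in>I. L2_fun (\<psi> i)) \<and>
     (\<forall>f. L2_fun f \<longrightarrow>
        ((\<lambda>(i, j, k). (cmod (L2_inner f (wavelet lam (\<psi> i) j k)))\<^sup>2)
           has_sum (L2_norm_fun f)\<^sup>2) (I \<times> (UNIV :: int set) \<times> (UNIV :: (int^'n) set)))"

text \<open>\<open>\<phi>\<close> is the function \<open>\<phi>\<^sub>\<tau>\<close>. The product index is shifted by one, and \<open>has_prod\<close> admits finitely
  many vanishing factors.\<close>

definition refinable_function ::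
    "nat \<Rightarrow> (real^'n \<Rightarrow> complex) \<Rightarrow> (real^'n \<Rightarrow> complex) \<Rightarrow> bool" where
  "refinable_function lam \<tau> \<phi> \<longleftrightarrow> L1_fun \<phi> \<and> L2_fun \<phi> \<and>
     (\<forall>\<xi>. (\<lambda>j. \<tau> ((1 / real lam ^ Suc j) *\<^sub>R \<xi>)) has_prod fourier \<phi> \<xi>)"

text \<open>\<open>\<psi>\<close> is a family of mother wavelets of the system \<open>X(\<tau>, (q i : i \<in> I))\<close>; by injectivity of the
  Fourier transform it is unique up to null sets.\<close>

definition mother_wavelets ::
    "nat \<Rightarrow> (real^'n \<Rightarrow> complex) \<Rightarrow> 'i set \<Rightarrow> ('i \<Rightarrow> real^'n \<Rightarrow> complex) \<Rightarrow>
     ('i \<Rightarrow> real^'n \<Rightarrow> complex) \<Rightarrow> bool" where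
  "mother_wavelets lam \<tau> I q \<psi> \<longleftrightarrow> (\<exists>\<phi>. refinable_function lam \<tau> \<phi> \<and>
     (\<forall>i\<in>I. L1_fun (\<psi> i) \<and> L2_fun (\<psi> i) \<and>
        (\<forall>\<xi>. fourier (\<psi> i) (real lam *\<^sub>R \<xi>) = q i \<xi> * fourier \<phi> \<xi>)))"

end

theory Submission imports Defs begin

text \<open>The masks form a filter bank: writing \<open>\<phi>\<close> as a combination of the functions \<open>\<lambda>^(n/2) \<phi>(\<lambda>x + \<nu>\<^sub>l)\<close>, whose
  integer translates are all the translates at the next finer scale, the hypotheses on \<open>p\<^sub>l\<close> and \<open>g\<^sub>l\<close> give
  pointwise on the torus an identity between the bracket sums \<open>\<Sum>\<^sub>k \<langle>f, u(\<cdot> - k)\<rangle> e\<^sup>-\<^sup>i\<^sup>k\<^sup>\<xi>\<close> of \<open>\<phi>\<close>, of the mother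
  wavelets and of the finer scale. By Parseval the wavelet coefficients of level \<open>j\<close> carry exactly the
  increment of \<open>\<Sum>\<^sub>k |\<langle>f, \<phi>\<^sub>j\<^sub>,\<^sub>k\<rangle>|\<^sup>2\<close> from level \<open>j\<close> to level \<open>j + 1\<close>; the sum telescopes, and for continuous \<open>f\<close>
  of compact support its ends tend to \<open>\<parallel>f\<parallel>\<^sup>2\<close> (a Riemann sum) and to \<open>0\<close>. Density gives all of \<open>L\<^sup>2\<close>.

  Everything takes place on the space side, without the Plancherel theorem or a Paley--Wiener theorem.
  The function \<open>\<phi>\<close> is a weak limit of the cascade iterates of the indicator of the unit cube; these have uniformly
  bounded supports, and their norms stay bounded by 1 since \<open>|p\<^sub>l| \<le> 1\<close>. Any other choice of
  \<open>\<phi>\<close> and of the mother wavelets agrees almost everywhere, by injectivity of the Fourier transform on \<open>L\<^sup>1\<close>.\<close>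

subsection \<open>Square integrable functions\<close>

text \<open>The masks are shaped so that no generator has to leave the scale of \<phi>. Since
  \<tau>(\<xi>) times the transform of \<phi> at \<xi> is its transform at \<lambda>\<xi>, the masks
  \<open>q1\<close> amount to the factors conj g_l at frequency \<lambda>\<xi>, that is, to
  combinations of integer translates of \<phi>; likewise \<open>q2\<close> is a polyphase component
  of \<phi> minus h conj p_m applied to \<phi>, with h = \<lambda>^(-n/2). Let C_m be the brackets
  of the polyphase components, so that \<phi> has the bracket a = h \<Sum> conj p_m C_m. The second
  family then contributes \<Sum> |C_m|^2 - 2|a|^2 + h^2 \<Sum> |p_m|^2 |a|^2, and the sum-of-squares
  hypothesis makes the first family contribute exactly |a|^2 - h^2 \<Sum> |p_m|^2 |a|^2, the indices
  beyond N giving 0.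

  No orthogonality or stability of the translates of \<phi> is available, so the limit at fine
  scales cannot come from a projection; it rests on \<phi> having integral 1. Nor is \<phi> given as
  a function: its square integrability and compact support have to be extracted from an infinite
  product of transforms. Test functions of bounded support make every bracket a trigonometric
  polynomial, so that Parseval is a finite computation.\<close>

lemma borel_measurable_cnj [measurable (raw)]:
  "f \<in> borel_measurable M \<Longrightarrow> (\<lambda>x. cnj (f x)) \<in> borel_measurable M"
  by (rule borel_measurable_continuous_on[of cnj]) (auto intro: continuous_intros)

lemma L2_fun_measurable [measurable_dest]: "L2_fun f \<Longrightarrow> f \<in> borel_measurable borel"
  by (simp add: L2_fun_def)

lemma L2_fun_integrable: "L2_fun f \<Longrightarrow> integrable lborel (\<lambda>x. (cmod (f x))\<^sup>2)"
  by (simp add: L2_fun_def)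

lemma L2_fun_bound:
  assumes "integrable lborel h" "f \<in> borel_measurable borel" "\<And>x. (cmod (f x))\<^sup>2 \<le> h x"
  shows "L2_fun f"
  unfolding L2_fun_def
proof
  show "integrable lborel (\<lambda>x. (cmod (f x))\<^sup>2)"
    by (rule Bochner_Integration.integrable_bound[OF assms(1)])
      (use assms in \<open>auto intro: order_trans[OF assms(3) abs_ge_self]\<close>)
qed (use assms in auto)

lemma L2_fun_cmult: "L2_fun f \<Longrightarrow> L2_fun (\<lambda>x. c * f x)"
  unfolding L2_fun_def by (auto simp: norm_mult power_mult_distrib)

lemma cmod_add_square_le: "(cmod (a + b))\<^sup>2 \<le> 2 * (cmod a)\<^sup>2 + 2 * (cmod b)\<^sup>2"
proof -
  have "(cmod (a + b))\<^sup>2 \<le> (cmod a + cmod b)\<^sup>2"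
    by (simp add: norm_triangle_ineq power_mono)
  also have "\<dots> \<le> 2 * (cmod a)\<^sup>2 + 2 * (cmod b)\<^sup>2"
    using sum_squares_bound[of "cmod a" "cmod b"] by (simp add: power2_sum)
  finally show ?thesis .
qed

lemma L2_fun_add:
  assumes f: "L2_fun f" and g: "L2_fun g"
  shows "L2_fun (\<lambda>x. f x + g x)"
proof (rule L2_fun_bound)
  show "integrable lborel (\<lambda>x. 2 * (cmod (f x))\<^sup>2 + 2 * (cmod (g x))\<^sup>2)"
    using f g by (auto simp: L2_fun_def)
  show "(\<lambda>x. f x + g x) \<in> borel_measurable borel"
    using f g by measurable
qed (rule cmod_add_square_le)

lemma L2_fun_zero [simp]: "L2_fun (\<lambda>x. 0)"
  by (simp add: L2_fun_def)

lemma L2_fun_diff: "L2_fun f \<Longrightarrow> L2_fun g \<Longrightarrow> L2_fun (\<lambda>x. f x - g x)"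
  using L2_fun_add[of f "\<lambda>x. - 1 * g x"] L2_fun_cmult[of g "-1"] by simp

lemma mult_le_squares: "a * b \<le> a\<^sup>2 + (b::real)\<^sup>2"
  using sum_squares_bound[of a b] sum_power2_ge_zero[of a b] by linarith

lemma L2_inner_integrable:
  assumes f: "L2_fun f" and g: "L2_fun g"
  shows "integrable lborel (\<lambda>x. f x * cnj (g x))"
proof (rule Bochner_Integration.integrable_bound)
  show "integrable lborel (\<lambda>x. (cmod (f x))\<^sup>2 + (cmod (g x))\<^sup>2)"
    using f g by (auto simp: L2_fun_def)
  show "(\<lambda>x. f x * cnj (g x)) \<in> borel_measurable lborel"
    using f g by measurable
  show "AE x in lborel. cmod (f x * cnj (g x)) \<le> norm ((cmod (f x))\<^sup>2 + (cmod (g x))\<^sup>2)"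
    by (auto simp: norm_mult intro: order_trans[OF mult_le_squares])
qed

lemma L2_inner_diff_left: "L2_fun f \<Longrightarrow> L2_fun g \<Longrightarrow> L2_fun h \<Longrightarrow>
    L2_inner (\<lambda>x. f x - g x) h = L2_inner f h - L2_inner g h"
  unfolding L2_inner_def by (simp add: left_diff_distrib L2_inner_integrable)

lemma L2_inner_diff_right: "L2_fun f \<Longrightarrow> L2_fun g \<Longrightarrow> L2_fun h \<Longrightarrow>
    L2_inner h (\<lambda>x. f x - g x) = L2_inner h f - L2_inner h g"
  unfolding L2_inner_def by (simp add: right_diff_distrib L2_inner_integrable)

lemma L2_inner_cmult_right: "L2_inner f (\<lambda>x. c * g x) = cnj c * L2_inner f g"
  unfolding L2_inner_def by (simp flip: integral_mult_right_zero add: algebra_simps)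

lemma L2_inner_sum_right:
  assumes "\<And>i. i \<in> A \<Longrightarrow> L2_fun (g i)" "L2_fun f"
  shows "L2_inner f (\<lambda>x. \<Sum>i\<in>A. g i x) = (\<Sum>i\<in>A. L2_inner f (g i))"
  unfolding L2_inner_def cnj_sum sum_distrib_left
  by (rule Bochner_Integration.integral_sum) (use assms L2_inner_integrable in auto)

lemma L2_inner_cong_AE:
  assumes "AE x in lborel. g x = h x"
    and "g \<in> borel_measurable borel" "h \<in> borel_measurable borel" "f \<in> borel_measurable borel"
  shows "L2_inner f g = L2_inner f h"
  unfolding L2_inner_def
proof (rule integral_cong_AE)
  note [measurable] = assms(2-4)
  show "(\<lambda>x. f x * cnj (g x)) \<in> borel_measurable lborel" "(\<lambda>x. f x * cnj (h x)) \<in> borel_measurable lborel"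
    by measurable
qed (use assms(1) in auto)

section \<open>Cauchy-Schwarz and the triangle inequality\<close>

lemma L2_norm_fun_nonneg [simp]: "0 \<le> L2_norm_fun f"
  by (simp add: L2_norm_fun_def)

lemma L2_norm_fun_square: "(L2_norm_fun f)\<^sup>2 = (LINT x|lborel. (cmod (f x))\<^sup>2)"
  by (simp add: L2_norm_fun_def)

lemma L2_Cauchy_Schwarz_real:
  assumes f: "L2_fun f" and g: "L2_fun g"
  shows "integrable lborel (\<lambda>x. cmod (f x) * cmod (g x))"
    and "(LINT x|lborel. cmod (f x) * cmod (g x)) \<le> L2_norm_fun f * L2_norm_fun g"
proof -
  show int: "integrable lborel (\<lambda>x. cmod (f x) * cmod (g x))"
    using integrable_norm[OF L2_inner_integrable[OF f g]] by (simp add: norm_mult)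
  define r s where "r = L2_norm_fun f" and "s = L2_norm_fun g"
  have r2: "r\<^sup>2 = (LINT x|lborel. (cmod (f x))\<^sup>2)" and s2: "s\<^sup>2 = (LINT x|lborel. (cmod (g x))\<^sup>2)"
    by (simp_all add: r_def s_def L2_norm_fun_square)
  have nn: "r \<ge> 0" "s \<ge> 0" by (simp_all add: r_def s_def)
  \<comment> \<open>The quadratic argument below cancels r s, so a vanishing norm is treated
    separately: then one of the functions is 0 almost everywhere.\<close>
  have zero: "(LINT x|lborel. cmod (f x) * cmod (g x)) = 0"
    if "(LINT x|lborel. (cmod (h x))\<^sup>2) = 0" "L2_fun h" "h = f \<or> h = g" for h
  proof -
    have "AE x in lborel. (cmod (h x))\<^sup>2 = 0"
      using that integral_nonneg_eq_0_iff_AE[of lborel "\<lambda>x. (cmod (h x))\<^sup>2"]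
      by (simp add: L2_fun_def)
    then have "AE x in lborel. cmod (f x) * cmod (g x) = 0"
      by eventually_elim (use that in auto)
    then show ?thesis by (rule integral_eq_zero_AE)
  qed
  have "(LINT x|lborel. cmod (f x) * cmod (g x)) \<le> r * s"
  proof (cases "r = 0 \<or> s = 0")
    case True
    then have "(LINT x|lborel. cmod (f x) * cmod (g x)) = 0"
      using zero[of f] zero[of g] f g r2 s2 by auto
    then show ?thesis using nn by simp
  next
    case False
    then have pos: "r * s > 0" using nn by (simp add: less_le)
    \<comment> \<open>The crossed weights make both squares integrate to r^2 s^2, so the expansion
      has the factor 2 r s.\<close>
    have "0 \<le> (LINT x|lborel. (s * cmod (f x) - r * cmod (g x))\<^sup>2)" by simp
    also have "\<dots> = (LINT x|lborel. s\<^sup>2 * (cmod (f x))\<^sup>2 + r\<^sup>2 * (cmod (g x))\<^sup>2 -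
        (2 * (r * s)) * (cmod (f x) * cmod (g x)))"
      by (intro Bochner_Integration.integral_cong) (auto simp: power2_eq_square algebra_simps)
    also have "\<dots> = s\<^sup>2 * r\<^sup>2 + r\<^sup>2 * s\<^sup>2 - (2 * (r * s)) * (LINT x|lborel. cmod (f x) * cmod (g x))"
      unfolding r2 s2 using int f g by (subst Bochner_Integration.integral_diff) (auto simp: L2_fun_def)
    also have "\<dots> = 2 * (r * s) * (r * s - (LINT x|lborel. cmod (f x) * cmod (g x)))"
      by (simp add: power2_eq_square algebra_simps)
    finally have "0 \<le> 2 * (r * s) * (r * s - (LINT x|lborel. cmod (f x) * cmod (g x)))" .
    then show ?thesis using pos by (simp add: zero_le_mult_iff)
  qed
  then show "(LINT x|lborel. cmod (f x) * cmod (g x)) \<le> L2_norm_fun f * L2_norm_fun g"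
    by (simp add: r_def s_def)
qed

lemma L2_Cauchy_Schwarz:
  assumes f: "L2_fun f" and g: "L2_fun g"
  shows "cmod (L2_inner f g) \<le> L2_norm_fun f * L2_norm_fun g"
proof -
  have "cmod (L2_inner f g) \<le> (LINT x|lborel. cmod (f x * cnj (g x)))"
    unfolding L2_inner_def by (rule integral_norm_bound)
  also have "\<dots> \<le> L2_norm_fun f * L2_norm_fun g"
    using L2_Cauchy_Schwarz_real(2)[OF f g] by (simp add: norm_mult)
  finally show ?thesis .
qed

lemma L2_norm_fun_triangle:
  assumes f: "L2_fun f" and g: "L2_fun g"
  shows "L2_norm_fun (\<lambda>x. f x + g x) \<le> L2_norm_fun f + L2_norm_fun g"
proof (rule power2_le_imp_le)
  have "(L2_norm_fun (\<lambda>x. f x + g x))\<^sup>2 \<le>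
      (LINT x|lborel. (cmod (f x))\<^sup>2 + (cmod (g x))\<^sup>2 + 2 * (cmod (f x) * cmod (g x)))"
    unfolding L2_norm_fun_square
  proof (rule integral_mono)
    show "integrable lborel (\<lambda>x. (cmod (f x + g x))\<^sup>2)"
      using L2_fun_add[OF f g] by (simp add: L2_fun_def)
    show "integrable lborel (\<lambda>x. (cmod (f x))\<^sup>2 + (cmod (g x))\<^sup>2 + 2 * (cmod (f x) * cmod (g x)))"
      using f g L2_Cauchy_Schwarz_real(1)[OF f g] by (auto simp: L2_fun_def)
    show "(cmod (f x + g x))\<^sup>2 \<le> (cmod (f x))\<^sup>2 + (cmod (g x))\<^sup>2 + 2 * (cmod (f x) * cmod (g x))" for x
    proof -
      have "(cmod (f x + g x))\<^sup>2 \<le> (cmod (f x) + cmod (g x))\<^sup>2"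
        by (simp add: norm_triangle_ineq power_mono)
      then show ?thesis by (simp add: power2_sum)
    qed
  qed
  also have "\<dots> = (L2_norm_fun f)\<^sup>2 + (L2_norm_fun g)\<^sup>2 +
      2 * (LINT x|lborel. cmod (f x) * cmod (g x))"
    using f g L2_Cauchy_Schwarz_real(1)[OF f g] by (simp add: L2_fun_def L2_norm_fun_square)
  also have "\<dots> \<le> (L2_norm_fun f + L2_norm_fun g)\<^sup>2"
    using L2_Cauchy_Schwarz_real(2)[OF f g] by (simp add: power2_sum)
  finally show "(L2_norm_fun (\<lambda>x. f x + g x))\<^sup>2 \<le> (L2_norm_fun f + L2_norm_fun g)\<^sup>2" .
qed (simp add: add_nonneg_nonneg)

lemma L2_norm_fun_minus_commute: "L2_norm_fun (\<lambda>x. f x - g x) = L2_norm_fun (\<lambda>x. g x - f x)"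
  by (simp add: L2_norm_fun_def norm_minus_commute)

lemma L2_norm_fun_le_diff:
  assumes "L2_fun f" "L2_fun g"
  shows "L2_norm_fun f \<le> L2_norm_fun g + L2_norm_fun (\<lambda>x. f x - g x)"
  using L2_norm_fun_triangle[OF assms(2) L2_fun_diff[OF assms]] by simp

section \<open>Affine changes of variables\<close>

lemma nn_integral_affine:
  fixes t :: "'a::euclidean_space"
  assumes [measurable]: "f \<in> borel_measurable borel" and c: "c \<noteq> 0"
  shows "(\<integral>\<^sup>+x. f x \<partial>lborel) = ennreal (\<bar>c\<bar> ^ DIM('a)) * (\<integral>\<^sup>+x. f (t + c *\<^sub>R x) \<partial>lborel)"
  by (subst lborel_affine[OF c, of t])
     (simp add: nn_integral_density nn_integral_distr nn_integral_cmult)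

lemma integrable_affine:
  fixes f :: "'a::euclidean_space \<Rightarrow> 'b::{banach, second_countable_topology}"
  assumes f: "integrable lborel f" and c: "c \<noteq> 0"
  shows "integrable lborel (\<lambda>x. f (t + c *\<^sub>R x))"
proof -
  have [measurable]: "f \<in> borel_measurable borel" using f by auto
  have "(\<integral>\<^sup>+x. norm (f x) \<partial>lborel) < \<infinity>" using f by (simp add: integrable_iff_bounded)
  then show ?thesis
    unfolding integrable_iff_bounded using c
    by (subst (asm) nn_integral_affine[where c=c and t=t]) (auto simp: ennreal_mult_less_top)
qed

text \<open>The converse is the forward direction for the inverse map x -> (x - t) / c.\<close>

lemma integrable_affine_iff:
  fixes f :: "'a::euclidean_space \<Rightarrow> 'b::{banach, second_countable_topology}"
  assumes "c \<noteq> 0"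
  shows "integrable lborel (\<lambda>x. f (t + c *\<^sub>R x)) \<longleftrightarrow> integrable lborel f"
  using assms integrable_affine[of f c t]
    integrable_affine[of "\<lambda>x. f (t + c *\<^sub>R x)" "1/c" "- (1/c) *\<^sub>R t"]
  by (auto simp: scaleR_right_distrib scaleR_right_diff_distrib)

lemma integral_affine:
  fixes f :: "'a::euclidean_space \<Rightarrow> 'b::{banach, second_countable_topology}"
  assumes c: "c \<noteq> 0"
  shows "(LINT x|lborel. f x) = \<bar>c\<bar> ^ DIM('a) *\<^sub>R (LINT x|lborel. f (t + c *\<^sub>R x))"
proof (cases "integrable lborel f")
  case True
  then have [measurable]: "f \<in> borel_measurable borel" by auto
  show ?thesis
    using c True integrable_affine[OF True c, of t]
    by (subst lborel_affine[OF c, of t]) (simp add: integral_density integral_distr)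
next
  \<comment> \<open>Both sides are then 0, the value given to the integral of a non-integrable
    function.\<close>
  case False
  then show ?thesis
    using integrable_affine_iff[OF c, of f t] by (simp add: not_integrable_integral_eq)
qed

text \<open>A null set pulls back to a null set because the integral of its indicator changes only
  by a constant factor.\<close>

lemma AE_affine:
  fixes P :: "'a::euclidean_space \<Rightarrow> bool"
  assumes c: "c \<noteq> 0" and ae: "AE x in lborel. P x"
  shows "AE x in lborel. P (t + c *\<^sub>R x)"
proof -
  obtain N where N: "{x. \<not> P x} \<subseteq> N" "N \<in> sets borel" "emeasure lborel N = 0"
    using ae by (auto elim!: AE_E)
  have [measurable]: "N \<in> sets borel" by fact
  have "(\<integral>\<^sup>+x. indicator N x \<partial>lborel) = 0" using N by simp
  then have "(\<integral>\<^sup>+x. indicator N (t + c *\<^sub>R x) \<partial>lborel) = (0::ennreal)"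
    using c by (subst (asm) nn_integral_affine[where c=c and t=t]) auto
  then have "AE x in lborel. indicator N (t + c *\<^sub>R x) = (0::ennreal)"
    by (subst (asm) nn_integral_0_iff_AE) auto
  then show ?thesis
    by eventually_elim (use N in \<open>auto simp: indicator_def split: if_splits\<close>)
qed

lemma L2_fun_affine:
  assumes f: "L2_fun f" and c: "c \<noteq> 0"
  shows "L2_fun (\<lambda>x. f (t + c *\<^sub>R x))"
  unfolding L2_fun_def
proof
  show "integrable lborel (\<lambda>x. (cmod (f (t + c *\<^sub>R x)))\<^sup>2)"
    using integrable_affine[OF L2_fun_integrable[OF f] c, of t] by simp
  have [measurable]: "f \<in> borel_measurable borel" using f by measurable
  show "(\<lambda>x. f (t + c *\<^sub>R x)) \<in> borel_measurable lborel" by measurable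
qed

text \<open>The bounded support makes all sums over integer translates below finite.\<close>

definition cl2 :: "(real^'n \<Rightarrow> complex) \<Rightarrow> bool" where
  "cl2 u \<longleftrightarrow> L2_fun u \<and> (\<exists>R. \<forall>x. R < norm x \<longrightarrow> u x = 0)"

lemma cl2_L2: "cl2 u \<Longrightarrow> L2_fun u"
  by (simp add: cl2_def)

text \<open>Off the ball there is nothing to bound, and on it t \<le> t^2 + 1.\<close>

lemma L1_fun_of_L2_bounded_support:
  assumes u: "L2_fun u" and R: "\<And>x. R < norm x \<Longrightarrow> u x = 0"
  shows "L1_fun u"
  unfolding L1_fun_def
proof (rule Bochner_Integration.integrable_bound)
  show "integrable lborel (\<lambda>x. indicator (cball 0 R) x + (cmod (u x))\<^sup>2)"
    using u emeasure_bounded_finite[of "cball (0::real^'a) R"]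
    by (intro Bochner_Integration.integrable_add) (auto simp: L2_fun_def)
  show "AE x in lborel. cmod (u x) \<le> norm (indicator (cball 0 R) x + (cmod (u x))\<^sup>2)"
  proof (rule AE_I2)
    fix x
    show "cmod (u x) \<le> norm (indicator (cball 0 R) x + (cmod (u x))\<^sup>2)"
      using R[of x] mult_le_squares[of "cmod (u x)" 1]
      by (cases "R < norm x") (auto simp: indicator_def)
  qed
qed (use u in measurable)

lemma cl2_L1: "cl2 u \<Longrightarrow> L1_fun u"
  unfolding cl2_def using L1_fun_of_L2_bounded_support by blast

lemma cl2_cmult: "cl2 u \<Longrightarrow> cl2 (\<lambda>x. c * u x)"
  unfolding cl2_def using L2_fun_cmult by fastforce

lemma cl2_add: assumes "cl2 u" "cl2 v" shows "cl2 (\<lambda>x. u x + v x)"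
proof -
  obtain R S where "\<And>x. R < norm x \<Longrightarrow> u x = 0" "\<And>x. S < norm x \<Longrightarrow> v x = 0"
    using assms unfolding cl2_def by metis
  then have "max R S < norm x \<longrightarrow> u x + v x = 0" for x by simp
  then show ?thesis using assms L2_fun_add unfolding cl2_def by blast
qed

lemma cl2_zero [simp]: "cl2 (\<lambda>x. 0)"
  by (simp add: cl2_def)

lemma cl2_diff: "cl2 u \<Longrightarrow> cl2 v \<Longrightarrow> cl2 (\<lambda>x. u x - v x)"
  using cl2_add[of u "\<lambda>x. - 1 * v x"] cl2_cmult[of v "-1"] by simp

lemma cl2_sum: "(\<And>i. i \<in> A \<Longrightarrow> cl2 (u i)) \<Longrightarrow> cl2 (\<lambda>x. \<Sum>i\<in>A. u i x)"
  by (induction A rule: infinite_finite_induct) (auto intro: cl2_add)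

lemma cl2_affine:
  assumes u: "cl2 u" and c: "c \<noteq> 0"
  shows "cl2 (\<lambda>x. u (t + c *\<^sub>R x))"
proof -
  obtain R where R: "\<And>x. R < norm x \<Longrightarrow> u x = 0" using u unfolding cl2_def by blast
  have "u (t + c *\<^sub>R x) = 0" if "(R + norm t) / \<bar>c\<bar> < norm x" for x
  proof (rule R)
    have "R + norm t < norm (c *\<^sub>R x)" using that c by (simp add: field_simps)
    also have "\<dots> \<le> norm (t + c *\<^sub>R x) + norm t"
      by (metis add_diff_cancel_left' norm_triangle_ineq4 add.commute)
    finally show "R < norm (t + c *\<^sub>R x)" by simp
  qed
  then show ?thesis unfolding cl2_def using L2_fun_affine[OF cl2_L2[OF u] c] by blast
qed

subsection \<open>Injectivity of the Fourier transform and density of continuous functions\<close>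

lemma fourier_integrable:
  assumes "L1_fun f"
  shows "integrable lborel (\<lambda>x. f x * exp (- \<i> * complex_of_real (x \<bullet> \<xi>)))"
proof (rule Bochner_Integration.integrable_bound)
  show "integrable lborel f" using assms by (simp add: L1_fun_def)
  then have [measurable]: "f \<in> borel_measurable borel" by auto
  show "(\<lambda>x. f x * exp (- \<i> * complex_of_real (x \<bullet> \<xi>))) \<in> borel_measurable lborel"
    by measurable
qed (simp add: norm_mult)

lemma L1_fun_bounded_mult:
  assumes f: "L1_fun f" and [measurable]: "u \<in> borel_measurable borel" and B: "\<And>x. cmod (u x) \<le> B"
  shows "L1_fun (\<lambda>x. u x * f x)"
  unfolding L1_fun_def
proof (rule Bochner_Integration.integrable_bound)
  show "integrable lborel (\<lambda>x. B * cmod (f x))" using f by (simp add: L1_fun_def)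
  have [measurable]: "f \<in> borel_measurable borel" using f by (auto simp: L1_fun_def)
  show "(\<lambda>x. u x * f x) \<in> borel_measurable lborel" by measurable
  have "0 \<le> B" using B[of undefined] norm_ge_zero order_trans by blast
  then show "AE x in lborel. cmod (u x * f x) \<le> norm (B * cmod (f x))"
    using B by (auto simp: norm_mult intro!: mult_right_mono)
qed

lemma L1_fun_cmult: "L1_fun f \<Longrightarrow> L1_fun (\<lambda>x. c * f x)"
  by (simp add: L1_fun_def)

lemma L1_fun_add: "L1_fun f \<Longrightarrow> L1_fun g \<Longrightarrow> L1_fun (\<lambda>x. f x + g x)"
  by (simp add: L1_fun_def)

lemma L1_fun_diff: "L1_fun f \<Longrightarrow> L1_fun g \<Longrightarrow> L1_fun (\<lambda>x. f x - g x)"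
  by (simp add: L1_fun_def)

lemma fourier_cmult: "fourier (\<lambda>x. c * f x) \<xi> = c * fourier f \<xi>"
  unfolding fourier_def by (simp flip: integral_mult_right_zero add: mult.assoc)

lemma fourier_add:
  "L1_fun f \<Longrightarrow> L1_fun g \<Longrightarrow> fourier (\<lambda>x. f x + g x) \<xi> = fourier f \<xi> + fourier g \<xi>"
  using fourier_integrable[of f \<xi>] fourier_integrable[of g \<xi>]
  unfolding fourier_def by (simp add: distrib_right)

lemma fourier_diff:
  "L1_fun f \<Longrightarrow> L1_fun g \<Longrightarrow> fourier (\<lambda>x. f x - g x) \<xi> = fourier f \<xi> - fourier g \<xi>"
  using fourier_integrable[of f \<xi>] fourier_integrable[of g \<xi>]
  unfolding fourier_def by (simp add: left_diff_distrib)

lemma fourier_sum: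
  "(\<And>i. i \<in> A \<Longrightarrow> L1_fun (f i)) \<Longrightarrow> fourier (\<lambda>x. \<Sum>i\<in>A. f i x) \<xi> = (\<Sum>i\<in>A. fourier (f i) \<xi>)"
  unfolding fourier_def sum_distrib_right
  by (rule Bochner_Integration.integral_sum) (rule fourier_integrable)

text \<open>Taken at the frequency c \<eta> to suit the relation between \<lambda>\<xi> and \<xi>: c
  = \<lambda> and t = \<nu>_l give the polyphase components, c = 1 gives translation.\<close>

lemma fourier_affine:
  fixes u :: "real^'n \<Rightarrow> complex"
  assumes c: "c \<noteq> 0"
  shows "fourier (\<lambda>x. u (t + c *\<^sub>R x)) (c *\<^sub>R \<eta>) =
    exp (\<i> * complex_of_real (t \<bullet> \<eta>)) * fourier u \<eta> / of_real (\<bar>c\<bar> ^ CARD('n))"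
proof -
  have "fourier u \<eta> = of_real (\<bar>c\<bar> ^ CARD('n)) *
      (LINT x|lborel. u (t + c *\<^sub>R x) * exp (- \<i> * complex_of_real ((t + c *\<^sub>R x) \<bullet> \<eta>)))"
    unfolding fourier_def
    by (subst integral_affine[OF c, of _ t]) (simp add: scaleR_conv_of_real)
  also have "(\<lambda>x. u (t + c *\<^sub>R x) * exp (- \<i> * complex_of_real ((t + c *\<^sub>R x) \<bullet> \<eta>))) =
      (\<lambda>x. exp (- \<i> * complex_of_real (t \<bullet> \<eta>)) *
        (u (t + c *\<^sub>R x) * exp (- \<i> * complex_of_real (x \<bullet> (c *\<^sub>R \<eta>)))))"
  proof
    fix x
    have "exp (- \<i> * complex_of_real ((t + c *\<^sub>R x) \<bullet> \<eta>)) =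
        exp (- \<i> * complex_of_real (t \<bullet> \<eta>)) * exp (- \<i> * complex_of_real (x \<bullet> (c *\<^sub>R \<eta>)))"
      unfolding exp_add[symmetric] by (simp add: inner_add_left algebra_simps)
    then show "u (t + c *\<^sub>R x) * exp (- \<i> * complex_of_real ((t + c *\<^sub>R x) \<bullet> \<eta>)) =
        exp (- \<i> * complex_of_real (t \<bullet> \<eta>)) *
        (u (t + c *\<^sub>R x) * exp (- \<i> * complex_of_real (x \<bullet> (c *\<^sub>R \<eta>))))"
      by simp
  qed
  finally have "fourier u \<eta> = of_real (\<bar>c\<bar> ^ CARD('n)) * exp (- \<i> * complex_of_real (t \<bullet> \<eta>)) *
      fourier (\<lambda>x. u (t + c *\<^sub>R x)) (c *\<^sub>R \<eta>)"
    by (simp add: fourier_def)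
  then show ?thesis using c by (simp add: field_simps exp_minus)
qed

lemma fourier_translate:
  fixes u :: "real^'n \<Rightarrow> complex"
  shows "fourier (\<lambda>x. u (x - a)) \<eta> = exp (- \<i> * complex_of_real (a \<bullet> \<eta>)) * fourier u \<eta>"
  using fourier_affine[of 1 u "-a" \<eta>] by simp

section \<open>Injectivity of the Fourier transform by means of multipliers\<close>

definition fourier_null :: "(real^'n \<Rightarrow> complex) \<Rightarrow> bool" where
  "fourier_null f \<longleftrightarrow> L1_fun f \<and> (\<forall>\<xi>. fourier f \<xi> = 0)"

text \<open>Modulation only shifts the transform, so the multipliers that preserve a vanishing
  transform form an algebra containing all characters. Stone-Weierstrass then reaches continuous
  functions without an inversion formula.\<close>

definition null_multiplier :: "(real^'n \<Rightarrow> complex) \<Rightarrow> bool" where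
  "null_multiplier u \<longleftrightarrow> (\<forall>f. fourier_null f \<longrightarrow> fourier_null (\<lambda>x. u x * f x))"

lemma null_multiplier_const: "null_multiplier (\<lambda>x. c)"
  by (simp add: null_multiplier_def fourier_null_def L1_fun_cmult fourier_cmult)

lemma null_multiplier_add:
  "null_multiplier u \<Longrightarrow> null_multiplier v \<Longrightarrow> null_multiplier (\<lambda>x. u x + v x)"
  by (simp add: null_multiplier_def fourier_null_def L1_fun_add fourier_add distrib_right)

lemma null_multiplier_mult:
  "null_multiplier u \<Longrightarrow> null_multiplier v \<Longrightarrow> null_multiplier (\<lambda>x. u x * v x)"
  by (simp add: null_multiplier_def mult.assoc)

lemma null_multiplier_sum:
  "(\<And>i. i \<in> A \<Longrightarrow> null_multiplier (u i)) \<Longrightarrow> null_multiplier (\<lambda>x. \<Sum>i\<in>A. u i x)"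
  by (induction A rule: infinite_finite_induct)
    (auto intro: null_multiplier_add null_multiplier_const[of 0])

lemma null_multiplier_exp:
  fixes a :: "real^'n"
  shows "null_multiplier (\<lambda>x. exp (\<i> * complex_of_real (x \<bullet> a)))"
  unfolding null_multiplier_def fourier_null_def
proof (intro allI impI conjI)
  fix f :: "real^'n \<Rightarrow> complex" and \<xi>
  assume f: "L1_fun f \<and> (\<forall>\<xi>. fourier f \<xi> = 0)"
  then show "L1_fun (\<lambda>x. exp (\<i> * complex_of_real (x \<bullet> a)) * f x)"
    by (intro L1_fun_bounded_mult[where B=1]) auto
  have "fourier (\<lambda>x. exp (\<i> * complex_of_real (x \<bullet> a)) * f x) \<xi> = fourier f (\<xi> - a)"
    unfolding fourier_def
  proof (intro Bochner_Integration.integral_cong refl)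
    fix x
    have "exp (\<i> * complex_of_real (x \<bullet> a)) * exp (- \<i> * complex_of_real (x \<bullet> \<xi>)) =
        exp (- \<i> * complex_of_real (x \<bullet> (\<xi> - a)))"
      unfolding exp_add[symmetric] by (simp add: inner_diff_right algebra_simps)
    then show "exp (\<i> * complex_of_real (x \<bullet> a)) * f x * exp (- \<i> * complex_of_real (x \<bullet> \<xi>)) =
        f x * exp (- \<i> * complex_of_real (x \<bullet> (\<xi> - a)))"
      by (metis mult.assoc mult.commute)
  qed
  then show "fourier (\<lambda>x. exp (\<i> * complex_of_real (x \<bullet> a)) * f x) \<xi> = 0" using f by simp
qed

lemma null_multiplier_sin: "null_multiplier (\<lambda>x::real^'n. complex_of_real (sin (d * x $ i)))"
proof -
  have eq: "(\<lambda>x::real^'n. complex_of_real (sin (d * x $ i))) =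
      (\<lambda>x. 1 / (2 * \<i>) * exp (\<i> * complex_of_real (x \<bullet> axis i d)) +
      (- 1 / (2 * \<i>)) * exp (\<i> * complex_of_real (x \<bullet> axis i (- d))))"
    by (simp add: inner_axis sin_of_real[symmetric] sin_exp_eq diff_divide_distrib
        right_diff_distrib mult.commute)
  show ?thesis unfolding eq
    by (intro null_multiplier_add null_multiplier_mult null_multiplier_const null_multiplier_exp)
qed

text \<open>A polynomial in the x_i themselves need not keep f integrable; composed with sines it is
  a finite combination of characters.\<close>

lemma null_multiplier_polynomial_sin:
  fixes P :: "real^'n \<Rightarrow> real"
  assumes "real_polynomial_function P"
  shows "null_multiplier (\<lambda>x. complex_of_real (P (\<chi> i. sin (d * x $ i))))"
  using assms
proof (induction rule: real_polynomial_function.induct)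
  case (linear f)
  interpret bounded_linear f by fact
  have "f (\<chi> i. sin (d * x $ i)) = (\<Sum>i\<in>UNIV. sin (d * x $ i) * f (axis i 1))" for x :: "real^'n"
  proof -
    have "(\<chi> i. sin (d * x $ i)) = (\<Sum>i\<in>UNIV. sin (d * x $ i) *\<^sub>R axis i 1)"
      by (simp add: vec_eq_iff axis_def if_distrib cong: if_cong)
    then show ?thesis by (simp add: sum scale)
  qed
  then show ?case
    by (auto intro!: null_multiplier_sum null_multiplier_mult null_multiplier_sin null_multiplier_const)
qed (auto intro: null_multiplier_const null_multiplier_add null_multiplier_mult)

lemma fourier_at_0: "fourier f 0 = (LINT x|lborel. f x)"
  by (simp add: fourier_def)

lemma L1_fun_of_real_mult:
  assumes "L1_fun f" "g \<in> borel_measurable borel" "\<And>x. \<bar>g x\<bar> \<le> B"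
  shows "L1_fun (\<lambda>x. complex_of_real (g x) * f x)"
  by (rule L1_fun_bounded_mult) (use assms in auto)

text \<open>The vector of the sin(d x_i) stays in the cube [-1,1]^n, where a polynomial P is
  uniformly within e of g. The part with P integrates to 0, being a transform at frequency 0, and
  the rest is at most e times the L^1 norm of f.\<close>

lemma fourier_null_integral_sin:
  fixes g :: "real^'n \<Rightarrow> real"
  assumes f: "fourier_null f" and g: "continuous_on UNIV g" and B: "\<And>x. \<bar>g x\<bar> \<le> B"
  shows "(LINT x|lborel. complex_of_real (g (\<chi> i. sin (d * x $ i))) * f x) = 0"
proof -
  define s :: "real^'n \<Rightarrow> real^'n" where "s x = (\<chi> i. sin (d * x $ i))" for x
  have s_cont: "continuous_on UNIV s" unfolding s_def by (intro continuous_intros)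
  then have s_meas: "s \<in> borel_measurable borel" by (rule borel_measurable_continuous_onI)
  have s_range: "s x \<in> cbox (-1) 1" for x by (simp add: s_def mem_box_cart)
  have f1: "L1_fun f" using f by (simp add: fourier_null_def)
  let ?J = "LINT x|lborel. complex_of_real (g (s x)) * f x"
  have gm: "(\<lambda>x. g (s x)) \<in> borel_measurable borel"
    by (intro borel_measurable_continuous_onI continuous_on_compose2[OF g s_cont]) auto
  have int_g: "L1_fun (\<lambda>x. complex_of_real (g (s x)) * f x)"
    by (rule L1_fun_of_real_mult[OF f1 gm B])
  have "cmod ?J \<le> e * (LINT x|lborel. cmod (f x))" if "e > 0" for e
  proof -
    obtain P where P: "real_polynomial_function P" "\<And>x. x \<in> cbox (-1) 1 \<Longrightarrow> \<bar>g x - P x\<bar> < e"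
      using Stone_Weierstrass_real_polynomial_function[of "cbox (-1) 1" g e]
        continuous_on_subset[OF g] \<open>e > 0\<close> by auto
    let ?d = "\<lambda>x. complex_of_real (g (s x)) * f x - complex_of_real (P (s x)) * f x"
    have null: "fourier_null (\<lambda>x. complex_of_real (P (s x)) * f x)"
      using null_multiplier_polynomial_sin[OF P(1), of d] f
      unfolding null_multiplier_def s_def by blast
    have int_P: "L1_fun (\<lambda>x. complex_of_real (P (s x)) * f x)"
      using null by (simp add: fourier_null_def)
    have "fourier (\<lambda>x. complex_of_real (P (s x)) * f x) 0 = 0"
      using null by (simp add: fourier_null_def)
    then have "?J = ?J - (LINT x|lborel. complex_of_real (P (s x)) * f x)"
      by (simp add: fourier_at_0)
    also have "\<dots> = (LINT x|lborel. ?d x)"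
      using int_g int_P by (simp add: L1_fun_def)
    finally have eq: "?J = (LINT x|lborel. ?d x)" .
    have "cmod ?J \<le> (LINT x|lborel. cmod (?d x))"
      using integral_norm_bound[of lborel "?d"]
      unfolding eq[symmetric] .
    also have "\<dots> \<le> (LINT x|lborel. e * cmod (f x))"
    proof (rule integral_mono)
      show "integrable lborel (\<lambda>x. cmod (?d x))"
        using int_g int_P by (simp add: L1_fun_def)
      show "integrable lborel (\<lambda>x. e * cmod (f x))" using f1 by (simp add: L1_fun_def)
      show "cmod (?d x) \<le> e * cmod (f x)" for x
      proof -
        have "complex_of_real (g (s x)) * f x - complex_of_real (P (s x)) * f x =
            complex_of_real (g (s x) - P (s x)) * f x"
          by (simp add: left_diff_distrib)
        then have "cmod (?d x) =
            \<bar>g (s x) - P (s x)\<bar> * cmod (f x)"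
          by (simp only: norm_mult norm_of_real)
        also have "\<dots> \<le> e * cmod (f x)"
          using P(2)[OF s_range, of x] by (intro mult_right_mono) auto
        finally show ?thesis .
      qed
    qed
    finally show ?thesis by simp
  qed
  then have "cmod ?J \<le> 0 + e" if "e > 0" for e
  proof -
    define I where "I = (LINT x|lborel. cmod (f x))"
    have "I \<ge> 0" by (simp add: I_def)
    \<comment> \<open>The added 1 covers the case I = 0.\<close>
    then have "e / (I + 1) > 0" using that by simp
    then have "cmod ?J \<le> e / (I + 1) * I"
      unfolding I_def by (rule \<open>\<And>e. e > 0 \<Longrightarrow> cmod ?J \<le> e * (LINT x|lborel. cmod (f x))\<close>)
    also have "\<dots> \<le> e" using \<open>I \<ge> 0\<close> that by (simp add: field_simps)
    finally show ?thesis by simp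
  qed
  then have "cmod ?J \<le> 0" by (rule field_le_epsilon)
  then show ?thesis by (simp add: s_def)
qed

lemma sin_scaled_tendsto: "(\<lambda>n. real (Suc n) * sin (x / real (Suc n))) \<longlonglongrightarrow> x"
proof (cases "x = 0")
  case False
  have "(\<lambda>n. x / real (Suc n)) \<longlonglongrightarrow> 0"
    using LIMSEQ_Suc[OF lim_const_over_n[of x]] by simp
  moreover have "\<forall>\<^sub>F n in sequentially. x / real (Suc n) \<noteq> 0"
    using False by (simp add: eventually_sequentially)
  ultimately have "filterlim (\<lambda>n. x / real (Suc n)) (at 0) sequentially"
    by (simp add: filterlim_at)
  then have "(\<lambda>n. sin (x / real (Suc n)) / (x / real (Suc n))) \<longlonglongrightarrow> 1"
    using filterlim_compose[of "\<lambda>h. sin h / h" "nhds 1" "at 0"] DERIV_D[OF DERIV_sin[of "0::real"]]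
    by (simp del: of_nat_Suc divide_divide_eq_right)
  from tendsto_mult[OF tendsto_const[of x] this] show ?thesis
    using False by (simp add: mult.commute)
qed simp

text \<open>The maps x_i -> m sin(x_i / m) tend to the identity, so dominated convergence leads from
  periodic test functions to all bounded continuous ones.\<close>

lemma fourier_null_integral_bounded_continuous:
  fixes g :: "real^'n \<Rightarrow> real"
  assumes f: "fourier_null f" and g: "continuous_on UNIV g" and B: "\<And>x. \<bar>g x\<bar> \<le> B"
  shows "(LINT x|lborel. complex_of_real (g x) * f x) = 0"
proof -
  have f1: "integrable lborel f" using f by (simp add: fourier_null_def L1_fun_def)
  then have [measurable]: "f \<in> borel_measurable borel" by auto
  have [measurable]: "g \<in> borel_measurable borel" by (rule borel_measurable_continuous_onI[OF g])
  define t :: "nat \<Rightarrow> real^'n \<Rightarrow> real^'n"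
    where "t n x = (\<chi> i. real (Suc n) * sin (x $ i / real (Suc n)))" for n x
  have t_cont: "continuous_on UNIV (t n)" for n unfolding t_def by (intro continuous_intros) auto
  then have [measurable]: "t n \<in> borel_measurable borel" for n by (rule borel_measurable_continuous_onI)
  have "(\<lambda>n. LINT x|lborel. complex_of_real (g (t n x)) * f x) \<longlonglongrightarrow>
      (LINT x|lborel. complex_of_real (g x) * f x)"
  proof (rule integral_dominated_convergence)
    show "integrable lborel (\<lambda>x. B * cmod (f x))" using f1 by simp
    show "AE x in lborel. (\<lambda>n. complex_of_real (g (t n x)) * f x) \<longlonglongrightarrow> complex_of_real (g x) * f x"
    proof (rule AE_I2)
      fix x
      have "(\<lambda>n. t n x) \<longlonglongrightarrow> x"
          unfolding t_def by (rule vec_tendstoI) (simp add: sin_scaled_tendsto del: of_nat_Suc)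
      moreover have "isCont g x" using g by (simp add: continuous_on_eq_continuous_at)
      ultimately have "(\<lambda>n. g (t n x)) \<longlonglongrightarrow> g x" by (rule isCont_tendsto_compose[rotated])
      then show "(\<lambda>n. complex_of_real (g (t n x)) * f x) \<longlonglongrightarrow> complex_of_real (g x) * f x"
        by (intro tendsto_intros)
    qed
    show "AE x in lborel. cmod (complex_of_real (g (t n x)) * f x) \<le> B * cmod (f x)" for n
      using B by (auto simp: norm_mult intro!: mult_right_mono)
  qed measurable
  moreover have "(LINT x|lborel. complex_of_real (g (t n x)) * f x) = 0" for n
  proof -
    \<comment> \<open>The outer factor \<open>Suc n\<close> is absorbed into the test function,
      which keeps the bound B; the frequency is then d = 1 / \<open>Suc n\<close>.\<close>
    have "continuous_on UNIV (\<lambda>y. g (real (Suc n) *\<^sub>R y))"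
      by (intro continuous_on_compose2[OF g] continuous_intros) auto
    from fourier_null_integral_sin[OF f this B, of "1 / real (Suc n)"]
    show ?thesis by (simp add: t_def scaleR_vec_def del: of_nat_Suc)
  qed
  ultimately show ?thesis using LIMSEQ_unique[OF _ tendsto_const] by auto
qed

text \<open>Approximation almost everywhere by continuous functions does not respect the bound; the
  radial retraction \<open>c\<close> onto the disc of radius B restores it and fixes the values of
  h.\<close>

lemma bounded_measurable_approx:
  fixes h :: "real^'n \<Rightarrow> complex"
  assumes h: "h \<in> borel_measurable borel" and B: "\<And>x. cmod (h x) \<le> B" and "B > 0"
  obtains g where "\<And>n::nat. continuous_on UNIV (g n)" "\<And>n x. cmod (g n x) \<le> B"
    "AE x in lborel. (\<lambda>n. g n x) \<longlonglongrightarrow> h x"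
proof -
  have "h \<in> borel_measurable lebesgue"
    using h by (simp add: measurable_completion)
  then have "h measurable_on UNIV"
    by (rule lebesgue_measurable_imp_measurable_on) simp
  then obtain N g where N: "negligible N" and cont: "\<And>n::nat. continuous_on UNIV (g n)"
    and lim: "\<And>x. x \<notin> N \<Longrightarrow> (\<lambda>n. g n x) \<longlonglongrightarrow> h x"
    unfolding measurable_on_def by auto
  define c :: "complex \<Rightarrow> complex" where "c z = complex_of_real (B / max B (cmod z)) * z" for z
  have pos: "max B (cmod z) \<noteq> 0" for z using \<open>B > 0\<close> by auto
  have c_cont: "continuous_on UNIV c"
    unfolding c_def by (intro continuous_intros) (use pos in auto)
  have c_bound: "cmod (c z) \<le> B" for z
    using \<open>B > 0\<close> by (auto simp: c_def norm_mult norm_divide max_def field_simps)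
  have c_id: "c z = z" if "cmod z \<le> B" for z
    using that \<open>B > 0\<close> by (simp add: c_def max_def)
  show thesis
  proof (rule that[of "\<lambda>n x. c (g n x)"])
    show "continuous_on UNIV (\<lambda>x. c (g n x))" for n
      by (rule continuous_on_compose2[OF c_cont cont]) auto
    show "cmod (c (g n x)) \<le> B" for n x by (rule c_bound)
    have "AE x in lebesgue. x \<notin> N"
      using N by (simp add: negligible_iff_null_sets AE_not_in)
    then have "AE x in lborel. x \<notin> N" by (simp add: AE_completion_iff)
    then show "AE x in lborel. (\<lambda>n. c (g n x)) \<longlonglongrightarrow> h x"
    proof eventually_elim
      case (elim x)
      have "isCont c (h x)" using c_cont by (simp add: continuous_on_eq_continuous_at)
      from isCont_tendsto_compose[OF this lim[OF elim]] show ?case by (simp add: c_id B)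
    qed
  qed
qed

text \<open>Testing against h = conj(sgn f) turns f into |f|. This h is bounded but merely
  measurable, hence the passage through the continuous functions \<open>g n\<close>.\<close>

lemma fourier_null_AE_zero:
  fixes f :: "real^'n \<Rightarrow> complex"
  assumes f: "fourier_null f"
  shows "AE x in lborel. f x = 0"
proof -
  have f1: "integrable lborel f" using f by (simp add: fourier_null_def L1_fun_def)
  then have [measurable]: "f \<in> borel_measurable borel" by auto
  define h where "h x = cnj (sgn (f x))" for x
  have [measurable]: "h \<in> borel_measurable borel" unfolding h_def sgn_div_norm by measurable
  have "cmod (h x) \<le> 1" for x by (simp add: h_def norm_sgn)
  then obtain g where cont: "\<And>n::nat. continuous_on UNIV (g n)" and bd: "\<And>n x. cmod (g n x) \<le> 1"
    and lim: "AE x in lborel. (\<lambda>n. g n x) \<longlonglongrightarrow> h x"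
    using bounded_measurable_approx[of h 1] by auto
  have [measurable]: "g n \<in> borel_measurable borel" for n
    by (rule borel_measurable_continuous_onI[OF cont])
  have int0: "(LINT x|lborel. g n x * f x) = 0" for n
  proof -
    have re: "(LINT x|lborel. complex_of_real (Re (g n x)) * f x) = 0"
      using order_trans[OF abs_Re_le_cmod bd]
      by (intro fourier_null_integral_bounded_continuous[OF f, where B=1] continuous_intros cont)
    have im: "(LINT x|lborel. complex_of_real (Im (g n x)) * f x) = 0"
      using order_trans[OF abs_Im_le_cmod bd]
      by (intro fourier_null_integral_bounded_continuous[OF f, where B=1] continuous_intros cont)
    have i1: "integrable lborel (\<lambda>x. complex_of_real (Re (g n x)) * f x)"
      and i2: "integrable lborel (\<lambda>x. complex_of_real (Im (g n x)) * f x)"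
      using L1_fun_of_real_mult[of f "\<lambda>x. Re (g n x)" 1] L1_fun_of_real_mult[of f "\<lambda>x. Im (g n x)" 1]
        f1 order_trans[OF abs_Re_le_cmod bd] order_trans[OF abs_Im_le_cmod bd]
      by (auto simp: L1_fun_def)
    have "(LINT x|lborel. g n x * f x) =
        (LINT x|lborel. complex_of_real (Re (g n x)) * f x + \<i> * (complex_of_real (Im (g n x)) * f x))"
      by (intro Bochner_Integration.integral_cong) (auto simp: complex_eq_iff algebra_simps)
    then show ?thesis using re im i1 i2 by simp
  qed
  have "(\<lambda>n. LINT x|lborel. g n x * f x) \<longlonglongrightarrow> (LINT x|lborel. h x * f x)"
  proof (rule integral_dominated_convergence)
    show "integrable lborel (\<lambda>x. cmod (f x))" using f1 by simp
    show "AE x in lborel. (\<lambda>n. g n x * f x) \<longlonglongrightarrow> h x * f x"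
      using lim by eventually_elim (intro tendsto_intros)
    show "AE x in lborel. cmod (g n x * f x) \<le> cmod (f x)" for n
      using mult_right_mono[OF bd[of n] norm_ge_zero] by (intro AE_I2) (simp add: norm_mult)
  qed measurable
  then have "(LINT x|lborel. h x * f x) = 0"
    unfolding int0 using LIMSEQ_unique[OF _ tendsto_const] by auto
  moreover have "h x * f x = complex_of_real (cmod (f x))" for x
  proof (cases "f x = 0")
    case False
    have "h x * f x = of_real ((cmod (f x))\<^sup>2) / of_real (cmod (f x))"
      unfolding complex_norm_square by (simp add: h_def sgn_div_norm scaleR_conv_of_real field_simps)
    then show ?thesis using False by (simp add: power2_eq_square)
  qed simp
  ultimately have "(LINT x|lborel. cmod (f x)) = 0" by simp
  then have "AE x in lborel. cmod (f x) = 0"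
    using integral_nonneg_eq_0_iff_AE[of lborel "\<lambda>x. cmod (f x)"] f1 by simp
  then show ?thesis by simp
qed

lemma fourier_inject:
  assumes "L1_fun f" "L1_fun g" "\<And>\<xi>. fourier f \<xi> = fourier g \<xi>"
  shows "AE x in lborel. f x = g x"
  using fourier_null_AE_zero[of "\<lambda>x. f x - g x"] assms
  by (simp add: fourier_null_def L1_fun_diff fourier_diff)


section \<open>Density of continuous functions with bounded support in L^2\<close>

lemma integrable_indicator_cball: "integrable lborel (indicat_real (cball (x::'a::euclidean_space) R))"
  using emeasure_bounded_finite[of "cball x R"] by (intro integrable_real_indicator) auto

lemma L2_approx_bounded:
  fixes f :: "real^'n \<Rightarrow> complex"
  assumes f: "L2_fun f" and "e > 0"
  obtains h B R where "h \<in> borel_measurable borel" "\<And>x. cmod (h x) \<le> B" "B > 0"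
    "\<And>x. R < norm x \<Longrightarrow> h x = 0" "L2_norm_fun (\<lambda>x. f x - h x) < e" "L2_fun h"
proof -
  have [measurable]: "f \<in> borel_measurable borel" using f by measurable
  define h where "h n x = (if norm x \<le> real n \<and> cmod (f x) \<le> real n then f x else 0)" for n x
  have hm [measurable]: "h n \<in> borel_measurable borel" for n unfolding h_def by measurable
  have "(\<lambda>n. LINT x|lborel. (cmod (f x - h n x))\<^sup>2) \<longlonglongrightarrow> (LINT x|(lborel :: (real^'n) measure). 0)"
  proof (rule integral_dominated_convergence)
    show "integrable lborel (\<lambda>x. (cmod (f x))\<^sup>2)" using f by (simp add: L2_fun_def)
    show "AE x in lborel. (\<lambda>n. (cmod (f x - h n x))\<^sup>2) \<longlonglongrightarrow> 0"
    proof (rule AE_I2, rule tendsto_eventually)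
      fix x
      obtain n0 :: nat where n0: "max (norm x) (cmod (f x)) \<le> real n0" using real_arch_simple by blast
      show "\<forall>\<^sub>F n in sequentially. (cmod (f x - h n x))\<^sup>2 = 0"
        using eventually_ge_at_top[of n0]
      proof eventually_elim
        case (elim n)
        then have "real n0 \<le> real n" by simp
        then show ?case using n0 by (auto simp: h_def)
      qed
    qed
    show "AE x in lborel. norm ((cmod (f x - h n x))\<^sup>2) \<le> (cmod (f x))\<^sup>2" for n
      by (rule AE_I2) (simp add: h_def)
  qed measurable
  then have "(\<lambda>n. L2_norm_fun (\<lambda>x. f x - h n x)) \<longlonglongrightarrow> 0"
    unfolding L2_norm_fun_def by (auto dest: tendsto_real_sqrt)
  then have "\<forall>\<^sub>F n in sequentially. L2_norm_fun (\<lambda>x. f x - h n x) < e"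
    using \<open>e > 0\<close> by (rule order_tendstoD)
  then obtain n where n: "L2_norm_fun (\<lambda>x. f x - h n x) < e"
    by (auto simp: eventually_sequentially)
  show thesis
  proof (rule that)
    \<comment> \<open>The bound has to be positive, and n may be 0.\<close>
    show "cmod (h n x) \<le> real n + 1" for x by (simp add: h_def)
    show "h n x = 0" if "real n < norm x" for x using that by (simp add: h_def)
    show "L2_fun (h n)"
      by (rule L2_fun_bound[OF L2_fun_integrable[OF f]]) (auto simp: h_def)
  qed (use n in \<open>auto simp: h_def\<close>)
qed

lemma L2_approx_bounded_continuous:
  fixes h :: "real^'n \<Rightarrow> complex"
  assumes hm: "h \<in> borel_measurable borel" and B: "\<And>x. cmod (h x) \<le> B" "B > 0"
    and R: "\<forall>x. R < norm x \<longrightarrow> h x = 0" and "e > 0"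
  obtains g S where "continuous_on UNIV g" "\<And>x. S < norm x \<Longrightarrow> g x = 0"
    "L2_norm_fun (\<lambda>x. h x - g x) < e"
proof -
  obtain g where cont: "\<And>n::nat. continuous_on UNIV (g n)" and bd: "\<And>n x. cmod (g n x) \<le> B"
    and lim: "AE x in lborel. (\<lambda>n. g n x) \<longlonglongrightarrow> h x"
    using bounded_measurable_approx[OF hm B] by auto
  \<comment> \<open>A continuous cutoff, 1 on the ball of radius R and 0 beyond R + 1, so that
    multiplication by it leaves h alone.\<close>
  define c where "c x = max 0 (min 1 (R + 1 - norm x))" for x :: "real^'n"
  have c01: "0 \<le> c x" "c x \<le> 1" for x by (auto simp: c_def)
  have c_cont: "continuous_on UNIV c" unfolding c_def by (intro continuous_intros)
  define G where "G n x = complex_of_real (c x) * g n x" for n x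
  have G_cont: "continuous_on UNIV (G n)" for n
    unfolding G_def by (intro continuous_intros cont c_cont)
  have G_bd: "cmod (G n x) \<le> B" for n x
    using mult_mono[OF c01(2) bd[of n x]] c01[of x] by (simp add: G_def norm_mult)
  have G_supp: "G n x = 0" if "R + 1 < norm x" for n x
    using that by (simp add: G_def c_def)
  have ch: "complex_of_real (c x) * h x = h x" for x
    using R[rule_format, of x] by (cases "R < norm x") (auto simp: c_def)
  note [measurable] = hm borel_measurable_continuous_onI[OF G_cont]
  have "(\<lambda>n. LINT x|lborel. (cmod (h x - G n x))\<^sup>2) \<longlonglongrightarrow> (LINT x|(lborel :: (real^'n) measure). 0)"
  proof (rule integral_dominated_convergence)
    show "integrable lborel (\<lambda>x. (2 * B)\<^sup>2 * indicator (cball 0 (R + 1)) x)"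
      by (intro integrable_mult_right integrable_indicator_cball)
    show "AE x in lborel. (\<lambda>n. (cmod (h x - G n x))\<^sup>2) \<longlonglongrightarrow> 0"
      using lim
    proof eventually_elim
      case (elim x)
      have "(\<lambda>n. (cmod (h x - complex_of_real (c x) * g n x))\<^sup>2) \<longlonglongrightarrow>
          (cmod (h x - complex_of_real (c x) * h x))\<^sup>2"
        by (intro tendsto_intros elim)
      then show ?case by (simp add: G_def ch)
    qed
    show "AE x in lborel. norm ((cmod (h x - G n x))\<^sup>2) \<le> (2 * B)\<^sup>2 * indicator (cball 0 (R + 1)) x" for n
    proof (rule AE_I2)
      fix x
      show "norm ((cmod (h x - G n x))\<^sup>2) \<le> (2 * B)\<^sup>2 * indicator (cball 0 (R + 1)) x"
      proof (cases "R + 1 < norm x")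
        case True
        then show ?thesis using R[rule_format, of x] G_supp[of x n] by simp
      next
        case False
        have "cmod (h x - G n x) \<le> 2 * B"
          using norm_triangle_ineq4[of "h x" "G n x"] B(1)[of x] G_bd[of n x] by linarith
        then show ?thesis using False power_mono[of "cmod (h x - G n x)" "2 * B" 2] by simp
      qed
    qed
  qed measurable
  then have "(\<lambda>n. L2_norm_fun (\<lambda>x. h x - G n x)) \<longlonglongrightarrow> 0"
    unfolding L2_norm_fun_def by (auto dest: tendsto_real_sqrt)
  then have "\<forall>\<^sub>F n in sequentially. L2_norm_fun (\<lambda>x. h x - G n x) < e"
    using \<open>e > 0\<close> by (rule order_tendstoD)
  then obtain n where n: "L2_norm_fun (\<lambda>x. h x - G n x) < e"
    by (auto simp: eventually_sequentially)
  show thesis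
    by (rule that[OF G_cont G_supp n])
qed

text \<open>Continuity is what the Riemann sums at fine scales need, bounded support what keeps them
  finite.\<close>

definition cc :: "(real^'n \<Rightarrow> complex) \<Rightarrow> bool" where
  "cc f \<longleftrightarrow> continuous_on UNIV f \<and> (\<exists>R. \<forall>x. R < norm x \<longrightarrow> f x = 0)"

lemma cc_bounded:
  assumes "cc f"
  obtains B where "\<And>x. cmod (f x) \<le> B" "B > 0"
proof -
  obtain R where R: "\<And>x. R < norm x \<Longrightarrow> f x = 0" using assms by (auto simp: cc_def)
  have "compact (f ` cball 0 R)"
    using assms compact_continuous_image[OF continuous_on_subset[OF _ subset_UNIV] compact_cball]
    unfolding cc_def by blast
  then have "bounded (f ` cball 0 R)" by (rule compact_imp_bounded)
  then obtain B where B: "\<And>x. x \<in> cball 0 R \<Longrightarrow> cmod (f x) \<le> B"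
    unfolding bounded_iff by blast
  have "cmod (f x) \<le> max B 1" for x
    using R[of x] B[of x] by (cases "R < norm x") auto
  then show thesis using that[of "max B 1"] by auto
qed

lemma cc_cl2:
  assumes f: "cc f" shows "cl2 f"
proof -
  obtain B where B: "\<And>x. cmod (f x) \<le> B" "B > 0" using cc_bounded[OF f] by blast
  obtain R where R: "\<And>x. R < norm x \<Longrightarrow> f x = 0" using f by (auto simp: cc_def)
  have "L2_fun f"
  proof (rule L2_fun_bound)
    show "integrable lborel (\<lambda>x. B\<^sup>2 * indicator (cball 0 R) x)"
      by (intro integrable_mult_right integrable_indicator_cball)
    show "f \<in> borel_measurable borel"
      using f by (auto simp: cc_def intro: borel_measurable_continuous_onI)
    show "(cmod (f x))\<^sup>2 \<le> B\<^sup>2 * indicator (cball 0 R) x" for x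
      using R[of x] power_mono[OF B(1)[of x], of 2] by (cases "R < norm x") auto
  qed
  then show ?thesis using R unfolding cl2_def by blast
qed

lemma cc_dense_L2:
  assumes f: "L2_fun f" and "e > 0"
  obtains g where "cc g" "L2_norm_fun (\<lambda>x. f x - g x) < e"
proof -
  obtain h B R where h: "h \<in> borel_measurable borel" "\<And>x. cmod (h x) \<le> B" "B > 0"
    "\<And>x. R < norm x \<Longrightarrow> h x = 0" "L2_norm_fun (\<lambda>x. f x - h x) < e / 2" "L2_fun h"
    by (rule L2_approx_bounded[OF f half_gt_zero[OF \<open>e > 0\<close>]]) (rule that, assumption+)
  obtain g S where g: "continuous_on UNIV g" "\<And>x. S < norm x \<Longrightarrow> g x = 0"
    "L2_norm_fun (\<lambda>x. h x - g x) < e / 2"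
    by (rule L2_approx_bounded_continuous[OF h(1-3) _ half_gt_zero[OF \<open>e > 0\<close>]])
      (use h(4) in blast, rule that, assumption+)
  have gc: "cc g" using g by (auto simp: cc_def)
  have "L2_norm_fun (\<lambda>x. (f x - h x) + (h x - g x)) \<le>
      L2_norm_fun (\<lambda>x. f x - h x) + L2_norm_fun (\<lambda>x. h x - g x)"
    by (intro L2_norm_fun_triangle L2_fun_diff f h cl2_L2[OF cc_cl2[OF gc]])
  then have "L2_norm_fun (\<lambda>x. f x - g x) < e" using h g by simp
  then show thesis using that gc by blast
qed

subsection \<open>Bracket sums and Parseval\<close>

lemma ivec_add: "ivec (a + b) = ivec a + ivec b"
  by (simp add: ivec_def vec_eq_iff)

lemma ivec_diff: "ivec (a - b) = ivec a - ivec b"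
  by (simp add: ivec_def vec_eq_iff)

lemma ivec_zero [simp]: "ivec 0 = 0"
  by (simp add: ivec_def vec_eq_iff)

lemma finite_int_box: "finite {k::int^'n. \<forall>i. k $ i \<in> A}" if "finite (A::int set)"
proof -
  have "{k::int^'n. \<forall>i. k $ i \<in> A} \<subseteq> vec_lambda ` (PiE UNIV (\<lambda>_. A))"
  proof
    fix k :: "int^'n" assume "k \<in> {k. \<forall>i. k $ i \<in> A}"
    then have "k = vec_lambda (\<lambda>i. k $ i)" "(\<lambda>i. k $ i) \<in> PiE UNIV (\<lambda>_. A)" by auto
    then show "k \<in> vec_lambda ` (PiE UNIV (\<lambda>_. A))" by (rule image_eqI)
  qed
  moreover have "finite (vec_lambda ` (PiE (UNIV::'n set) (\<lambda>_. A)))"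
    using that by (intro finite_imageI finite_PiE) auto
  ultimately show ?thesis by (rule finite_subset)
qed

lemma finite_ivec_norm_le: "finite {k::int^'n. norm (ivec k) \<le> R}"
proof (rule finite_subset)
  show "{k::int^'n. norm (ivec k) \<le> R} \<subseteq> {k. \<forall>i. k $ i \<in> {-\<lceil>R\<rceil>..\<lceil>R\<rceil>}}"
  proof safe
    fix k :: "int^'n" and i assume "norm (ivec k) \<le> R"
    then have "\<bar>real_of_int (k $ i)\<bar> \<le> R"
      using component_le_norm_cart[of "ivec k" i] by (simp add: ivec_def)
    then show "k $ i \<in> {-\<lceil>R\<rceil>..\<lceil>R\<rceil>}" by (auto simp: le_ceiling_iff) linarith+
  qed
qed (rule finite_int_box, simp)

section \<open>Trigonometric polynomials acting by translations\<close>

definition tp_rep :: "(real^'n \<Rightarrow> complex) \<Rightarrow> (int^'n) set \<times> (int^'n \<Rightarrow> complex)" where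
  "tp_rep p = (SOME (K, h). finite K \<and>
     (\<forall>\<xi>. p \<xi> = (\<Sum>k\<in>K. h k * exp (- \<i> * complex_of_real (ivec k \<bullet> \<xi>)))))"

text \<open>The frequency set fixed by \<open>tp_rep\<close> is not canonical, as zero coefficients
  may occur; only the expansion and its finiteness matter.\<close>

definition tp_supp :: "(real^'n \<Rightarrow> complex) \<Rightarrow> (int^'n) set" where "tp_supp p = fst (tp_rep p)"

definition tp_coef :: "(real^'n \<Rightarrow> complex) \<Rightarrow> int^'n \<Rightarrow> complex" where "tp_coef p = snd (tp_rep p)"

lemma tp_rep:
  assumes "trig_poly p"
  shows finite_tp_supp: "finite (tp_supp p)"
    and tp_expand: "p \<xi> = (\<Sum>k\<in>tp_supp p. tp_coef p k * exp (- \<i> * complex_of_real (ivec k \<bullet> \<xi>)))"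
proof -
  let ?P = "\<lambda>(K, h). finite K \<and> (\<forall>\<xi>. p \<xi> = (\<Sum>k\<in>K. h k * exp (- \<i> * complex_of_real (ivec k \<bullet> \<xi>))))"
  obtain K h where "?P (K, h)"
    using assms unfolding trig_poly_def by auto
  then have "?P (tp_rep p)" unfolding tp_rep_def by (rule someI)
  then show "finite (tp_supp p)"
    and "p \<xi> = (\<Sum>k\<in>tp_supp p. tp_coef p k * exp (- \<i> * complex_of_real (ivec k \<bullet> \<xi>)))"
    by (auto simp: tp_supp_def tp_coef_def split: prod.splits)
qed

lemma trig_poly_cnj:
  assumes "trig_poly p" shows "trig_poly (\<lambda>\<xi>. cnj (p \<xi>))"
proof -
  obtain K h where K: "finite K"
    and p: "\<And>\<xi>. p \<xi> = (\<Sum>k\<in>K. h k * exp (- \<i> * complex_of_real (ivec k \<bullet> \<xi>)))"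
    using assms unfolding trig_poly_def by blast
  have "cnj (p \<xi>) = (\<Sum>k\<in>uminus ` K. cnj (h (- k)) * exp (- \<i> * complex_of_real (ivec k \<bullet> \<xi>)))" for \<xi>
  proof -
    have "ivec (- k) = - ivec k" for k :: "int^'a" by (simp add: ivec_def vec_eq_iff)
    then show ?thesis
      unfolding p by (subst sum.reindex) (auto simp: exp_cnj)
  qed
  moreover have "finite (uminus ` K)" using K by simp
  ultimately show ?thesis
    unfolding trig_poly_def
    by (intro exI[of _ "uminus ` K"] exI[of _ "\<lambda>k. cnj (h (- k))"] conjI allI)
qed

text \<open>The trigonometric polynomial \<open>p\<close> acting as a combination of integer translations, so that
  the Fourier transform turns the action into multiplication by \<open>p\<close>.\<close>

definition tp_op :: "(real^'n \<Rightarrow> complex) \<Rightarrow> (real^'n \<Rightarrow> complex) \<Rightarrow> real^'n \<Rightarrow> complex" where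
  "tp_op p u = (\<lambda>x. \<Sum>k\<in>tp_supp p. tp_coef p k * u (x - ivec k))"

lemma L1_fun_translate: "L1_fun u \<Longrightarrow> L1_fun (\<lambda>x. u (x - a))"
  using integrable_affine[of u 1 "-a"] by (simp add: L1_fun_def)

lemma cl2_translate: "cl2 u \<Longrightarrow> cl2 (\<lambda>x. u (x - a))"
  using cl2_affine[of u 1 "-a"] by simp

lemma cl2_tp_op: "cl2 u \<Longrightarrow> cl2 (tp_op p u)"
  unfolding tp_op_def by (intro cl2_sum cl2_cmult cl2_translate)

lemma fourier_tp_op:
  assumes p: "trig_poly p" and u: "L1_fun u"
  shows "fourier (tp_op p u) \<xi> = p \<xi> * fourier u \<xi>"
proof -
  have "fourier (tp_op p u) \<xi> = (\<Sum>k\<in>tp_supp p. tp_coef p k * fourier (\<lambda>x. u (x - ivec k)) \<xi>)"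
    unfolding tp_op_def
    by (subst fourier_sum) (intro L1_fun_cmult L1_fun_translate u, simp add: fourier_cmult)
  also have "\<dots> = p \<xi> * fourier u \<xi>"
    by (subst tp_expand[OF p, of \<xi>]) (simp add: fourier_translate sum_distrib_right mult.assoc)
  finally show ?thesis .
qed

section \<open>Bracket sums and energies\<close>

definition tr_coef :: "(real^'n \<Rightarrow> complex) \<Rightarrow> (real^'n \<Rightarrow> complex) \<Rightarrow> int^'n \<Rightarrow> complex" where
  "tr_coef f u k = L2_inner f (\<lambda>x. u (x - ivec k))"

definition ek :: "int^'n \<Rightarrow> real^'n \<Rightarrow> complex" where
  "ek k \<xi> = exp (- \<i> * complex_of_real (ivec k \<bullet> \<xi>))"

text \<open>Formally, by Poisson summation, the periodization of the transform of f times the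
  conjugate transform of u, known as the bracket product. The sum form avoids Plancherel and has
  finitely many nonzero terms for \<open>cl2\<close> functions.\<close>

definition bracket :: "(real^'n \<Rightarrow> complex) \<Rightarrow> (real^'n \<Rightarrow> complex) \<Rightarrow> real^'n \<Rightarrow> complex" where
  "bracket f u \<xi> = (\<Sum>\<^sub>\<infinity>k. tr_coef f u k * ek k \<xi>)"

text \<open>By Parseval, the mean of |bracket|^2 over the torus.\<close>

definition energy :: "(real^'n \<Rightarrow> complex) \<Rightarrow> (real^'n \<Rightarrow> complex) \<Rightarrow> real" where
  "energy f u = (\<Sum>\<^sub>\<infinity>k. (cmod (tr_coef f u k))\<^sup>2)"

lemma ek_add: "ek (k + m) \<xi> = ek k \<xi> * ek m \<xi>"
  unfolding ek_def exp_add[symmetric] by (simp add: ivec_add inner_add_left algebra_simps)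

lemma ek_cnj: "ek m \<xi> * cnj (ek m \<xi>) = 1"
  unfolding ek_def exp_cnj exp_add[symmetric] by simp

lemma ek_diff: "ek (k - m) \<xi> = ek k \<xi> * cnj (ek m \<xi>)"
  unfolding ek_def exp_cnj exp_add[symmetric] by (simp add: ivec_diff inner_diff_left algebra_simps)

text \<open>If k is longer than R + S, the ball of radius S about k misses the ball of radius R
  about 0.\<close>

lemma tr_coef_finite:
  assumes "cl2 f" "cl2 u"
  shows "finite {k. tr_coef f u k \<noteq> 0}"
proof -
  obtain R S where R: "\<And>x. R < norm x \<Longrightarrow> f x = 0" and S: "\<And>x. S < norm x \<Longrightarrow> u x = 0"
    using assms unfolding cl2_def by metis
  have "{k. tr_coef f u k \<noteq> 0} \<subseteq> {k. norm (ivec k) \<le> R + S}"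
  proof safe
    fix k assume nz: "tr_coef f u k \<noteq> 0"
    have "\<exists>x. f x * cnj (u (x - ivec k)) \<noteq> 0"
    proof (rule ccontr)
      assume "\<nexists>x. f x * cnj (u (x - ivec k)) \<noteq> 0"
      then have "(\<lambda>x. f x * cnj (u (x - ivec k))) = (\<lambda>x. 0)" by blast
      then show False using nz unfolding tr_coef_def L2_inner_def by simp
    qed
    then obtain x where "f x \<noteq> 0" "u (x - ivec k) \<noteq> 0" by auto
    then have "norm x \<le> R" "norm (x - ivec k) \<le> S" using R S by (meson not_le)+
    then show "norm (ivec k) \<le> R + S"
      using norm_triangle_ineq4[of x "x - ivec k"] by simp
  qed
  then show ?thesis using finite_ivec_norm_le finite_subset by blast
qed

lemma finite_support_has_sum:
  assumes "finite {k. F k \<noteq> 0}"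
  shows "(F has_sum (\<Sum>\<^sub>\<infinity>k. F k)) UNIV"
  using finite_nonzero_values_imp_summable_on[of UNIV F] assms by simp

lemma bracket_has_sum:
  assumes "cl2 f" "cl2 u"
  shows "((\<lambda>k. tr_coef f u k * ek k \<xi>) has_sum bracket f u \<xi>) UNIV"
  unfolding bracket_def
  by (rule finite_support_has_sum, rule finite_subset[OF _ tr_coef_finite[OF assms]]) auto

lemma energy_has_sum:
  assumes "cl2 f" "cl2 u"
  shows "((\<lambda>k. (cmod (tr_coef f u k))\<^sup>2) has_sum energy f u) UNIV"
  unfolding energy_def
  by (rule finite_support_has_sum, rule finite_subset[OF _ tr_coef_finite[OF assms]]) auto

lemma bracket_eqI:
  "((\<lambda>k. tr_coef f u k * ek k \<xi>) has_sum s) UNIV \<Longrightarrow> bracket f u \<xi> = s"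
  unfolding bracket_def by (rule infsumI)

lemma has_sum_finite_sum:
  fixes f :: "'a \<Rightarrow> 'b \<Rightarrow> 'c::topological_comm_monoid_add"
  assumes "\<And>i. i \<in> A \<Longrightarrow> ((f i) has_sum s i) B"
  shows "((\<lambda>k. \<Sum>i\<in>A. f i k) has_sum (\<Sum>i\<in>A. s i)) B"
  using assms by (induction A rule: infinite_finite_induct) (auto intro: has_sum_add)

lemma bracket_cmult:
  assumes f: "cl2 f" and u: "cl2 u"
  shows "bracket f (\<lambda>x. c * u x) \<xi> = cnj c * bracket f u \<xi>"
proof (rule bracket_eqI)
  show "((\<lambda>k. tr_coef f (\<lambda>x. c * u x) k * ek k \<xi>) has_sum cnj c * bracket f u \<xi>) UNIV"
    using has_sum_cmult_right[OF bracket_has_sum[OF f u], of "cnj c" \<xi>]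
    by (simp add: tr_coef_def L2_inner_cmult_right mult.assoc)
qed

lemma bracket_sum:
  assumes f: "cl2 f" and u: "\<And>i. i \<in> A \<Longrightarrow> cl2 (u i)"
  shows "bracket f (\<lambda>x. \<Sum>i\<in>A. u i x) \<xi> = (\<Sum>i\<in>A. bracket f (u i) \<xi>)"
proof (rule bracket_eqI)
  have "tr_coef f (\<lambda>x. \<Sum>i\<in>A. u i x) k = (\<Sum>i\<in>A. tr_coef f (u i) k)" for k
    unfolding tr_coef_def
    by (rule L2_inner_sum_right) (auto intro: cl2_L2 cl2_translate u f)
  then show "((\<lambda>k. tr_coef f (\<lambda>x. \<Sum>i\<in>A. u i x) k * ek k \<xi>) has_sum (\<Sum>i\<in>A. bracket f (u i) \<xi>)) UNIV"
    using has_sum_finite_sum[of A "\<lambda>i k. tr_coef f (u i) k * ek k \<xi>" UNIV "\<lambda>i. bracket f (u i) \<xi>"]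
      bracket_has_sum[OF f u] by (simp add: sum_distrib_right)
qed

lemma bracket_diff:
  assumes f: "cl2 f" and u: "cl2 u" and v: "cl2 v"
  shows "bracket f (\<lambda>x. u x - v x) \<xi> = bracket f u \<xi> - bracket f v \<xi>"
proof (rule bracket_eqI)
  have "tr_coef f (\<lambda>x. u x - v x) k = tr_coef f u k + (- 1) * tr_coef f v k" for k
    unfolding tr_coef_def
    by (subst L2_inner_diff_right) (auto intro: cl2_L2 cl2_translate u v f)
  then show "((\<lambda>k. tr_coef f (\<lambda>x. u x - v x) k * ek k \<xi>) has_sum (bracket f u \<xi> - bracket f v \<xi>)) UNIV"
    using has_sum_add[OF bracket_has_sum[OF f u, of \<xi>] has_sum_cmult_right[OF bracket_has_sum[OF f v, of \<xi>], of "-1"]]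
    by (simp add: left_diff_distrib)
qed

lemma bracket_translate:
  assumes f: "cl2 f" and u: "cl2 u"
  shows "bracket f (\<lambda>x. u (x - ivec m)) \<xi> = cnj (ek m \<xi>) * bracket f u \<xi>"
proof (rule bracket_eqI)
  have eq: "tr_coef f (\<lambda>x. u (x - ivec m)) k * ek k \<xi> =
      cnj (ek m \<xi>) * (tr_coef f u (k + m) * ek (k + m) \<xi>)" for k
  proof -
    have "tr_coef f (\<lambda>x. u (x - ivec m)) k = tr_coef f u (k + m)"
      by (simp add: tr_coef_def ivec_add diff_diff_add)
    moreover have "cnj (ek m \<xi>) * (tr_coef f u (k + m) * (ek k \<xi> * ek m \<xi>)) =
        tr_coef f u (k + m) * ek k \<xi> * (ek m \<xi> * cnj (ek m \<xi>))" by simp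
    ultimately show ?thesis by (simp add: ek_add ek_cnj)
  qed
  have "bij (\<lambda>k::int^'a. k + m)" by (rule bij_plus_right)
  then have "((\<lambda>k. tr_coef f u (k + m) * ek (k + m) \<xi>) has_sum bracket f u \<xi>) UNIV"
    using has_sum_reindex_bij_betw[of "\<lambda>k. k + m" UNIV UNIV "\<lambda>k. tr_coef f u k * ek k \<xi>"]
      bracket_has_sum[OF f u] by blast
  from has_sum_cmult_right[OF this, of "cnj (ek m \<xi>)"]
  show "((\<lambda>k. tr_coef f (\<lambda>x. u (x - ivec m)) k * ek k \<xi>) has_sum cnj (ek m \<xi>) * bracket f u \<xi>) UNIV"
    by (simp add: eq)
qed

text \<open>Translating u shifts the index of the coefficients, and the second slot of the inner
  product is antilinear; hence the conjugate. The conjugates in the wavelet masks thus turn into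
  plain factors g_l and p_m of brackets.\<close>

lemma bracket_tp_op:
  assumes p: "trig_poly p" and f: "cl2 f" and u: "cl2 u"
  shows "bracket f (tp_op p u) \<xi> = cnj (p \<xi>) * bracket f u \<xi>"
proof -
  have "bracket f (tp_op p u) \<xi> =
      (\<Sum>k\<in>tp_supp p. bracket f (\<lambda>x. tp_coef p k * u (x - ivec k)) \<xi>)"
    unfolding tp_op_def by (rule bracket_sum[OF f]) (intro cl2_cmult cl2_translate u)
  also have "\<dots> = (\<Sum>k\<in>tp_supp p. cnj (tp_coef p k) * (cnj (ek k \<xi>) * bracket f u \<xi>))"
    by (intro sum.cong refl) (simp only: bracket_cmult[OF f cl2_translate[OF u]] bracket_translate[OF f u])
  also have "\<dots> = cnj (p \<xi>) * bracket f u \<xi>"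
    by (subst tp_expand[OF p, of \<xi>]) (simp add: ek_def cnj_sum sum_distrib_right mult.assoc)
  finally show ?thesis .
qed

text \<open>Averaging over the points \<open>2\<pi>t/R\<close> of the torus replaces the integral over the torus: it
  is exact on trigonometric polynomials of degree below \<open>R\<close>.\<close>

definition grid :: "nat \<Rightarrow> (int^'n) set" where
  "grid R = {t. \<forall>i. t $ i \<in> {0..<int R}}"

definition grid_mean :: "nat \<Rightarrow> (real^'n \<Rightarrow> 'b::real_vector) \<Rightarrow> 'b" where
  "grid_mean R F = (1 / real R ^ CARD('n)) *\<^sub>R (\<Sum>t\<in>grid R. F ((2 * pi / real R) *\<^sub>R ivec t))"

lemma sum_grid_prod:
  fixes F :: "'n::finite \<Rightarrow> int \<Rightarrow> 'b::comm_semiring_1"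
  shows "(\<Sum>t\<in>(grid R :: (int^'n) set). \<Prod>i\<in>UNIV. F i (t $ i)) = (\<Prod>i\<in>UNIV. \<Sum>s\<in>{0..<int R}. F i s)"
proof -
  have "bij_betw vec_lambda (PiE UNIV (\<lambda>_. {0..<int R})) (grid R :: (int^'n) set)"
    by (rule bij_betw_byWitness[where f' = vec_nth]) (auto simp: grid_def)
  then have "(\<Sum>t\<in>(grid R :: (int^'n) set). \<Prod>i\<in>UNIV. F i (t $ i)) =
      (\<Sum>s\<in>PiE UNIV (\<lambda>_. {0..<int R}). \<Prod>i\<in>UNIV. F i (vec_lambda s $ i))"
    by (rule sum.reindex_bij_betw[symmetric])
  then show ?thesis by (simp add: prod_sum_PiE)
qed

lemma card_grid: "card (grid R :: (int^'n) set) = R ^ CARD('n)"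
  using sum_grid_prod[where F = "\<lambda>(i::'n) s. 1::nat" and R = R] by simp

text \<open>The sum factors over the coordinates. Where k has a nonzero entry, of size below R, the
  factor is a full geometric sum over a nontrivial R-th root of unity.\<close>

lemma sum_grid_ek:
  fixes k :: "int^'n"
  assumes "k \<noteq> 0" and less: "\<And>i. \<bar>k $ i\<bar> < int R"
  shows "(\<Sum>t\<in>grid R. ek k ((2 * pi / real R) *\<^sub>R ivec t)) = 0"
proof -
  \<comment> \<open>Any coordinate will do: \<open>less\<close> puts an absolute value strictly
    below R.\<close>
  have R: "R > 0" using less[of undefined] by (cases R) auto
  define w where "w i = exp (\<i> * complex_of_real (- 2 * pi * real_of_int (k $ i) / real R))" for i
  have ek_prod: "ek k ((2 * pi / real R) *\<^sub>R ivec t) = (\<Prod>i\<in>UNIV. w i ^ nat (t $ i))" if "t \<in> grid R" for t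
  proof -
    have "ek k ((2 * pi / real R) *\<^sub>R ivec t) =
        exp (\<Sum>i\<in>UNIV. of_nat (nat (t $ i)) * (\<i> * complex_of_real (- 2 * pi * real_of_int (k $ i) / real R)))"
      using that unfolding ek_def
      by (simp add: inner_vec_def ivec_def sum_distrib_left sum_negf[symmetric] grid_def
          mult.commute mult.left_commute)
    also have "\<dots> = (\<Prod>i\<in>UNIV. w i ^ nat (t $ i))"
      by (simp only: exp_sum[OF finite] w_def exp_of_nat_mult)
    finally show ?thesis .
  qed
  have "(\<Sum>t\<in>grid R. ek k ((2 * pi / real R) *\<^sub>R ivec t)) = (\<Sum>t\<in>grid R. \<Prod>i\<in>UNIV. w i ^ nat (t $ i))"
    by (rule sum.cong) (auto simp: ek_prod)
  also have "\<dots> = (\<Prod>i\<in>UNIV. \<Sum>s\<in>{0..<int R}. w i ^ nat s)"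
    by (rule sum_grid_prod)
  also have "\<dots> = 0"
  proof -
    obtain i where i: "k $ i \<noteq> 0" using \<open>k \<noteq> 0\<close> by (auto simp: vec_eq_iff)
    have wR: "w i ^ R = 1"
    proof -
      have "w i ^ R = exp (of_nat R * (\<i> * complex_of_real (- 2 * pi * real_of_int (k $ i) / real R)))"
        by (simp only: w_def exp_of_nat_mult)
      also have "of_nat R * (\<i> * complex_of_real (- 2 * pi * real_of_int (k $ i) / real R)) =
          2 * of_int (- k $ i) * complex_of_real pi * \<i>"
        using R by simp
      also have "exp \<dots> = 1"
        unfolding exp_eq_1 by (intro conjI exI[of _ "- (k $ i)"]) (simp_all)
      finally show ?thesis .
    qed
    \<comment> \<open>Otherwise the entry k_i would be a nonzero multiple of R.\<close>
    have w1: "w i \<noteq> 1"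
    proof
      assume "w i = 1"
      then obtain m :: int where "- 2 * pi * real_of_int (k $ i) / real R = of_int (2 * m) * pi"
        by (auto simp: w_def exp_eq_1)
      then have "- 2 * pi * real_of_int (k $ i) = of_int (2 * m) * pi * real R"
        using R by (simp only: divide_eq_eq)
      then have "(2 * pi) * (- real_of_int (k $ i)) = (2 * pi) * (of_int m * real R)"
        by (simp only: of_int_mult of_int_numeral mult.assoc mult.commute mult.left_commute mult_minus_left mult_minus_right)
      then have "- real_of_int (k $ i) = of_int m * real R"
        by (subst (asm) mult_left_cancel) auto
      then have "real_of_int (- (k $ i)) = real_of_int (m * int R)" by simp
      then have km: "- (k $ i) = m * int R" by (simp only: of_int_eq_iff)
      then have "\<bar>k $ i\<bar> = \<bar>m\<bar> * int R" by (metis abs_minus_cancel abs_mult abs_of_nat)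
      moreover have "m \<noteq> 0" using km i by auto
      then have "\<bar>m\<bar> \<ge> 1" by linarith
      ultimately have "int R \<le> \<bar>k $ i\<bar>" by (simp add: mult_le_cancel_right1)
      then show False using less[of i] by simp
    qed
    have "(\<Sum>s\<in>{0..<int R}. w i ^ nat s) = (\<Sum>s<R. w i ^ s)"
      by (rule sum.reindex_bij_witness[where i = int and j = nat]) auto
    also have "\<dots> = 0" using w1 wR by (simp add: geometric_sum)
    finally show ?thesis by (intro prod_zero) auto
  qed
  finally show ?thesis .
qed

text \<open>Expanding the square produces the frequencies k - m, whose entries are below R in size,
  so only the diagonal survives the average.\<close>

lemma grid_mean_square:
  fixes c :: "int^'n \<Rightarrow> complex"
  assumes K: "finite K" and "R > 0"
    and R: "\<And>k m i. k \<in> K \<Longrightarrow> m \<in> K \<Longrightarrow> \<bar>k $ i - m $ i\<bar> < int R"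
  shows "grid_mean R (\<lambda>\<xi>. (cmod (\<Sum>k\<in>K. c k * ek k \<xi>))\<^sup>2) = (\<Sum>k\<in>K. (cmod (c k))\<^sup>2)"
proof -
  let ?x = "\<lambda>t. (2 * pi / real R) *\<^sub>R ivec t"
  let ?N = "real R ^ CARD('n)"
  have orth: "(\<Sum>t\<in>grid R. ek (k - m) (?x t)) = (if m = k then of_real ?N else 0)"
    if "k \<in> K" "m \<in> K" for k m
  proof (cases "m = k")
    case True
    then show ?thesis by (simp add: ek_def card_grid)
  next
    case False
    then show ?thesis using sum_grid_ek[of "k - m" R] R[OF that] by simp
  qed
  have "complex_of_real (\<Sum>t\<in>grid R. (cmod (\<Sum>k\<in>K. c k * ek k (?x t)))\<^sup>2) =
      (\<Sum>t\<in>grid R. (\<Sum>k\<in>K. c k * ek k (?x t)) * cnj (\<Sum>k\<in>K. c k * ek k (?x t)))"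
    by (simp only: of_real_sum complex_norm_square)
  also have "\<dots> = (\<Sum>t\<in>grid R. \<Sum>k\<in>K. \<Sum>m\<in>K. c k * cnj (c m) * ek (k - m) (?x t))"
    by (intro sum.cong refl) (simp add: sum_product cnj_sum ek_diff algebra_simps)
  also have "\<dots> = (\<Sum>k\<in>K. \<Sum>m\<in>K. \<Sum>t\<in>grid R. c k * cnj (c m) * ek (k - m) (?x t))"
    by (rule trans[OF sum.swap]) (rule sum.cong[OF refl], rule sum.swap)
  also have "\<dots> = (\<Sum>k\<in>K. \<Sum>m\<in>K. if m = k then c k * cnj (c m) * of_real ?N else 0)"
    by (intro sum.cong refl) (simp add: sum_distrib_left[symmetric] orth)
  also have "\<dots> = (\<Sum>k\<in>K. c k * cnj (c k) * of_real ?N)"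
    using K by simp
  also have "\<dots> = complex_of_real (?N * (\<Sum>k\<in>K. (cmod (c k))\<^sup>2))"
    by (simp add: sum_distrib_left complex_norm_square[symmetric] mult.commute flip: of_real_power)
  finally have "(\<Sum>t\<in>grid R. (cmod (\<Sum>k\<in>K. c k * ek k (?x t)))\<^sup>2) = ?N * (\<Sum>k\<in>K. (cmod (c k))\<^sup>2)"
    using of_real_eq_iff by blast
  then show ?thesis using \<open>R > 0\<close> by (simp add: grid_mean_def)
qed

text \<open>Stated for all large R because several brackets are going to share one grid.\<close>

lemma grid_mean_bracket:
  fixes f u :: "real^'n \<Rightarrow> complex"
  assumes f: "cl2 f" and u: "cl2 u"
  shows "\<forall>\<^sub>F R in sequentially. grid_mean R (\<lambda>\<xi>. (cmod (bracket f u \<xi>))\<^sup>2) = energy f u"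
proof -
  define K where "K = {k. tr_coef f u k \<noteq> 0}"
  have K: "finite K" unfolding K_def by (rule tr_coef_finite[OF f u])
  have br: "bracket f u \<xi> = (\<Sum>k\<in>K. tr_coef f u k * ek k \<xi>)" for \<xi>
    by (rule bracket_eqI, rule has_sum_finite_neutralI[OF K]) (auto simp: K_def)
  have en: "energy f u = (\<Sum>k\<in>K. (cmod (tr_coef f u k))\<^sup>2)"
    unfolding energy_def
    by (rule infsumI, rule has_sum_finite_neutralI[OF K]) (auto simp: K_def)
  have "finite ((\<lambda>(k, m, i). \<bar>k $ i - m $ i\<bar>) ` (K \<times> K \<times> (UNIV :: 'n set)))"
    using K by simp
  then obtain M where M: "\<And>k m i. k \<in> K \<Longrightarrow> m \<in> K \<Longrightarrow> \<bar>k $ i - m $ i\<bar> \<le> M"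
    by (auto dest!: bdd_above_finite simp: bdd_above_def) blast
  show ?thesis
    using eventually_gt_at_top[of "nat M"]
  proof eventually_elim
    case (elim R)
    have "\<bar>k $ i - m $ i\<bar> < int R" if "k \<in> K" "m \<in> K" for k m i
      using M[OF that, of i] elim by linarith
    then show ?case
      unfolding br en using elim by (intro grid_mean_square[OF K]) auto
  qed
qed

text \<open>A single R serves all the finitely many functions, and averaging is monotone. The form
  of an inequality yields the Bessel bound directly and, used in both directions, the frame
  identity.\<close>

lemma energy_sum_le:
  fixes f :: "real^'n \<Rightarrow> complex"
  assumes fin: "finite A" "finite B" and f: "cl2 f"
    and u: "\<And>a. a \<in> A \<Longrightarrow> cl2 (u a)" and v: "\<And>b. b \<in> B \<Longrightarrow> cl2 (v b)"
    and le: "\<And>\<xi>. (\<Sum>a\<in>A. (cmod (bracket f (u a) \<xi>))\<^sup>2) \<le> (\<Sum>b\<in>B. (cmod (bracket f (v b) \<xi>))\<^sup>2)"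
  shows "(\<Sum>a\<in>A. energy f (u a)) \<le> (\<Sum>b\<in>B. energy f (v b))"
proof -
  let ?G = "\<lambda>R w. grid_mean R (\<lambda>\<xi>. (cmod (bracket f w \<xi>))\<^sup>2)"
  have "\<forall>\<^sub>F R in sequentially. \<forall>a\<in>A. ?G R (u a) = energy f (u a)"
    using fin u by (auto simp: eventually_ball_finite_distrib intro: grid_mean_bracket[OF f])
  moreover have "\<forall>\<^sub>F R in sequentially. \<forall>b\<in>B. ?G R (v b) = energy f (v b)"
    using fin v by (auto simp: eventually_ball_finite_distrib intro: grid_mean_bracket[OF f])
  ultimately have "\<forall>\<^sub>F R in sequentially.
      (\<forall>a\<in>A. ?G R (u a) = energy f (u a)) \<and>
      (\<forall>b\<in>B. ?G R (v b) = energy f (v b))"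
    by (rule eventually_conj)
  then obtain R where
    A: "\<And>a. a \<in> A \<Longrightarrow> ?G R (u a) = energy f (u a)" and
    B: "\<And>b. b \<in> B \<Longrightarrow> ?G R (v b) = energy f (v b)"
    using eventually_happens'[OF sequentially_bot] by blast
  have sum_mean: "(\<Sum>i\<in>C. grid_mean R (F i)) = grid_mean R (\<lambda>\<xi>. \<Sum>i\<in>C. F i \<xi>)"
    for C :: "'z set" and F :: "'z \<Rightarrow> real^'n \<Rightarrow> real"
    unfolding grid_mean_def scaleR_sum_right[symmetric] by (subst sum.swap) simp
  have "(\<Sum>a\<in>A. energy f (u a)) = (\<Sum>a\<in>A. ?G R (u a))"
    by (intro sum.cong refl) (simp add: A)
  also have "\<dots> = grid_mean R (\<lambda>\<xi>. \<Sum>a\<in>A. (cmod (bracket f (u a) \<xi>))\<^sup>2)"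
    by (rule sum_mean)
  also have "\<dots> \<le> grid_mean R (\<lambda>\<xi>. \<Sum>b\<in>B. (cmod (bracket f (v b) \<xi>))\<^sup>2)"
    unfolding grid_mean_def by (intro scaleR_left_mono sum_mono le) auto
  also have "\<dots> = (\<Sum>b\<in>B. ?G R (v b))"
    by (rule sum_mean[symmetric])
  also have "\<dots> = (\<Sum>b\<in>B. energy f (v b))"
    by (intro sum.cong refl) (simp add: B)
  finally show ?thesis .
qed

subsection \<open>The cascade operator\<close>

text \<open>Moves the dilation of a wavelet onto the test function.\<close>

definition stretch :: "nat \<Rightarrow> (real^'n \<Rightarrow> complex) \<Rightarrow> real^'n \<Rightarrow> complex" where
  "stretch lam f = (\<lambda>x. complex_of_real (real lam powr (- real CARD('n) / 2)) * f ((1 / real lam) *\<^sub>R x))"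

text \<open>The setting in which \<phi> is constructed: the sum-of-squares identity and the
  unimodular p_l enter through the bound \<open>p_le\<close>.\<close>

locale masks =
  fixes lam :: nat and p :: "nat \<Rightarrow> real^'n \<Rightarrow> complex" and \<nu> :: "nat \<Rightarrow> int^'n"
    and \<tau> :: "real^'n \<Rightarrow> complex"
  assumes lam: "lam \<ge> 2"
    and p_poly: "\<And>l. l \<in> {1..lam ^ CARD('n)} \<Longrightarrow> trig_poly (p l)"
    and p_le: "\<And>l \<xi>. l \<in> {1..lam ^ CARD('n)} \<Longrightarrow> cmod (p l \<xi>) \<le> 1"
    and \<nu>_bij: "bij_betw \<nu> {1..lam ^ CARD('n)} {k. \<forall>i. 0 \<le> k $ i \<and> k $ i \<le> int lam - 1}"
    and \<tau>_def: "\<And>\<xi>. \<tau> \<xi> = (1 / of_nat lam ^ CARD('n)) *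
           (\<Sum>l = 1..lam ^ CARD('n).
              p l (real lam *\<^sub>R \<xi>) * exp (\<i> * complex_of_real (ivec (\<nu> l) \<bullet> \<xi>)))"
    and \<tau>_0: "\<tau> 0 = 1"
begin

text \<open>Normalized so that the energies of these \<lambda>^n functions add up to the energy at
  the next finer scale.\<close>

definition polyphase :: "nat \<Rightarrow> (real^'n \<Rightarrow> complex) \<Rightarrow> real^'n \<Rightarrow> complex" where
  "polyphase l u = (\<lambda>x. complex_of_real (real lam powr (real CARD('n) / 2)) *
     u (ivec (\<nu> l) + real lam *\<^sub>R x))"

text \<open>The refinement operator, a combination of the functions u(\<lambda>x - m), sorted by the
  residue class of m modulo \<lambda>. Its fixed point, up to a null set, is \<phi>.\<close>

definition cascade :: "(real^'n \<Rightarrow> complex) \<Rightarrow> real^'n \<Rightarrow> complex" where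
  "cascade u = (\<lambda>x. complex_of_real (real lam powr (- real CARD('n) / 2)) *
     (\<Sum>l\<in>{1..lam ^ CARD('n)}. tp_op (p l) (polyphase l u) x))"

lemma lam_pos: "real lam > 0" "lam > 0" "real lam \<noteq> 0"
  using lam by auto

lemma powr_half_square: "(real lam powr (real CARD('n) / 2))\<^sup>2 = real lam ^ CARD('n)"
  using lam_pos by (simp add: power2_eq_square powr_add[symmetric] powr_realpow)

lemma powr_minus_half: "real lam powr (- real CARD('n) / 2) = inverse (real lam powr (real CARD('n) / 2))"
    "real lam powr - (real CARD('n) / 2) = inverse (real lam powr (real CARD('n) / 2))"
  using powr_minus[of "real lam" "real CARD('n) / 2"] by simp_all

lemma cl2_stretch: "cl2 f \<Longrightarrow> cl2 (stretch lam f)"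
  unfolding stretch_def using cl2_affine[of f "1 / real lam" 0] lam_pos
  by (intro cl2_cmult) simp

lemma L2_norm_stretch:
  fixes f :: "real^'n \<Rightarrow> complex"
  shows "L2_norm_fun (stretch lam f) = L2_norm_fun f"
proof -
  have "(LINT x|lborel. (cmod (f x))\<^sup>2) =
      (1 / real lam) ^ CARD('n) * (LINT x|lborel. (cmod (f ((1 / real lam) *\<^sub>R x)))\<^sup>2)"
    using integral_affine[of "1 / real lam" "\<lambda>x. (cmod (f x))\<^sup>2" 0] lam_pos by simp
  also have "(1 / real lam) ^ CARD('n) = (real lam powr (- real CARD('n) / 2))\<^sup>2"
    by (simp only: powr_minus_half power_inverse powr_half_square power_one_over inverse_eq_divide)
  also have "\<dots> * (LINT x|lborel. (cmod (f ((1 / real lam) *\<^sub>R x)))\<^sup>2) =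
      (LINT x|lborel. (cmod (stretch lam f x))\<^sup>2)"
    by (simp add: stretch_def norm_mult power_mult_distrib)
  finally show ?thesis by (simp add: L2_norm_fun_def)
qed

lemma cl2_polyphase: "cl2 u \<Longrightarrow> cl2 (polyphase l u)"
  unfolding polyphase_def by (intro cl2_cmult cl2_affine lam_pos)

lemma cl2_cascade: "cl2 u \<Longrightarrow> cl2 (cascade u)"
  unfolding cascade_def by (intro cl2_cmult cl2_sum cl2_tp_op cl2_polyphase)

text \<open>At x - k the polyphase component l evaluates u at \<nu>_l + \<lambda>(x - k) =
  \<lambda>x - (\<lambda>k - \<nu>_l).\<close>

definition merge :: "nat \<times> (int^'n) \<Rightarrow> int^'n" where
  "merge = (\<lambda>(l, k). \<chi> i. int lam * k $ i - \<nu> l $ i)"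

text \<open>Division with remainder in each coordinate; the remainder is that of -m, because
  \<open>merge\<close> subtracts \<nu>_l.\<close>

lemma bij_merge: "bij_betw merge ({1..lam ^ CARD('n)} \<times> UNIV) UNIV"
proof (rule bij_betw_imageI)
  have \<nu>_range: "0 \<le> \<nu> l $ i" "\<nu> l $ i < int lam" if "l \<in> {1..lam ^ CARD('n)}" for l i
    using bij_betwE[OF \<nu>_bij] that by fastforce+
  show "inj_on merge ({1..lam ^ CARD('n)} \<times> UNIV)"
  proof (rule inj_onI, clarify)
    fix l k l' k' assume l: "l \<in> {1..lam ^ CARD('n)}" and l': "l' \<in> {1..lam ^ CARD('n)}" and eq: "merge (l, k) = merge (l', k')"
    have comp: "int lam * k $ i - \<nu> l $ i = int lam * k' $ i - \<nu> l' $ i" for i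
      using eq by (simp add: merge_def vec_eq_iff)
    have same: "\<nu> l $ i = \<nu> l' $ i" for i
    proof -
      have "\<nu> l $ i = \<nu> l' $ i + int lam * (k $ i - k' $ i)"
        using comp[of i] by (simp add: algebra_simps)
      then have "\<nu> l $ i mod int lam = \<nu> l' $ i mod int lam" by simp
      then show ?thesis using \<nu>_range l l' by simp
    qed
    then have "\<nu> l = \<nu> l'" by (simp add: vec_eq_iff)
    then have "l = l'" using \<nu>_bij l l' by (auto simp: bij_betw_def inj_on_def)
    moreover have "k = k'" using comp same lam_pos by (simp add: vec_eq_iff)
    ultimately show "l = l' \<and> k = k'" by simp
  qed
  show "merge ` ({1..lam ^ CARD('n)} \<times> UNIV) = UNIV"
  proof (intro set_eqI iffI UNIV_I)
    fix m :: "int^'n"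
    define v :: "int^'n" where "v = (\<chi> i. (- m $ i) mod int lam)"
    have "v \<in> {k. \<forall>i. 0 \<le> k $ i \<and> k $ i \<le> int lam - 1}"
      using lam_pos by (auto simp: v_def zle_diff1_eq)
    then obtain l where l: "l \<in> {1..lam ^ CARD('n)}" "\<nu> l = v"
      using \<nu>_bij by (metis (no_types, lifting) bij_betw_imp_surj_on imageE)
    define k :: "int^'n" where "k = (\<chi> i. - ((- m $ i) div int lam))"
    have "int lam * k $ i - v $ i = m $ i" for i
      unfolding k_def v_def vec_lambda_beta mult_minus_right
      using mult_div_mod_eq[of "int lam" "- m $ i"] by linarith
    then have "m = merge (l, k)" using l by (simp add: merge_def vec_eq_iff)
    then show "m \<in> merge ` ({1..lam ^ CARD('n)} \<times> UNIV)" using l by blast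
  qed
qed

lemma tr_coef_polyphase: "tr_coef f (polyphase l u) k = tr_coef (stretch lam f) u (merge (l, k))"
proof -
  have arg: "ivec (\<nu> l) + real lam *\<^sub>R ((1 / real lam) *\<^sub>R x - ivec k) = x - ivec (merge (l, k))" for x
    using lam_pos by (simp add: merge_def ivec_def vec_eq_iff algebra_simps)
  let ?h = "real lam powr (real CARD('n) / 2)"
  have h: "(1 / real lam) ^ CARD('n) * ?h = real lam powr (- real CARD('n) / 2)"
    using lam_pos by (simp add: powr_minus_half power_one_over powr_half_square[symmetric]
        power2_eq_square field_simps)
  have "tr_coef f (polyphase l u) k = (1 / real lam) ^ CARD('n) *\<^sub>R
      (LINT x|lborel. f ((1 / real lam) *\<^sub>R x) * cnj (of_real ?h * u (x - ivec (merge (l, k)))))"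
    unfolding tr_coef_def L2_inner_def polyphase_def
    by (subst integral_affine[where c = "1 / real lam" and t = 0]) (use lam_pos in \<open>auto simp: arg\<close>)
  also have "\<dots> = of_real ((1 / real lam) ^ CARD('n) * ?h) *
      (LINT x|lborel. f ((1 / real lam) *\<^sub>R x) * cnj (u (x - ivec (merge (l, k)))))"
    by (simp add: scaleR_conv_of_real algebra_simps flip: integral_mult_right_zero)
  also have "\<dots> = tr_coef (stretch lam f) u (merge (l, k))"
    unfolding h tr_coef_def L2_inner_def stretch_def
    by (simp flip: integral_mult_right_zero add: mult.assoc)
  finally show ?thesis .
qed

text \<open>The pairs (l, k) enumerate the translates at the finer scale once each, and the finer
  scale itself is moved onto f.\<close>

lemma energy_polyphase:
  assumes f: "cl2 f" and u: "cl2 u"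
  shows "(\<Sum>l\<in>{1..lam ^ CARD('n)}. energy f (polyphase l u)) = energy (stretch lam f) u"
proof -
  let ?F = "\<lambda>m. (cmod (tr_coef (stretch lam f) u m))\<^sup>2"
  have "((\<lambda>x. ?F (merge x)) has_sum energy (stretch lam f) u) ({1..lam ^ CARD('n)} \<times> UNIV)"
    using has_sum_reindex_bij_betw[OF bij_merge, of ?F] energy_has_sum[OF cl2_stretch[OF f] u] by blast
  moreover have "((\<lambda>k. ?F (merge (l, k))) has_sum energy f (polyphase l u)) UNIV" for l
    using energy_has_sum[OF f cl2_polyphase[OF u], of l] by (simp add: tr_coef_polyphase)
  ultimately have "((\<lambda>l. energy f (polyphase l u)) has_sum energy (stretch lam f) u) {1..lam ^ CARD('n)}"
    by (intro has_sum_SigmaD[where f="\<lambda>x. ?F (merge x)"])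
  then show ?thesis by (simp add: has_sum_finite_iff)
qed

lemma bracket_cascade:
  assumes f: "cl2 f" and u: "cl2 u"
  shows "bracket f (cascade u) \<xi> = complex_of_real (real lam powr (- real CARD('n) / 2)) *
    (\<Sum>l\<in>{1..lam ^ CARD('n)}. cnj (p l \<xi>) * bracket f (polyphase l u) \<xi>)"
proof -
  have "bracket f (cascade u) \<xi> = complex_of_real (real lam powr (- real CARD('n) / 2)) *
      (\<Sum>l\<in>{1..lam ^ CARD('n)}. bracket f (tp_op (p l) (polyphase l u)) \<xi>)"
    unfolding cascade_def
    by (simp add: bracket_cmult[OF f] bracket_sum[OF f] cl2_sum cl2_tp_op cl2_polyphase[OF u])
  also have "(\<Sum>l\<in>{1..lam ^ CARD('n)}. bracket f (tp_op (p l) (polyphase l u)) \<xi>) =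
      (\<Sum>l\<in>{1..lam ^ CARD('n)}. cnj (p l \<xi>) * bracket f (polyphase l u) \<xi>)"
    by (intro sum.cong refl bracket_tp_op[OF _ f cl2_polyphase[OF u]] p_poly)
  finally show ?thesis .
qed

text \<open>The Bessel inequality with bound 1 survives the cascade step because the polyphase components
  \<open>p l\<close> of the mask are bounded by 1.\<close>

definition bessel :: "(real^'n \<Rightarrow> complex) \<Rightarrow> bool" where
  "bessel u \<longleftrightarrow> cl2 u \<and> (\<forall>f. cl2 f \<longrightarrow> energy f u \<le> (L2_norm_fun f)\<^sup>2)"

lemma bessel_cascade:
  assumes u: "bessel u"
  shows "bessel (cascade u)"
  unfolding bessel_def
proof (intro conjI allI impI)
  have cu: "cl2 u" using u by (simp add: bessel_def)
  then show cc: "cl2 (cascade u)" by (rule cl2_cascade)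
  fix f :: "real^'n \<Rightarrow> complex" assume f: "cl2 f"
  have "(\<Sum>a\<in>{()}. energy f (cascade u)) \<le> (\<Sum>l\<in>{1..lam ^ CARD('n)}. energy f (polyphase l u))"
  proof (rule energy_sum_le)
    fix \<xi>
    let ?b = "\<lambda>l. bracket f (polyphase l u) \<xi>"
    have "cmod (\<Sum>l\<in>{1..lam ^ CARD('n)}. cnj (p l \<xi>) * ?b l) \<le> (\<Sum>l\<in>{1..lam ^ CARD('n)}. cmod (?b l))"
    proof (rule sum_norm_le)
      fix l assume "l \<in> {1..lam ^ CARD('n)}"
      then show "cmod (cnj (p l \<xi>) * ?b l) \<le> cmod (?b l)"
        using mult_right_mono[OF p_le[of l \<xi>] norm_ge_zero[of "?b l"]] by (simp add: norm_mult)
    qed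
    then have "(cmod (\<Sum>l\<in>{1..lam ^ CARD('n)}. cnj (p l \<xi>) * ?b l))\<^sup>2 \<le> (\<Sum>l\<in>{1..lam ^ CARD('n)}. cmod (?b l))\<^sup>2"
      by (simp add: power_mono)
    \<comment> \<open>The number \<lambda>^n of terms, lost here to Cauchy-Schwarz, cancels against
      the square of the factor \<lambda>^(-n/2) of the cascade.\<close>
    also have "\<dots> \<le> (\<Sum>l\<in>{1..lam ^ CARD('n)}. (cmod (?b l))\<^sup>2) * card {1..lam ^ CARD('n)}"
      by (rule sum_squared_le_sum_of_squares)
    finally have le: "(cmod (\<Sum>l\<in>{1..lam ^ CARD('n)}. cnj (p l \<xi>) * ?b l))\<^sup>2 \<le> real lam ^ CARD('n) * (\<Sum>l\<in>{1..lam ^ CARD('n)}. (cmod (?b l))\<^sup>2)"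
      by (simp add: mult.commute)
    have "(cmod (bracket f (cascade u) \<xi>))\<^sup>2 =
        inverse (real lam ^ CARD('n)) * (cmod (\<Sum>l\<in>{1..lam ^ CARD('n)}. cnj (p l \<xi>) * ?b l))\<^sup>2"
      by (simp add: bracket_cascade[OF f cu] norm_mult power_mult_distrib powr_minus_half
          norm_inverse power_inverse powr_half_square)
    also have "\<dots> \<le> inverse (real lam ^ CARD('n)) * (real lam ^ CARD('n) * (\<Sum>l\<in>{1..lam ^ CARD('n)}. (cmod (?b l))\<^sup>2))"
      using le by (intro mult_left_mono) auto
    also have "\<dots> = (\<Sum>l\<in>{1..lam ^ CARD('n)}. (cmod (?b l))\<^sup>2)" using lam_pos by simp
    finally show "(\<Sum>a\<in>{()}. (cmod (bracket f (cascade u) \<xi>))\<^sup>2) \<le> (\<Sum>l\<in>{1..lam ^ CARD('n)}. (cmod (?b l))\<^sup>2)" by simp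
  qed (use f cc cu cl2_polyphase in auto)
  also have "\<dots> = energy (stretch lam f) u" by (rule energy_polyphase[OF f cu])
  also have "\<dots> \<le> (L2_norm_fun (stretch lam f))\<^sup>2"
    using u cl2_stretch[OF f] by (simp add: bessel_def)
  finally show "energy f (cascade u) \<le> (L2_norm_fun f)\<^sup>2" by (simp add: L2_norm_stretch)
qed

text \<open>With u tested against itself, the term k = 0 alone gives ||u||^4 \<le> ||u||^2.\<close>

lemma bessel_norm_le:
  assumes u: "bessel u"
  shows "L2_norm_fun u \<le> 1"
proof -
  have cu: "cl2 u" using u by (simp add: bessel_def)
  have "L2_inner u u = complex_of_real ((L2_norm_fun u)\<^sup>2)"
    unfolding L2_inner_def L2_norm_fun_square
    by (simp add: complex_norm_square[symmetric] flip: of_real_power)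
  then have "(cmod (tr_coef u u 0))\<^sup>2 = ((L2_norm_fun u)\<^sup>2)\<^sup>2"
    by (simp add: tr_coef_def norm_power)
  moreover have "(cmod (tr_coef u u 0))\<^sup>2 \<le> energy u u"
    using finite_sum_le_has_sum[OF energy_has_sum[OF cu cu], of "{0}"] by simp
  moreover have "energy u u \<le> (L2_norm_fun u)\<^sup>2" using u cu by (simp add: bessel_def)
  ultimately have le: "((L2_norm_fun u)\<^sup>2)\<^sup>2 \<le> (L2_norm_fun u)\<^sup>2 * 1" by simp
  show ?thesis
  proof (rule ccontr)
    assume "\<not> L2_norm_fun u \<le> 1"
    then have gt: "1 < (L2_norm_fun u)\<^sup>2" by (simp add: one_less_power)
    then have "(L2_norm_fun u)\<^sup>2 * 1 < (L2_norm_fun u)\<^sup>2 * (L2_norm_fun u)\<^sup>2"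
      by (intro mult_strict_left_mono) auto
    then show False using le by (simp add: power2_eq_square)
  qed
qed

lemma fourier_polyphase:
  "fourier (polyphase l u) (real lam *\<^sub>R \<xi>) = complex_of_real (real lam powr (- real CARD('n) / 2)) *
     exp (\<i> * complex_of_real (ivec (\<nu> l) \<bullet> \<xi>)) * fourier u \<xi>"
proof -
  let ?h = "real lam powr (real CARD('n) / 2)"
  have "fourier (polyphase l u) (real lam *\<^sub>R \<xi>) = of_real ?h *
      (exp (\<i> * complex_of_real (ivec (\<nu> l) \<bullet> \<xi>)) * fourier u \<xi> / of_real (real lam ^ CARD('n)))"
    unfolding polyphase_def fourier_cmult using fourier_affine[of "real lam" u "ivec (\<nu> l)" \<xi>] lam_pos
    by simp
  also have "complex_of_real (real lam ^ CARD('n)) = of_real ?h * of_real ?h"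
    by (simp only: powr_half_square[symmetric] power2_eq_square of_real_mult)
  finally show ?thesis
    using lam_pos by (simp add: powr_minus_half field_simps)
qed

text \<open>One factor \<lambda>^(-n/2) comes from the cascade and one from the polyphase
  components; together they are the \<lambda>^(-n) in \<tau>.\<close>

lemma fourier_cascade:
  assumes u: "cl2 u"
  shows "fourier (cascade u) (real lam *\<^sub>R \<xi>) = \<tau> \<xi> * fourier u \<xi>"
proof -
  let ?h = "complex_of_real (real lam powr (- real CARD('n) / 2))"
  have h2: "?h * ?h = 1 / of_nat lam ^ CARD('n)"
  proof -
    have "?h * ?h = complex_of_real (inverse (real lam ^ CARD('n)))"
      unfolding powr_minus_half powr_half_square[symmetric]
      by (simp add: power2_eq_square)
    then show ?thesis
      by (simp only: inverse_eq_divide of_real_divide of_real_power of_real_of_nat_eq of_real_1)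
  qed
  have "fourier (cascade u) (real lam *\<^sub>R \<xi>) =
      ?h * (\<Sum>l\<in>{1..lam ^ CARD('n)}. fourier (tp_op (p l) (polyphase l u)) (real lam *\<^sub>R \<xi>))"
    unfolding cascade_def fourier_cmult
    by (subst fourier_sum) (auto intro: cl2_L1 cl2_tp_op cl2_polyphase u)
  also have "\<dots> = ?h * (\<Sum>l\<in>{1..lam ^ CARD('n)}. p l (real lam *\<^sub>R \<xi>) *
      (?h * exp (\<i> * complex_of_real (ivec (\<nu> l) \<bullet> \<xi>)) * fourier u \<xi>))"
    by (intro arg_cong2[where f="(*)"] sum.cong refl)
      (simp only: fourier_tp_op[OF p_poly cl2_L1[OF cl2_polyphase[OF u]]] fourier_polyphase)
  also have "\<dots> = (?h * ?h) * (\<Sum>l\<in>{1..lam ^ CARD('n)}. p l (real lam *\<^sub>R \<xi>) *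
      exp (\<i> * complex_of_real (ivec (\<nu> l) \<bullet> \<xi>))) * fourier u \<xi>"
    by (simp add: sum_distrib_left sum_distrib_right mult_ac)
  also have "\<dots> = \<tau> \<xi> * fourier u \<xi>" unfolding h2 \<tau>_def ..
  finally show ?thesis .
qed

end

subsection \<open>Weak limits\<close>

text \<open>Cauchy-Schwarz against the indicator of the ball. With a common radius, L^2 convergence
  carries over to L^1 and to the transforms.\<close>

lemma L1_norm_le_L2_norm:
  fixes f :: "real^'n \<Rightarrow> complex"
  assumes f: "L2_fun f" and R: "\<And>x. R < norm x \<Longrightarrow> f x = 0"
  shows "(LINT x|lborel. cmod (f x)) \<le> L2_norm_fun f * sqrt (measure lborel (cball (0::real^'n) R))"
proof -
  let ?i = "\<lambda>x. complex_of_real (indicator (cball 0 R) (x::real^'n))"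
  have sq: "(cmod (?i x))\<^sup>2 = indicator (cball 0 R) x" for x
    by (simp add: indicator_def)
  have i: "L2_fun ?i"
  proof (rule L2_fun_bound[OF integrable_indicator_cball[of 0 R]])
    have [measurable]: "cball (0::real^'n) R \<in> sets borel" by simp
    show "?i \<in> borel_measurable borel" by measurable
  qed (simp only: sq order_refl)
  have "L2_norm_fun ?i = sqrt (measure lborel (cball (0::real^'n) R))"
    unfolding L2_norm_fun_def sq by simp
  moreover have "(LINT x|lborel. cmod (f x) * cmod (?i x)) \<le> L2_norm_fun f * L2_norm_fun ?i"
    by (rule L2_Cauchy_Schwarz_real(2)[OF f i])
  moreover have "(\<lambda>x. cmod (f x) * cmod (?i x)) = (\<lambda>x. cmod (f x))"
  proof
    show "cmod (f x) * cmod (?i x) = cmod (f x)" for x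
      using R[of x] by (cases "R < norm x") auto
  qed
  ultimately show ?thesis by simp
qed

lemma fourier_bound_L2:
  fixes f :: "real^'n \<Rightarrow> complex"
  assumes f: "L2_fun f" and R: "\<And>x. R < norm x \<Longrightarrow> f x = 0"
  shows "cmod (fourier f \<xi>) \<le> L2_norm_fun f * sqrt (measure lborel (cball (0::real^'n) R))"
proof -
  have "cmod (fourier f \<xi>) \<le> (LINT x|lborel. cmod (f x * exp (- \<i> * complex_of_real (x \<bullet> \<xi>))))"
    unfolding fourier_def by (rule integral_norm_bound)
  also have "\<dots> = (LINT x|lborel. cmod (f x))" by (simp add: norm_mult)
  finally show ?thesis using L1_norm_le_L2_norm[OF f, of R] R by auto
qed

lemma L2_Fatou:
  fixes f :: "real^'n \<Rightarrow> complex"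
  assumes w: "\<And>k::nat. L2_fun (w k)" and le: "\<And>k. L2_norm_fun (w k) \<le> c"
    and lim: "AE x in lborel. (\<lambda>k. w k x) \<longlonglongrightarrow> f x" and [measurable]: "f \<in> borel_measurable borel"
  shows "L2_fun f" and "L2_norm_fun f \<le> c"
proof -
  let ?I = "\<lambda>h::real^'n \<Rightarrow> complex. \<integral>\<^sup>+x. ennreal ((cmod (h x))\<^sup>2) \<partial>lborel"
  note [measurable] = L2_fun_measurable[OF w]
  have c0: "0 \<le> c" using le[of 0] L2_norm_fun_nonneg order_trans by blast
  have nn_w: "?I (w k) \<le> ennreal (c\<^sup>2)" for k
  proof -
    have "?I (w k) = ennreal ((L2_norm_fun (w k))\<^sup>2)"
      unfolding L2_norm_fun_square using w[of k] by (intro nn_integral_eq_integral) (auto simp: L2_fun_def)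
    then show ?thesis using le[of k] by (simp add: ennreal_leI power_mono)
  qed
  have "?I f =
      (\<integral>\<^sup>+x. liminf (\<lambda>k. ennreal ((cmod (w k x))\<^sup>2)) \<partial>lborel)"
  proof (rule nn_integral_cong_AE, use lim in eventually_elim)
    case (elim x)
    then have "(\<lambda>k. ennreal ((cmod (w k x))\<^sup>2)) \<longlonglongrightarrow> ennreal ((cmod (f x))\<^sup>2)"
      by (intro tendsto_intros)
    then show ?case by (rule lim_imp_Liminf[OF sequentially_bot, symmetric])
  qed
  also have "\<dots> \<le> liminf (\<lambda>k. \<integral>\<^sup>+x. ennreal ((cmod (w k x))\<^sup>2) \<partial>lborel)"
    by (rule nn_integral_liminf) measurable
  also have "\<dots> \<le> ennreal (c\<^sup>2)"
    using nn_w by (intro order_trans[OF Liminf_le_Limsup Limsup_bounded]) auto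
  finally have nn_f: "?I f \<le> ennreal (c\<^sup>2)" .
  then have "integrable lborel (\<lambda>x. (cmod (f x))\<^sup>2)"
    unfolding integrable_iff_bounded by (auto intro: le_less_trans)
  then show f: "L2_fun f" by (simp add: L2_fun_def)
  have "ennreal ((L2_norm_fun f)\<^sup>2) \<le> ennreal (c\<^sup>2)"
    using nn_f unfolding L2_norm_fun_square
    by (subst nn_integral_eq_integral[symmetric]) (use f in \<open>auto simp: L2_fun_def\<close>)
  then have "(L2_norm_fun f)\<^sup>2 \<le> c\<^sup>2" by (simp add: ennreal_le_iff)
  then show "L2_norm_fun f \<le> c" using c0 by (rule power2_le_imp_le)
qed

text \<open>On a common ball an L^2 Cauchy sequence is L^1 Cauchy and so has a subsequence
  converging almost everywhere; Fatou turns the Cauchy estimates into L^2 convergence to its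
  limit.\<close>

lemma L2_complete_bounded_support:
  fixes v :: "nat \<Rightarrow> real^'n \<Rightarrow> complex"
  assumes v: "\<And>k. L2_fun (v k)" and R: "\<And>k x. R < norm x \<Longrightarrow> v k x = 0"
    and Cauchy: "\<And>e. e > 0 \<Longrightarrow> \<exists>N. \<forall>i\<ge>N. \<forall>j\<ge>N. L2_norm_fun (\<lambda>x. v i x - v j x) < e"
  shows "\<exists>\<phi>. L2_fun \<phi> \<and> (\<forall>x. R < norm x \<longrightarrow> \<phi> x = 0) \<and>
    (\<forall>e>0. \<exists>j0. \<forall>j\<ge>j0. L2_norm_fun (\<lambda>x. \<phi> x - v j x) \<le> e)"
proof -
  let ?m = "sqrt (measure lborel (cball (0::real^'n) R)) + 1"
  have m: "?m > 0" by (simp add: add_nonneg_pos)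
  have int: "integrable lborel (v k)" for k
    using L1_fun_of_L2_bounded_support[OF v, of R k] R by (auto simp: L1_fun_def)
  note [measurable] = L2_fun_measurable[OF v]
  have "\<exists>N. \<forall>i\<ge>N. \<forall>j\<ge>N. (LINT x|lborel. cmod (v i x - v j x)) < e" if "e > 0" for e
  proof -
    have "e / ?m > 0" using that m by simp
    then obtain N where N: "\<And>i j. N \<le> i \<Longrightarrow> N \<le> j \<Longrightarrow> L2_norm_fun (\<lambda>x. v i x - v j x) < e / ?m"
      using Cauchy by blast
    have "(LINT x|lborel. cmod (v i x - v j x)) < e" if "N \<le> i" "N \<le> j" for i j
    proof -
      have "(LINT x|lborel. cmod (v i x - v j x)) \<le>
          L2_norm_fun (\<lambda>x. v i x - v j x) * sqrt (measure lborel (cball (0::real^'n) R))"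
        by (rule L1_norm_le_L2_norm) (auto intro: L2_fun_diff v simp: R)
      also have "\<dots> \<le> L2_norm_fun (\<lambda>x. v i x - v j x) * ?m"
        by (intro mult_left_mono) auto
      also have "\<dots> < e / ?m * ?m" using N[OF that] m by (intro mult_strict_right_mono) auto
      finally show ?thesis using m by simp
    qed
    then show ?thesis by blast
  qed
  then obtain r where r: "strict_mono r" and AE: "AE x in lborel. Cauchy (\<lambda>i. v (r i) x)"
    using cauchy_L1_AE_cauchy_subseq[of lborel v] int by blast
  \<comment> \<open>Taken at every point, so that \<phi> vanishes exactly, not just almost
    everywhere, outside the ball.\<close>
  define \<phi> where "\<phi> x = lim (\<lambda>i. v (r i) x)" for x
  have [measurable]: "\<phi> \<in> borel_measurable borel"
    unfolding \<phi>_def[abs_def] by measurable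
  have lim: "AE x in lborel. (\<lambda>i. v (r i) x) \<longlonglongrightarrow> \<phi> x"
    using AE by eventually_elim (simp add: \<phi>_def Cauchy_convergent_iff convergent_LIMSEQ_iff)
  have close: "L2_fun (\<lambda>x. \<phi> x - v j x) \<and> L2_norm_fun (\<lambda>x. \<phi> x - v j x) \<le> e"
    if N: "\<And>i j. N \<le> i \<Longrightarrow> N \<le> j \<Longrightarrow> L2_norm_fun (\<lambda>x. v i x - v j x) < e" and "N \<le> j" for N j e
  proof -
    \<comment> \<open>The shift by N keeps all indices of the subsequence in the range of the Cauchy
      estimate.\<close>
    have *: "N \<le> r (k + N)" for k
      using seq_suble[OF r, of "k + N"] by linarith
    have "AE x in lborel. (\<lambda>k. v (r (k + N)) x - v j x) \<longlonglongrightarrow> \<phi> x - v j x"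
      using lim by eventually_elim (intro tendsto_diff tendsto_const LIMSEQ_ignore_initial_segment)
    then show ?thesis
      using L2_Fatou[of "\<lambda>k x. v (r (k + N)) x - v j x" e "\<lambda>x. \<phi> x - v j x"]
        N[OF * \<open>N \<le> j\<close>] L2_fun_diff[OF v v] by (auto intro: less_imp_le)
  qed
  obtain N0 where "\<And>i j. N0 \<le> i \<Longrightarrow> N0 \<le> j \<Longrightarrow> L2_norm_fun (\<lambda>x. v i x - v j x) < 1"
    using Cauchy[of 1] by auto
  from close[OF this order_refl] have "L2_fun (\<lambda>x. (\<phi> x - v N0 x) + v N0 x)"
    by (intro L2_fun_add v) blast
  then have "L2_fun \<phi>" by simp
  moreover have "\<phi> x = 0" if "R < norm x" for x
    using that by (simp add: \<phi>_def R)
  moreover have "\<exists>j0. \<forall>j\<ge>j0. L2_norm_fun (\<lambda>x. \<phi> x - v j x) \<le> e" if "e > 0" for e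
    using Cauchy[OF that] close by metis
  ultimately show ?thesis by blast
qed

text \<open>Midpoints suffice: the parallelogram law asks for no other convex combination.\<close>

inductive_set tail_means :: "(nat \<Rightarrow> real^'n \<Rightarrow> complex) \<Rightarrow> nat \<Rightarrow> (real^'n \<Rightarrow> complex) set"
  for u m where
  base: "m \<le> i \<Longrightarrow> u i \<in> tail_means u m"
| mean: "f \<in> tail_means u m \<Longrightarrow> g \<in> tail_means u m \<Longrightarrow> (\<lambda>x. 1/2 * (f x + g x)) \<in> tail_means u m"

lemma tail_means_mono:
  assumes "m \<le> m'" shows "tail_means u m' \<subseteq> tail_means u m"
proof
  fix f assume "f \<in> tail_means u m'"
  then show "f \<in> tail_means u m"
  proof induction
    case (base i)
    then show ?case using assms by (intro tail_means.base) simp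
  next
    case (mean f g)
    then show ?case by (intro tail_means.mean)
  qed
qed

lemma parallelogram_L2:
  assumes f: "L2_fun f" and g: "L2_fun g"
  shows "(L2_norm_fun (\<lambda>x. f x - g x))\<^sup>2 = 2 * (L2_norm_fun f)\<^sup>2 + 2 * (L2_norm_fun g)\<^sup>2 -
    4 * (L2_norm_fun (\<lambda>x. 1/2 * (f x + g x)))\<^sup>2"
proof -
  have pt: "(cmod (a - b))\<^sup>2 = 2 * (cmod a)\<^sup>2 + 2 * (cmod b)\<^sup>2 - 4 * (cmod (1/2 * (a + b)))\<^sup>2" for a b
  proof -
    have "(cmod (a - b))\<^sup>2 + (cmod (a + b))\<^sup>2 = 2 * (cmod a)\<^sup>2 + 2 * (cmod b)\<^sup>2"
      by (simp only: cmod_power2 complex.sel minus_complex.sel plus_complex.sel)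
        (simp add: power2_eq_square algebra_simps)
    moreover have "4 * (cmod (1/2 * (a + b)))\<^sup>2 = (cmod (a + b))\<^sup>2"
      by (simp add: norm_mult norm_divide power_divide)
    ultimately show ?thesis by linarith
  qed
  have m: "L2_fun (\<lambda>x. 1/2 * (f x + g x))" by (intro L2_fun_cmult L2_fun_add f g)
  have "(LINT x|lborel. (cmod (f x - g x))\<^sup>2) = (LINT x|lborel. 2 * (cmod (f x))\<^sup>2 +
      2 * (cmod (g x))\<^sup>2 - 4 * (cmod (1/2 * (f x + g x)))\<^sup>2)"
    by (subst pt) simp
  also have "\<dots> = 2 * (LINT x|lborel. (cmod (f x))\<^sup>2) + 2 * (LINT x|lborel. (cmod (g x))\<^sup>2) -
      4 * (LINT x|lborel. (cmod (1/2 * (f x + g x)))\<^sup>2)"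
    using L2_fun_integrable[OF f] L2_fun_integrable[OF g] L2_fun_integrable[OF m]
    by (subst Bochner_Integration.integral_diff) auto
  finally show ?thesis by (simp only: L2_norm_fun_square)
qed

text \<open>Weak compactness of the unit ball in the form needed here: nearly norm-minimal means of the
  tails of the sequence are Cauchy in \<open>L\<^sup>2\<close> by the parallelogram law, and taking means of tails does
  not change the limit of the Fourier transforms.\<close>

lemma fourier_weak_limit:
  fixes u :: "nat \<Rightarrow> real^'n \<Rightarrow> complex"
  assumes u: "\<And>m. L2_fun (u m)" and nrm: "\<And>m. L2_norm_fun (u m) \<le> 1"
    and R: "\<And>m x. R < norm x \<Longrightarrow> u m x = 0"
    and lim: "\<And>\<xi>. (\<lambda>m. fourier (u m) \<xi>) \<longlonglongrightarrow> \<Lambda> \<xi>"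
  shows "\<exists>\<phi>. L2_fun \<phi> \<and> (\<forall>x. R < norm x \<longrightarrow> \<phi> x = 0) \<and> (\<forall>\<xi>. fourier \<phi> \<xi> = \<Lambda> \<xi>)"
proof -
  let ?S = "\<lambda>f. (L2_norm_fun f)\<^sup>2"
  have tL2: "L2_fun f" if "f \<in> tail_means u m" for f m
    using that
  proof induction
    case (mean f g)
    show ?case by (intro L2_fun_cmult L2_fun_add mean.IH)
  qed (rule u)
  have tR: "\<forall>x. R < norm x \<longrightarrow> f x = 0" if "f \<in> tail_means u m" for f m
    using that by induction (auto simp: R)
  \<comment> \<open>Discs about \<open>\<Lambda> \<xi>\<close> are convex, so means inherit the
    error bound of the tail.\<close>
  have tF: "cmod (fourier f \<xi> - \<Lambda> \<xi>) \<le> e"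
    if "f \<in> tail_means u m" "\<And>i. m \<le> i \<Longrightarrow> cmod (fourier (u i) \<xi> - \<Lambda> \<xi>) \<le> e" for f m \<xi> e
    using that(1)
  proof induction
    case (mean f g)
    have "L1_fun f" "L1_fun g"
      using L1_fun_of_L2_bounded_support tL2 tR mean.hyps by blast+
    then have "fourier (\<lambda>x. 1/2 * (f x + g x)) \<xi> - \<Lambda> \<xi> =
        1/2 * ((fourier f \<xi> - \<Lambda> \<xi>) + (fourier g \<xi> - \<Lambda> \<xi>))"
      unfolding fourier_cmult by (simp add: fourier_add field_simps)
    also have "cmod \<dots> \<le> 1/2 * (e + e)"
      unfolding norm_mult using norm_triangle_mono[OF mean.IH] by simp
    finally show ?case by simp
  qed (rule that(2))
  \<comment> \<open>Later tails are smaller sets, so these infima increase; being at most 1, they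
    converge.\<close>
  define d where "d m = Inf (?S ` tail_means u m)" for m
  have ne: "?S ` tail_means u m \<noteq> {}" for m using tail_means.base[of m m u] by blast
  have bdd: "bdd_below (?S ` tail_means u m)" for m
    by (rule bdd_belowI[of _ 0]) auto
  have d_le: "d m \<le> ?S f" if "f \<in> tail_means u m" for f m
    unfolding d_def by (rule cInf_lower[OF imageI[OF that] bdd])
  have "incseq d"
    unfolding d_def by (intro monoI cInf_superset_mono ne bdd image_mono tail_means_mono)
  moreover have "d m \<le> 1" for m
    using order_trans[OF d_le[OF tail_means.base[of m m u]], of 1] nrm[of m]
    by (simp add: power_le_one)
  ultimately obtain D where D: "d \<longlonglongrightarrow> D" "\<And>m. d m \<le> D"
    using incseq_convergent[of d 1] by metis
  have "\<exists>f\<in>tail_means u m. ?S f < d m + 1 / real (Suc m)" for m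
    using cInf_lessD[OF ne, of m "d m + 1 / real (Suc m)"] unfolding d_def[symmetric] by auto
  then obtain v where vt: "\<And>m. v m \<in> tail_means u m" and vS: "\<And>m. ?S (v m) < d m + 1 / real (Suc m)"
    by metis
  \<comment> \<open>The parallelogram law for \<open>v m\<close> and \<open>v k\<close>, both in the
    tail from m, gives at most 2(d_m + 1/(m+1)) + 2(d_k + 1/(k+1)) - 4 d_m, where d_k \<le> D and k
    \<ge> m.\<close>
  define \<epsilon> where "\<epsilon> m = 2 * (D - d m) + 4 / real (Suc m)" for m
  have "(\<lambda>m. 2 * (D - d m) + 4 * (1 / real (Suc m))) \<longlonglongrightarrow> 2 * (D - D) + 4 * 0"
    by (intro tendsto_intros D LIMSEQ_Suc[OF lim_const_over_n])
  then have \<epsilon>0: "\<epsilon> \<longlonglongrightarrow> 0" by (simp add: \<epsilon>_def[abs_def])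
  have diff: "?S (\<lambda>x. v m x - v k x) \<le> \<epsilon> m" if "m \<le> k" for m k
  proof -
    have vk: "v k \<in> tail_means u m" using vt[of k] tail_means_mono[OF that] by blast
    have "d m \<le> ?S (\<lambda>x. 1/2 * (v m x + v k x))" by (intro d_le tail_means.mean vt vk)
    moreover have "1 / real (Suc k) \<le> 1 / real (Suc m)" using that by (simp add: frac_le)
    ultimately show ?thesis
      using parallelogram_L2[OF tL2[OF vt] tL2[OF vt], of m k] vS[of m] vS[of k] D(2)[of k]
      by (simp add: \<epsilon>_def)
  qed
  have "\<exists>N. \<forall>i\<ge>N. \<forall>j\<ge>N. L2_norm_fun (\<lambda>x. v i x - v j x) < e" if "e > 0" for e
  proof -
    have "\<forall>\<^sub>F m in sequentially. \<epsilon> m < e\<^sup>2"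
      using order_tendstoD(2)[OF \<epsilon>0, of "e\<^sup>2"] that by simp
    then obtain N where N: "\<And>m. N \<le> m \<Longrightarrow> \<epsilon> m < e\<^sup>2" by (auto simp: eventually_sequentially)
    have *: "L2_norm_fun (\<lambda>x. v i x - v j x) < e" if "N \<le> i" "i \<le> j" for i j
      using le_less_trans[OF diff[OF that(2)] N[OF that(1)]] \<open>e > 0\<close>
      by (rule power2_less_imp_less[OF _ less_imp_le])
    have "L2_norm_fun (\<lambda>x. v i x - v j x) < e" if "N \<le> i" "N \<le> j" for i j
      using *[of i j] *[of j i] that L2_norm_fun_minus_commute[of "v i" "v j"] by (cases "i \<le> j") auto
    then show ?thesis by blast
  qed
  moreover have "L2_fun (v k)" for k by (rule tL2[OF vt])
  moreover have "v k x = 0" if "R < norm x" for k x using tR[OF vt] that by blast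
  ultimately have "\<exists>\<phi>. L2_fun \<phi> \<and> (\<forall>x. R < norm x \<longrightarrow> \<phi> x = 0) \<and>
      (\<forall>e>0. \<exists>j0. \<forall>j\<ge>j0. L2_norm_fun (\<lambda>x. \<phi> x - v j x) \<le> e)"
    by (intro L2_complete_bounded_support)
  then obtain \<phi> where \<phi>: "L2_fun \<phi>" and \<phi>R: "\<And>x. R < norm x \<Longrightarrow> \<phi> x = 0"
    and conv: "\<And>e. e > 0 \<Longrightarrow> \<exists>j0. \<forall>j\<ge>j0. L2_norm_fun (\<lambda>x. \<phi> x - v j x) \<le> e"
    by blast
  have "fourier \<phi> \<xi> = \<Lambda> \<xi>" for \<xi>
  proof -
    let ?m = "sqrt (measure lborel (cball (0::real^'n) R)) + 1"
    have m: "?m > 0" by (simp add: add_nonneg_pos)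
    have "cmod (fourier \<phi> \<xi> - \<Lambda> \<xi>) \<le> 0 + e" if "e > 0" for e
    proof -
      have "e / (2 * ?m) > 0" using that m by simp
      then obtain j0 where j0: "\<And>j. j0 \<le> j \<Longrightarrow> L2_norm_fun (\<lambda>x. \<phi> x - v j x) \<le> e / (2 * ?m)"
        using conv by blast
      have "\<forall>\<^sub>F i in sequentially. dist (fourier (u i) \<xi>) (\<Lambda> \<xi>) < e / 2"
        using tendstoD[OF lim[of \<xi>], of "e / 2"] that by simp
      then obtain j1 where j1: "\<And>i. j1 \<le> i \<Longrightarrow> cmod (fourier (u i) \<xi> - \<Lambda> \<xi>) \<le> e / 2"
        by (auto simp: eventually_sequentially dist_norm intro: less_imp_le)
      \<comment> \<open>Past \<open>j0\<close> the mean \<open>v j\<close> is close to \<phi>; past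
        \<open>j1\<close> all members of the tail it averages have transforms close to
        \<open>\<Lambda> \<xi>\<close>.\<close>
      define j where "j = max j0 j1"
      have a: "cmod (fourier (v j) \<xi> - \<Lambda> \<xi>) \<le> e / 2"
      proof (rule tF[OF vt])
        show "cmod (fourier (u i) \<xi> - \<Lambda> \<xi>) \<le> e / 2" if "j \<le> i" for i
          by (rule j1) (use that in \<open>simp add: j_def\<close>)
      qed
      have L1: "L1_fun \<phi>" "L1_fun (v j)"
        using L1_fun_of_L2_bounded_support[OF \<phi>, of R] L1_fun_of_L2_bounded_support[OF tL2[OF vt], of R]
          tR[OF vt] \<phi>R by auto
      have "cmod (fourier \<phi> \<xi> - fourier (v j) \<xi>) =
          cmod (fourier (\<lambda>x. \<phi> x - v j x) \<xi>)"
        using L1 by (simp add: fourier_diff)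
      also have "\<dots> \<le> L2_norm_fun (\<lambda>x. \<phi> x - v j x) * sqrt (measure lborel (cball (0::real^'n) R))"
        by (rule fourier_bound_L2) (use \<phi>R tR[OF vt] in \<open>auto intro: L2_fun_diff \<phi> tL2[OF vt]\<close>)
      also have "\<dots> \<le> e / (2 * ?m) * ?m"
        using j0[of j] that m by (intro mult_mono) (auto simp: j_def)
      also have "\<dots> = e / 2" using m by (simp add: divide_simps)
      finally have b: "cmod (fourier \<phi> \<xi> - fourier (v j) \<xi>) \<le> e / 2" .
      have "fourier \<phi> \<xi> - \<Lambda> \<xi> = (fourier \<phi> \<xi> - fourier (v j) \<xi>) + (fourier (v j) \<xi> - \<Lambda> \<xi>)" by simp
      then show ?thesis using norm_triangle_mono[OF b a] by simp
    qed
    then have "cmod (fourier \<phi> \<xi> - \<Lambda> \<xi>) \<le> 0" by (rule field_le_epsilon)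
    then show ?thesis by simp
  qed
  then show ?thesis using \<phi> \<phi>R by blast
qed

subsection \<open>The refinable function\<close>

definition vfloor :: "real^'n \<Rightarrow> int^'n" where
  "vfloor x = (\<chi> i. \<lfloor>x $ i\<rfloor>)"

text \<open>The indicator of the half-open cube, written through the floor so that its integer
  translates partition the space exactly and \<open>vfloor x\<close> names the one containing
  x.\<close>

definition unit_box_fun :: "real^'n \<Rightarrow> complex" where
  "unit_box_fun x = (if vfloor x = 0 then 1 else 0)"

lemma vfloor_diff_ivec: "vfloor (x - ivec k) = vfloor x - k"
  by (simp add: vfloor_def ivec_def vec_eq_iff)

lemma unit_box_fun_translate: "unit_box_fun (x - ivec k) = (if vfloor x = k then 1 else 0)"
  by (simp add: unit_box_fun_def vfloor_diff_ivec)

lemma vfloor_cell_measurable [measurable]: "{x. vfloor x = k} \<in> sets borel"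
proof -
  have "{x. vfloor x = k} = (\<Inter>i. {x. \<lfloor>x $ i\<rfloor> = k $ i})"
    by (auto simp: vfloor_def vec_eq_iff)
  also have "\<dots> \<in> sets borel"
    by (intro sets.countable_INT'' countableI_type) measurable
  finally show ?thesis .
qed

lemma pred_vfloor [measurable]: "Measurable.pred borel (\<lambda>x. vfloor x = k)"
  using vfloor_cell_measurable[of k] by (simp add: pred_def)

text \<open>The half-open cube lies between the open and the closed one, both of measure 1.\<close>

lemma emeasure_unit_cell: "emeasure lborel {x::real^'n. vfloor x = 0} = 1"
proof -
  have basis: "(1::real^'n) \<bullet> b = 1" if "b \<in> Basis" for b
    using that by (auto simp: Basis_vec_def inner_axis)
  have "emeasure lborel (box 0 (1::real^'n)) = 1" "emeasure lborel (cbox 0 (1::real^'n)) = 1"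
    by (simp_all add: emeasure_lborel_box_eq emeasure_lborel_cbox_eq basis)
  moreover have "emeasure lborel (box 0 (1::real^'n)) \<le> emeasure lborel {x::real^'n. vfloor x = 0}"
    by (intro emeasure_mono) (auto simp: mem_box_cart vfloor_def vec_eq_iff floor_eq_iff less_imp_le)
  moreover have "emeasure lborel {x::real^'n. vfloor x = 0} \<le> emeasure lborel (cbox 0 (1::real^'n))"
    by (intro emeasure_mono) (auto simp: mem_box_cart vfloor_def vec_eq_iff floor_eq_iff less_imp_le)
  ultimately show ?thesis by simp
qed

lemma unit_box_fun_measurable [measurable]: "unit_box_fun \<in> borel_measurable borel"
  unfolding unit_box_fun_def[abs_def] by measurable

lemma cell_integral:
  shows "integrable lborel (\<lambda>x::real^'n. if vfloor x = k then 1 else 0 :: real)" (is ?A)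
    and "(LINT x|lborel. (if vfloor x = k then 1 else 0)) = (1::real)" (is ?B)
proof -
  have ind: "(\<lambda>x::real^'n. if vfloor x = m then 1 else 0) = indicat_real {x. vfloor x = m}" for m
    by (auto simp: indicator_def)
  have 0: "integrable lborel (\<lambda>x::real^'n. if vfloor x = 0 then 1 else 0 :: real)"
    "(LINT x|lborel. (if vfloor (x::real^'n) = 0 then 1 else 0 :: real)) = 1"
    unfolding ind using emeasure_unit_cell[where 'n='n]
    by (auto simp: measure_def intro!: integrable_real_indicator)
  have eq: "(\<lambda>x. if vfloor (- ivec k + 1 *\<^sub>R x) = 0 then 1 else 0) = (\<lambda>x. if vfloor x = k then 1 else (0::real))"
    using vfloor_diff_ivec[of _ k] by simp
  show ?A using integrable_affine[OF 0(1), of 1 "- ivec k"] unfolding eq by simp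
  show ?B
    using integral_affine[of 1 "\<lambda>x::real^'n. if vfloor x = 0 then 1 else (0::real)" "- ivec k"] 0(2)
    unfolding eq by simp
qed

lemma L2_unit_box_fun: "L2_fun unit_box_fun"
  by (rule L2_fun_bound[OF cell_integral(1)[of 0]]) (auto simp: unit_box_fun_def)

lemma unit_box_fun_support:
  assumes "real CARD('n) < norm (x::real^'n)" shows "unit_box_fun x = 0"
proof (rule ccontr)
  assume "unit_box_fun x \<noteq> 0"
  then have "vfloor x = 0" by (simp add: unit_box_fun_def split: if_splits)
  then have "\<bar>x $ i\<bar> \<le> 1" for i
    by (auto simp: vfloor_def vec_eq_iff floor_eq_iff less_imp_le)
  then have "(\<Sum>i\<in>UNIV. \<bar>x $ i\<bar>) \<le> (\<Sum>i\<in>(UNIV::'n set). 1)" by (intro sum_mono)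
  then show False using norm_le_l1_cart[of x] assms by simp
qed

lemma cl2_unit_box_fun: "cl2 unit_box_fun"
  unfolding cl2_def using L2_unit_box_fun unit_box_fun_support by blast

lemma fourier_unit_box_tendsto:
  fixes \<xi> :: "real^'n"
  assumes "c \<longlonglongrightarrow> 0"
  shows "(\<lambda>m. fourier unit_box_fun (c m *\<^sub>R \<xi>)) \<longlonglongrightarrow> 1"
proof -
  let ?e = "\<lambda>m x. unit_box_fun x * exp (- \<i> * complex_of_real (x \<bullet> (c m *\<^sub>R \<xi>)))"
  have "(\<lambda>m. fourier unit_box_fun (c m *\<^sub>R \<xi>)) \<longlonglongrightarrow> (LINT x|(lborel :: (real^'n) measure). unit_box_fun x)"
    unfolding fourier_def
  proof (rule integral_dominated_convergence)
    show "integrable lborel (\<lambda>x::real^'n. if vfloor x = 0 then 1 else (0::real))"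
      by (rule cell_integral(1))
    show "AE x in lborel. (\<lambda>m. ?e m x) \<longlonglongrightarrow> unit_box_fun x"
    proof (rule AE_I2)
      fix x :: "real^'n"
      have "(\<lambda>m. ?e m x) \<longlonglongrightarrow>
          unit_box_fun x * exp (- \<i> * complex_of_real (x \<bullet> (0 *\<^sub>R \<xi>)))"
        by (intro tendsto_intros assms)
      then show "(\<lambda>m. ?e m x) \<longlonglongrightarrow> unit_box_fun x"
        by simp
    qed
    show "AE x in lborel. norm (?e m x)
        \<le> (if vfloor x = 0 then 1 else 0)" for m
      by (rule AE_I2) (simp add: unit_box_fun_def norm_mult)
  qed measurable
  also have "(LINT x|lborel. unit_box_fun (x::real^'n)) =
      complex_of_real (LINT x|lborel. (if vfloor (x::real^'n) = 0 then 1 else 0))"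
  proof -
    have eq: "unit_box_fun = (\<lambda>x::real^'n. complex_of_real (if vfloor x = 0 then 1 else 0))"
      by (simp add: fun_eq_iff unit_box_fun_def)
    show ?thesis unfolding eq by (rule integral_of_real) (rule cell_integral(1))
  qed
  finally show ?thesis by (simp only: cell_integral(2) of_real_1)
qed

lemma cmod_exp_minus_1_le: "cmod (exp (\<i> * complex_of_real t) - 1) \<le> \<bar>t\<bar>"
  using abs_sin_x_le_abs_x[of "t / 2"] by (simp add: dist_exp_i_1)

text \<open>For \<tau>, with value 1 at 0, this makes the factors of the infinite product differ
  from 1 by O(\<lambda>^(-j)), so the product converges absolutely.\<close>

definition lipschitz_at_0 :: "(real^'n \<Rightarrow> complex) \<Rightarrow> bool" where
  "lipschitz_at_0 f \<longleftrightarrow> (\<exists>C. \<forall>\<xi>. cmod (f \<xi> - f 0) \<le> C * norm \<xi>)"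

lemma lipschitz_at_0_exp: "lipschitz_at_0 (\<lambda>\<xi>. exp (\<i> * complex_of_real (a \<bullet> \<xi>)))"
  unfolding lipschitz_at_0_def
proof (intro exI allI)
  fix \<xi>
  have "cmod (exp (\<i> * complex_of_real (a \<bullet> \<xi>)) - 1) \<le> \<bar>a \<bullet> \<xi>\<bar>" by (rule cmod_exp_minus_1_le)
  also have "\<dots> \<le> norm a * norm \<xi>" by (rule Cauchy_Schwarz_ineq2)
  finally show "cmod (exp (\<i> * complex_of_real (a \<bullet> \<xi>)) - exp (\<i> * complex_of_real (a \<bullet> 0))) \<le> norm a * norm \<xi>"
    by simp
qed

lemma lipschitz_at_0_add:
  assumes "lipschitz_at_0 f" "lipschitz_at_0 g"
  shows "lipschitz_at_0 (\<lambda>\<xi>. f \<xi> + g \<xi>)"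
proof -
  obtain A B where A: "\<And>\<xi>. cmod (f \<xi> - f 0) \<le> A * norm \<xi>" and B: "\<And>\<xi>. cmod (g \<xi> - g 0) \<le> B * norm \<xi>"
    using assms unfolding lipschitz_at_0_def by blast
  have "cmod (f \<xi> + g \<xi> - (f 0 + g 0)) \<le> (A + B) * norm \<xi>" for \<xi>
    using norm_triangle_mono[OF A[of \<xi>] B[of \<xi>]] by (simp add: algebra_simps)
  then show ?thesis unfolding lipschitz_at_0_def by blast
qed

text \<open>The bound on f alone suffices by the splitting f g - f(0) g(0) = f (g - g(0)) + (f -
  f(0)) g(0).\<close>

lemma lipschitz_at_0_mult:
  assumes "lipschitz_at_0 f" "lipschitz_at_0 g" and bd: "\<And>\<xi>. cmod (f \<xi>) \<le> M"
  shows "lipschitz_at_0 (\<lambda>\<xi>. f \<xi> * g \<xi>)"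
proof -
  obtain A B where A: "\<And>\<xi>. cmod (f \<xi> - f 0) \<le> A * norm \<xi>" and B: "\<And>\<xi>. cmod (g \<xi> - g 0) \<le> B * norm \<xi>"
    using assms unfolding lipschitz_at_0_def by blast
  have "cmod (f \<xi> * g \<xi> - f 0 * g 0) \<le> (M * B + A * cmod (g 0)) * norm \<xi>" for \<xi>
  proof -
    have M: "0 \<le> M" using bd norm_ge_zero order_trans by blast
    have 1: "cmod (f \<xi> * (g \<xi> - g 0)) \<le> M * (B * norm \<xi>)"
      unfolding norm_mult by (intro mult_mono bd B M norm_ge_zero)
    have 2: "cmod ((f \<xi> - f 0) * g 0) \<le> A * norm \<xi> * cmod (g 0)"
      unfolding norm_mult by (intro mult_right_mono A norm_ge_zero)
    have "f \<xi> * g \<xi> - f 0 * g 0 = f \<xi> * (g \<xi> - g 0) + (f \<xi> - f 0) * g 0" by (simp add: algebra_simps)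
    then show ?thesis using norm_triangle_mono[OF 1 2] by (simp add: algebra_simps)
  qed
  then show ?thesis unfolding lipschitz_at_0_def by blast
qed

lemma lipschitz_at_0_const: "lipschitz_at_0 (\<lambda>\<xi>. c)"
  unfolding lipschitz_at_0_def by (intro exI[of _ 0]) simp

lemma lipschitz_at_0_cmult: "lipschitz_at_0 f \<Longrightarrow> lipschitz_at_0 (\<lambda>\<xi>. c * f \<xi>)"
  using lipschitz_at_0_mult[OF lipschitz_at_0_const] by blast

lemma lipschitz_at_0_sum:
  "(\<And>i. i \<in> A \<Longrightarrow> lipschitz_at_0 (f i)) \<Longrightarrow> lipschitz_at_0 (\<lambda>\<xi>. \<Sum>i\<in>A. f i \<xi>)"
  by (induction A rule: infinite_finite_induct) (auto intro: lipschitz_at_0_add lipschitz_at_0_const)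

lemma lipschitz_at_0_trig_poly:
  assumes p: "trig_poly p" shows "lipschitz_at_0 (\<lambda>\<xi>. p (c *\<^sub>R \<xi>))"
proof -
  have "(\<lambda>\<xi>. p (c *\<^sub>R \<xi>)) = (\<lambda>\<xi>. \<Sum>k\<in>tp_supp p. tp_coef p k * exp (\<i> * complex_of_real ((- c *\<^sub>R ivec k) \<bullet> \<xi>)))"
    by (rule ext, subst tp_expand[OF p]) simp
  then show ?thesis
    by (simp only:) (intro lipschitz_at_0_sum lipschitz_at_0_cmult lipschitz_at_0_exp)
qed

lemma tail_summable_powers:
  assumes "1 < (lam::real)" shows "summable (\<lambda>j. C * (1 / lam ^ Suc j))"
proof -
  have "summable (\<lambda>j. (1 / lam) ^ j)" using assms by (intro summable_geometric) simp
  then have "summable (\<lambda>j. C / lam * (1 / lam) ^ j)" by (rule summable_mult)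
  then show ?thesis by (simp add: power_one_over field_simps)
qed

section \<open>Cascade iterates and the infinite product\<close>

context masks begin

text \<open>The translates are indicators of disjoint cells of measure 1; on each cell
  Cauchy-Schwarz bounds the coefficient by the part of f living there.\<close>

lemma bessel_unit_box: "bessel unit_box_fun"
  unfolding bessel_def
proof (intro conjI allI impI)
  show "cl2 (unit_box_fun :: real^'n \<Rightarrow> complex)" by (rule cl2_unit_box_fun)
  fix f :: "real^'n \<Rightarrow> complex" assume f: "cl2 f"
  have fi: "integrable lborel (\<lambda>x. (cmod (f x))\<^sup>2)" and [measurable]: "f \<in> borel_measurable borel"
    using L2_fun_integrable L2_fun_measurable cl2_L2[OF f] by auto
  let ?c = "\<lambda>k x. if vfloor x = k then f x else 0"
  have cL2: "L2_fun (?c k)" for k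
    by (rule L2_fun_bound[OF fi]) (auto, measurable)
  have le: "(cmod (tr_coef f unit_box_fun k))\<^sup>2 \<le> (LINT x|lborel. (cmod (?c k x))\<^sup>2)" for k
  proof -
    let ?e = "\<lambda>x::real^'n. unit_box_fun (x - ivec k)"
    have e: "L2_fun ?e" by (rule cl2_L2[OF cl2_translate[OF cl2_unit_box_fun]])
    have "(cmod (?e x))\<^sup>2 = (if vfloor x = k then 1 else 0)" for x
      by (simp add: unit_box_fun_translate)
    then have n1: "L2_norm_fun ?e = 1" by (simp add: L2_norm_fun_def cell_integral(2))
    have "(\<lambda>x. f x * cnj (?e x)) = (\<lambda>x. ?c k x * cnj (?e x))"
      by (simp add: fun_eq_iff unit_box_fun_translate)
    then have "tr_coef f unit_box_fun k = L2_inner (?c k) ?e"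
      by (simp only: tr_coef_def L2_inner_def)
    then have "cmod (tr_coef f unit_box_fun k) \<le> L2_norm_fun (?c k)"
      using L2_Cauchy_Schwarz[OF cL2[of k] e] n1 by simp
    then have "(cmod (tr_coef f unit_box_fun k))\<^sup>2 \<le> (L2_norm_fun (?c k))\<^sup>2"
      by (simp add: power_mono)
    then show ?thesis by (simp only: L2_norm_fun_square)
  qed
  show "energy f unit_box_fun \<le> (L2_norm_fun f)\<^sup>2"
  proof (rule has_sum_le_finite_sums[OF energy_has_sum[OF f cl2_unit_box_fun]])
    fix K :: "(int^'n) set" assume K: "finite K"
    have "(\<Sum>k\<in>K. (cmod (tr_coef f unit_box_fun k))\<^sup>2) \<le> (\<Sum>k\<in>K. LINT x|lborel. (cmod (?c k x))\<^sup>2)"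
      by (intro sum_mono le)
    also have "\<dots> = (LINT x|lborel. (\<Sum>k\<in>K. (cmod (?c k x))\<^sup>2))"
      by (rule Bochner_Integration.integral_sum[symmetric]) (rule L2_fun_integrable[OF cL2])
    also have "\<dots> \<le> (LINT x|lborel. (cmod (f x))\<^sup>2)"
    proof (rule integral_mono[OF _ fi])
      show "integrable lborel (\<lambda>x. (\<Sum>k\<in>K. (cmod (?c k x))\<^sup>2))"
        by (intro Bochner_Integration.integrable_sum L2_fun_integrable cL2)
      fix x
      have "(\<Sum>k\<in>K. (cmod (?c k x))\<^sup>2) = (\<Sum>k\<in>K. if k = vfloor x then (cmod (f x))\<^sup>2 else 0)"
        by (intro sum.cong) auto
      also have "\<dots> \<le> (cmod (f x))\<^sup>2" using K by simp
      finally show "(\<Sum>k\<in>K. (cmod (?c k x))\<^sup>2) \<le> (cmod (f x))\<^sup>2" .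
    qed
    finally show "(\<Sum>k\<in>K. (cmod (tr_coef f unit_box_fun k))\<^sup>2) \<le> (L2_norm_fun f)\<^sup>2"
      by (simp only: L2_norm_fun_square)
  qed
qed

definition approximant :: "nat \<Rightarrow> real^'n \<Rightarrow> complex" where
  "approximant m = (cascade ^^ m) unit_box_fun"

lemma bessel_approximant: "bessel (approximant m)"
  unfolding approximant_def
  by (induction m) (auto intro: bessel_unit_box bessel_cascade)

lemma cl2_approximant: "cl2 (approximant m)"
  using bessel_approximant by (simp add: bessel_def)

lemma fourier_cascade': "cl2 u \<Longrightarrow> fourier (cascade u) \<xi> = \<tau> ((1 / real lam) *\<^sub>R \<xi>) * fourier u ((1 / real lam) *\<^sub>R \<xi>)"
  using fourier_cascade[of u "(1 / real lam) *\<^sub>R \<xi>"] lam_pos by simp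

lemma fourier_approximant:
  "fourier (approximant m) \<xi> =
    (\<Prod>j<m. \<tau> ((1 / real lam ^ Suc j) *\<^sub>R \<xi>)) * fourier unit_box_fun ((1 / real lam ^ m) *\<^sub>R \<xi>)"
proof (induction m arbitrary: \<xi>)
  case 0
  then show ?case by (simp add: approximant_def)
next
  case (Suc m)
  have "approximant (Suc m) = cascade (approximant m)" by (simp add: approximant_def)
  then have "fourier (approximant (Suc m)) \<xi> =
      \<tau> ((1 / real lam) *\<^sub>R \<xi>) * fourier (approximant m) ((1 / real lam) *\<^sub>R \<xi>)"
    by (simp add: fourier_cascade'[OF cl2_approximant])
  also have "\<dots> = (\<Prod>j<Suc m. \<tau> ((1 / real lam ^ Suc j) *\<^sub>R \<xi>)) *
      fourier unit_box_fun ((1 / real lam ^ Suc m) *\<^sub>R \<xi>)"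
    unfolding Suc.IH by (simp add: prod.lessThan_Suc_shift mult.commute mult.left_commute del: prod.lessThan_Suc)
  finally show ?case .
qed

text \<open>Dilation divides radii by \<lambda> \<ge> 2 while the finitely many translations add at
  most a constant, so every sufficiently large ball is preserved.\<close>

lemma cascade_support:
  "\<exists>C. \<forall>u R. R \<ge> C \<longrightarrow> (\<forall>x. R < norm x \<longrightarrow> u x = 0) \<longrightarrow> (\<forall>x. R < norm x \<longrightarrow> cascade u x = 0)"
proof -
  define S where "S = (\<Union>l\<in>{1..lam ^ CARD('n)}. (\<lambda>k. norm (real lam *\<^sub>R ivec k - ivec (\<nu> l))) ` tp_supp (p l))"
  have "finite S" unfolding S_def by (auto intro!: finite_tp_supp p_poly)
  then obtain C0 where "\<And>s. s \<in> S \<Longrightarrow> s \<le> C0"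
    using bdd_above_finite[of S] unfolding bdd_above_def by blast
  then have C0: "norm (real lam *\<^sub>R ivec k - ivec (\<nu> l)) \<le> C0"
    if "l \<in> {1..lam ^ CARD('n)}" "k \<in> tp_supp (p l)" for l k
    using that unfolding S_def by blast
  have "cascade u x = 0" if R: "R \<ge> max 0 C0" and u: "\<forall>x. R < norm x \<longrightarrow> u x = 0" and x: "R < norm x" for u R x
  proof -
    have "u (ivec (\<nu> l) + real lam *\<^sub>R (x - ivec k)) = 0"
      if l: "l \<in> {1..lam ^ CARD('n)}" and k: "k \<in> tp_supp (p l)" for l k
    proof -
      \<comment> \<open>The argument of u differs from \<lambda>x by at most \<open>C0\<close> \<le>
        R, so its norm still exceeds 2R - R.\<close>
      have "2 * R \<le> real lam * R" using R lam by (intro mult_right_mono) auto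
      also have "\<dots> < real lam * norm x" using x lam_pos by simp
      also have "\<dots> = norm ((ivec (\<nu> l) + real lam *\<^sub>R (x - ivec k)) + (real lam *\<^sub>R ivec k - ivec (\<nu> l)))"
        using lam_pos by (simp add: algebra_simps)
      also have "\<dots> \<le> norm (ivec (\<nu> l) + real lam *\<^sub>R (x - ivec k)) + C0"
        using norm_triangle_mono[OF order_refl C0[OF l k]] by blast
      finally have "R < norm (ivec (\<nu> l) + real lam *\<^sub>R (x - ivec k))" using R by simp
      then show ?thesis using u by blast
    qed
    then have "tp_op (p l) (polyphase l u) x = 0" if "l \<in> {1..lam ^ CARD('n)}" for l
      unfolding tp_op_def polyphase_def by (intro sum.neutral) (use that in auto)
    then show ?thesis by (simp add: cascade_def)
  qed
  then show ?thesis by blast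
qed

lemma approximant_support: "\<exists>R. \<forall>m x. R < norm x \<longrightarrow> approximant m x = 0"
proof -
  obtain C where C: "\<And>u R. R \<ge> C \<Longrightarrow> \<forall>x. R < norm x \<longrightarrow> u x = 0 \<Longrightarrow> \<forall>x. R < norm x \<longrightarrow> cascade u x = 0"
    using cascade_support by blast
  \<comment> \<open>Large enough for invariance under the cascade and for the unit cube with which
    the iteration starts.\<close>
  define R where "R = max C (real CARD('n))"
  have "\<forall>x. R < norm x \<longrightarrow> approximant m x = 0" for m
  proof (induction m)
    case 0
    then show ?case by (simp add: approximant_def R_def unit_box_fun_support)
  next
    case (Suc m)
    then show ?case using C[of R "approximant m"] by (simp add: approximant_def R_def)
  qed
  then show ?thesis by blast
qed

lemma mask_product: "\<exists>P. (\<lambda>j. \<tau> ((1 / real lam ^ Suc j) *\<^sub>R \<xi>)) has_prod P"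
proof -
  have "lipschitz_at_0 (\<lambda>\<xi>. p l (real lam *\<^sub>R \<xi>) * exp (\<i> * complex_of_real (ivec (\<nu> l) \<bullet> \<xi>)))"
    if "l \<in> {1..lam ^ CARD('n)}" for l
    by (rule lipschitz_at_0_mult[where M=1])
      (rule lipschitz_at_0_trig_poly[OF p_poly[OF that]] lipschitz_at_0_exp p_le[OF that])+
  then have "lipschitz_at_0 \<tau>"
    unfolding \<tau>_def by (intro lipschitz_at_0_cmult lipschitz_at_0_sum)
  then obtain C where C: "\<And>\<xi>. cmod (\<tau> \<xi> - 1) \<le> C * norm \<xi>"
    unfolding lipschitz_at_0_def \<tau>_0 by blast
  have "summable (\<lambda>j. norm (\<tau> ((1 / real lam ^ Suc j) *\<^sub>R \<xi>) - 1))"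
  proof (rule summable_comparison_test_ev)
    show "summable (\<lambda>j. (C * norm \<xi>) * (1 / real lam ^ Suc j))"
      using lam by (intro tail_summable_powers) simp
    show "\<forall>\<^sub>F j in sequentially. norm (norm (\<tau> ((1 / real lam ^ Suc j) *\<^sub>R \<xi>) - 1)) \<le>
        (C * norm \<xi>) * (1 / real lam ^ Suc j)"
      using C[of "(1 / real lam ^ Suc _) *\<^sub>R \<xi>"] by (intro always_eventually allI) (simp add: mult_ac)
  qed
  from convergent_prod_has_prod[OF abs_convergent_prod_imp_convergent_prod[OF
      summable_imp_abs_convergent_prod[OF this]]]
  show ?thesis by (rule exI)
qed

text \<open>The transform of an iterate is a partial product times the transform of the cube at
  \<lambda>^(-m) \<xi>, and the latter tends to 1. The uniform bounds on norms and supports then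
  allow a weak limit.\<close>

lemma refinable_exists:
  "\<exists>\<phi>. cl2 \<phi> \<and> (\<forall>\<xi>. (\<lambda>j. \<tau> ((1 / real lam ^ Suc j) *\<^sub>R \<xi>)) has_prod fourier \<phi> \<xi>)"
proof -
  obtain R where R: "\<And>m x. R < norm x \<Longrightarrow> approximant m x = 0" using approximant_support by blast
  obtain \<Lambda> where \<Lambda>: "\<And>\<xi>. (\<lambda>j. \<tau> ((1 / real lam ^ Suc j) *\<^sub>R \<xi>)) has_prod \<Lambda> \<xi>"
    using mask_product by metis
  have lim: "(\<lambda>m. fourier (approximant m) \<xi>) \<longlonglongrightarrow> \<Lambda> \<xi>" for \<xi>
  proof -
    have "(\<lambda>m. (1 / real lam) ^ m) \<longlonglongrightarrow> 0" using lam by (intro LIMSEQ_realpow_zero) auto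
    then have "(\<lambda>m. (\<Prod>j<m. \<tau> ((1 / real lam ^ Suc j) *\<^sub>R \<xi>)) *
        fourier unit_box_fun ((1 / real lam) ^ m *\<^sub>R \<xi>)) \<longlonglongrightarrow> \<Lambda> \<xi> * 1"
      by (intro tendsto_mult has_prod_imp_tendsto' \<Lambda> fourier_unit_box_tendsto)
    then show ?thesis by (simp add: fourier_approximant power_one_over)
  qed
  have "\<exists>\<phi>. L2_fun \<phi> \<and> (\<forall>x. R < norm x \<longrightarrow> \<phi> x = 0) \<and> (\<forall>\<xi>. fourier \<phi> \<xi> = \<Lambda> \<xi>)"
    by (rule fourier_weak_limit[of approximant])
      (auto intro: cl2_L2 cl2_approximant bessel_norm_le bessel_approximant R lim)
  then obtain \<phi> where "L2_fun \<phi>" "\<forall>x. R < norm x \<longrightarrow> \<phi> x = 0" "\<And>\<xi>. fourier \<phi> \<xi> = \<Lambda> \<xi>" by blast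
  then show ?thesis using \<Lambda> unfolding cl2_def by metis
qed

end

subsection \<open>Energies at fine and at coarse scales\<close>

text \<open>Carries the scale of a wavelet over to f: every wavelet coefficient becomes one with
  integer translates at scale 0, and \<open>stretch\<close> raises j by 1.\<close>

definition dilate :: "nat \<Rightarrow> int \<Rightarrow> (real^'n \<Rightarrow> complex) \<Rightarrow> real^'n \<Rightarrow> complex" where
  "dilate lam j f = (\<lambda>x. complex_of_real (real lam powr (- (real_of_int j * real CARD('n) / 2))) *
     f ((real lam powi (- j)) *\<^sub>R x))"

lemma powi_pos: "lam > 0 \<Longrightarrow> real lam powi j > 0"
  by (simp add: zero_less_power_int)

lemma stretch_dilate:
  fixes f :: "real^'n \<Rightarrow> complex"
  assumes "lam > 0"
  shows "stretch lam (dilate lam j f) = dilate lam (j + 1) f"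
proof
  fix x :: "real^'n"
  have "real lam powr (- real CARD('n) / 2) * real lam powr (- (real_of_int j * real CARD('n) / 2)) =
      real lam powr (- (real_of_int (j + 1) * real CARD('n) / 2))"
    unfolding powr_add[symmetric]
    by (rule arg_cong[where f = "\<lambda>t. real lam powr t"]) (simp add: field_simps)
  moreover have "(real lam powi (- j)) * (1 / real lam) = real lam powi (- (j + 1))"
    using assms by (simp add: power_int_diff power_int_minus power_int_add field_simps)
  ultimately show "stretch lam (dilate lam j f) x = dilate lam (j + 1) f x"
    unfolding stretch_def dilate_def mult.assoc[symmetric] scaleR_scaleR of_real_mult[symmetric] by (simp only:)
qed

lemma powr_half_dilate_square:
  assumes "lam > 0"
  shows "(real lam powr (- (real_of_int j * real n / 2)))\<^sup>2 = (real lam powi (- j)) ^ n"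
proof -
  have "(real lam powr (- (real_of_int j * real n / 2)))\<^sup>2 = real lam powr (- (real_of_int j * real n))"
    unfolding power2_eq_square powr_add[symmetric] by simp
  also have "\<dots> = (real lam powr real_of_int (- j)) powr real n"
    unfolding powr_powr by simp
  also have "\<dots> = (real lam powi (- j)) ^ n"
    using assms powi_pos[OF assms, of "- j"] powr_real_of_int'[of "real lam" "- j"]
    by (simp add: powr_realpow)
  finally show ?thesis .
qed

lemma cl2_dilate: "lam > 0 \<Longrightarrow> cl2 f \<Longrightarrow> cl2 (dilate lam j f)"
  unfolding dilate_def
  using cl2_affine[OF _ less_imp_neq[OF powi_pos[of lam "- j"], symmetric], of f 0]
  by (intro cl2_cmult) simp

lemma L2_norm_dilate:
  fixes f :: "real^'n \<Rightarrow> complex"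
  assumes "lam > 0"
  shows "L2_norm_fun (dilate lam j f) = L2_norm_fun f"
proof -
  have pos: "real lam powi (- j) > 0" using assms by (rule powi_pos)
  have "(LINT x|lborel. (cmod (dilate lam j f x))\<^sup>2) =
      (real lam powi (- j)) ^ CARD('n) * (LINT x|lborel. (cmod (f ((real lam powi (- j)) *\<^sub>R x)))\<^sup>2)"
    by (simp add: dilate_def norm_mult power_mult_distrib powr_half_dilate_square[OF assms])
  also have "\<dots> = (LINT x|lborel. (cmod (f x))\<^sup>2)"
    using integral_affine[OF less_imp_neq[OF pos, symmetric], of "\<lambda>x. (cmod (f x))\<^sup>2" 0] pos by simp
  finally show ?thesis by (simp add: L2_norm_fun_def)
qed

lemma L2_fun_wavelet:
  assumes "lam > 0" "L2_fun \<psi>" shows "L2_fun (wavelet lam \<psi> j k)"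
  unfolding wavelet_def
  using L2_fun_affine[OF assms(2) less_imp_neq[OF powi_pos[OF assms(1), of j], symmetric], of "- ivec k"]
  by (intro L2_fun_cmult) simp

lemma inner_wavelet:
  fixes f :: "real^'n \<Rightarrow> complex"
  assumes lam: "lam > 0"
  shows "L2_inner f (wavelet lam \<psi> j k) = tr_coef (dilate lam j f) \<psi> k"
proof -
  let ?c = "real lam powi (- j)"
  let ?a = "real lam powr (real_of_int j * real CARD('n) / 2)"
  have c: "?c > 0" using lam by (rule powi_pos)
  have cc: "real lam powi j * ?c = 1"
    using lam by (simp add: power_int_minus)
  have a: "?c ^ CARD('n) * ?a = real lam powr (- (real_of_int j * real CARD('n) / 2))"
  proof -
    have "?c ^ CARD('n) * ?a = real lam powr (- (real_of_int j * real CARD('n) / 2)) *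
        (real lam powr (- (real_of_int j * real CARD('n) / 2)) * ?a)"
      unfolding powr_half_dilate_square[OF lam, symmetric] power2_eq_square by simp
    then show ?thesis unfolding powr_add[symmetric] using lam by simp
  qed
  have "L2_inner f (wavelet lam \<psi> j k) = ?c ^ CARD('n) *\<^sub>R
      (LINT x|lborel. f (?c *\<^sub>R x) * cnj (of_real ?a * \<psi> (x - ivec k)))"
    unfolding L2_inner_def wavelet_def
    by (subst integral_affine[OF less_imp_neq[OF c, symmetric], of _ 0]) (simp add: cc)
  also have "\<dots> = of_real (?c ^ CARD('n) * ?a) *
      (LINT x|lborel. f (?c *\<^sub>R x) * cnj (\<psi> (x - ivec k)))"
    by (simp add: scaleR_conv_of_real algebra_simps flip: integral_mult_right_zero)
  also have "\<dots> = tr_coef (dilate lam j f) \<psi> k"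
    unfolding a tr_coef_def L2_inner_def dilate_def
    by (simp flip: integral_mult_right_zero add: mult.assoc)
  finally show ?thesis .
qed

text \<open>The cells have volume 1, so a sum over Z^n is the integral of a step function.\<close>

lemma step_function_integral:
  fixes F :: "int^'n \<Rightarrow> real"
  assumes fin: "finite {k. F k \<noteq> 0}"
  shows "(\<lambda>x. F (vfloor x)) \<in> borel_measurable borel"
    and "(LINT x|lborel. F (vfloor x)) = (\<Sum>\<^sub>\<infinity>k. F k)"
proof -
  let ?K = "{k. F k \<noteq> 0}"
  have eq: "(\<lambda>x. F (vfloor x)) = (\<lambda>x. \<Sum>k\<in>?K. F k * (if vfloor x = k then 1 else 0))"
    using fin by (auto simp: fun_eq_iff if_distrib sum.delta' cong: if_cong)
  show "(\<lambda>x. F (vfloor x)) \<in> borel_measurable borel"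
    unfolding eq by measurable
  have "(LINT x|lborel. F (vfloor x)) = (\<Sum>k\<in>?K. F k)"
    unfolding eq by (subst Bochner_Integration.integral_sum)
      (auto simp: cell_integral intro!: integrable_mult_right cell_integral)
  also have "\<dots> = (\<Sum>\<^sub>\<infinity>k. F k)"
    by (rule infsumI[symmetric], rule has_sum_finite_neutralI[OF fin]) auto
  finally show "(LINT x|lborel. F (vfloor x)) = (\<Sum>\<^sub>\<infinity>k. F k)" .
qed

lemma norm_vfloor_diff_le:
  fixes x :: "real^'n"
  shows "norm (ivec (vfloor x) - x) \<le> real CARD('n)"
proof -
  have "norm (ivec (vfloor x) - x) \<le> (\<Sum>i\<in>UNIV. \<bar>(ivec (vfloor x) - x) $ i\<bar>)"
    by (rule norm_le_l1_cart)
  also have "\<dots> \<le> (\<Sum>i\<in>(UNIV::'n set). 1)"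
  proof (rule sum_mono)
    fix i
    show "\<bar>(ivec (vfloor x) - x) $ i\<bar> \<le> 1"
      unfolding ivec_def vfloor_def vector_minus_component vec_lambda_beta abs_le_iff
      using of_int_floor_le[of "x $ i"] real_of_int_floor_add_one_gt[of "x $ i"] by linarith
  qed
  finally show ?thesis by simp
qed

text \<open>At fine scales the energy is a Riemann sum for \<open>\<bar>f\<bar>\<^sup>2\<close>, written as the integral of a step
  function so that dominated convergence applies.\<close>

lemma energy_fine_scale:
  fixes f \<phi> :: "real^'n \<Rightarrow> complex"
  assumes lam: "lam \<ge> 2" and f: "cc f" and \<phi>: "cl2 \<phi>" and one: "fourier \<phi> 0 = 1"
  shows "(\<lambda>j. energy (dilate lam (int j) f) \<phi>) \<longlonglongrightarrow> (L2_norm_fun f)\<^sup>2"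
proof -
  have l0: "lam > 0" and l1: "real lam > 1" using lam by auto
  obtain B where B: "\<And>x. cmod (f x) \<le> B" "B > 0" using cc_bounded[OF f] by blast
  obtain R where R: "\<And>x. R < norm x \<Longrightarrow> f x = 0" using f unfolding cc_def by blast
  obtain S where S: "\<And>x. S < norm x \<Longrightarrow> \<phi> x = 0" using \<phi> unfolding cl2_def by blast
  have f_cont: "isCont f x" for x using f by (simp add: cc_def continuous_on_eq_continuous_at)
  have [measurable]: "f \<in> borel_measurable borel" "\<phi> \<in> borel_measurable borel"
    using L2_fun_measurable cl2_L2 cc_cl2[OF f] \<phi> by auto
  have \<phi>1: "integrable lborel \<phi>" using cl2_L1[OF \<phi>] by (simp add: L1_fun_def)
  define M where "M = (LINT y|lborel. B * cmod (\<phi> y))"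
  \<comment> \<open>The coefficient without its normalization, recentred at the translate. For large
    j it is about f(\<lambda>^(-j) k), as \<phi> has integral 1.\<close>
  define s where "s j k = (LINT y|lborel. f ((1 / real lam ^ j) *\<^sub>R (y + ivec k)) * cnj (\<phi> y))" for j k
  have coef: "(cmod (tr_coef (dilate lam (int j) f) \<phi> k))\<^sup>2 = (1 / real lam ^ j) ^ CARD('n) * (cmod (s j k))\<^sup>2" for j k
  proof -
    have powi: "real lam powi (- int j) = 1 / real lam ^ j"
      by (simp add: power_int_minus divide_inverse)
    have eq: "tr_coef (dilate lam (int j) f) \<phi> k =
        of_real (real lam powr (- (real_of_int (int j) * real CARD('n) / 2))) * s j k"
      unfolding tr_coef_def L2_inner_def s_def
      by (subst integral_affine[where c = 1 and t = "ivec k"])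
        (simp_all add: dilate_def powi mult.assoc add.commute)
    show ?thesis
      unfolding eq norm_mult power_mult_distrib norm_of_real power2_abs
      by (simp only: powr_half_dilate_square[OF l0] powi)
  qed
  have s_bound: "cmod (s j k) \<le> M" for j k
    unfolding s_def M_def
  proof (rule order_trans[OF integral_norm_bound])
    let ?F = "\<lambda>y. f ((1 / real lam ^ j) *\<^sub>R (y + ivec k)) * cnj (\<phi> y)"
    show "(LINT y|lborel. cmod (?F y)) \<le>
        (LINT y|lborel. B * cmod (\<phi> y))"
    proof (rule integral_mono)
      show "integrable lborel (\<lambda>y. B * cmod (\<phi> y))" using \<phi>1 by simp
      then show "integrable lborel (\<lambda>y. cmod (?F y))"
        by (rule Bochner_Integration.integrable_bound) (measurable, use B in \<open>auto simp: norm_mult intro!: mult_right_mono\<close>)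
      show "cmod (?F y) \<le> B * cmod (\<phi> y)" for y
        using B by (auto simp: norm_mult intro!: mult_right_mono)
    qed
  qed
  have s_supp: "norm (ivec k) \<le> R * real lam ^ j + S" if "s j k \<noteq> 0" for j k
  proof -
    let ?F = "\<lambda>y. f ((1 / real lam ^ j) *\<^sub>R (y + ivec k)) * cnj (\<phi> y)"
    have "\<exists>y. ?F y \<noteq> 0"
    proof (rule ccontr)
      assume "\<nexists>y. ?F y \<noteq> 0"
      then have "(\<lambda>y. ?F y) = (\<lambda>y. 0)" by blast
      then show False using that by (simp add: s_def)
    qed
    then obtain y where "f ((1 / real lam ^ j) *\<^sub>R (y + ivec k)) \<noteq> 0" "\<phi> y \<noteq> 0" by auto
    then have "norm ((1 / real lam ^ j) *\<^sub>R (y + ivec k)) \<le> R" "norm y \<le> S" using R S by (meson not_le)+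
    then have "\<bar>1 / real lam ^ j\<bar> * norm (y + ivec k) \<le> R" by (simp only: norm_scaleR)
    then have "norm (y + ivec k) \<le> R * real lam ^ j" using l0 by (simp add: divide_le_eq)
    moreover have "norm (ivec k) \<le> norm (y + ivec k) + norm y"
      using norm_triangle_ineq4[of "y + ivec k" y] by simp
    ultimately show ?thesis using \<open>norm y \<le> S\<close> by linarith
  qed
  have s_fin: "finite {k. (cmod (s j k))\<^sup>2 \<noteq> 0}" for j
    using finite_subset[OF _ finite_ivec_norm_le[of "R * real lam ^ j + S"], of "{k. (cmod (s j k))\<^sup>2 \<noteq> 0}"]
      s_supp by auto
  \<comment> \<open>The lattice point k = \<open>vfloor\<close> of \<lambda>^j x follows a fixed x:
    \<lambda>^(-j) k tends to x.\<close>
  define G where "G j x = s j (vfloor (real lam ^ j *\<^sub>R x))" for j x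
  have meas0: "(\<lambda>x. (cmod (s j (vfloor x)))\<^sup>2) \<in> borel_measurable borel" for j
    by (rule step_function_integral(1)[OF s_fin])
  have G_meas [measurable]: "(\<lambda>x. (cmod (G j x))\<^sup>2) \<in> borel_measurable borel" for j
    unfolding G_def by (rule measurable_compose[OF _ meas0]) measurable
  have energy_G: "energy (dilate lam (int j) f) \<phi> = (LINT x|lborel. (cmod (G j x))\<^sup>2)" for j
  proof -
    have "energy (dilate lam (int j) f) \<phi> = (\<Sum>\<^sub>\<infinity>k. (1 / real lam ^ j) ^ CARD('n) * (cmod (s j k))\<^sup>2)"
      unfolding energy_def coef ..
    also have "\<dots> = (1 / real lam ^ j) ^ CARD('n) * (\<Sum>\<^sub>\<infinity>k. (cmod (s j k))\<^sup>2)"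
      by (rule infsum_cmult_right) (rule finite_nonzero_values_imp_summable_on, simp add: s_fin[simplified])
    also have "(\<Sum>\<^sub>\<infinity>k. (cmod (s j k))\<^sup>2) = (LINT x|lborel. (cmod (s j (vfloor x)))\<^sup>2)"
      by (rule step_function_integral(2)[OF s_fin, symmetric])
    also have "\<dots> = (real lam ^ j) ^ CARD('n) * (LINT x|lborel. (cmod (G j x))\<^sup>2)"
      using integral_affine[of "real lam ^ j" "\<lambda>x. (cmod (s j (vfloor x)))\<^sup>2" 0] l0 by (simp add: G_def)
    finally show ?thesis using l0 by (simp add: power_one_over)
  qed
  have pw0: "(\<lambda>j. 1 / real lam ^ j) \<longlonglongrightarrow> 0"
    using LIMSEQ_realpow_zero[of "1 / real lam"] l1 by (simp add: power_one_over)
  have G_lim: "(\<lambda>j. G j x) \<longlonglongrightarrow> f x" for x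
  proof -
    let ?z = "\<lambda>j y. (1 / real lam ^ j) *\<^sub>R (y + ivec (vfloor (real lam ^ j *\<^sub>R x)))"
    have arg: "(\<lambda>j. ?z j y) \<longlonglongrightarrow> x" for y
    proof -
      \<comment> \<open>The displacement of \<open>?z j y\<close> from x. It is O(\<lambda>^(-j)),
        since the floor moves each coordinate by at most 1.\<close>
      let ?d = "\<lambda>j. (1 / real lam ^ j) *\<^sub>R (y + (ivec (vfloor (real lam ^ j *\<^sub>R x)) - real lam ^ j *\<^sub>R x))"
      have "norm (?d j) \<le> (1 / real lam ^ j) * (norm y + real CARD('n))" for j
        unfolding norm_scaleR using l0 norm_triangle_mono[OF order_refl norm_vfloor_diff_le]
        by (intro mult_mono) auto
      then have "?d \<longlonglongrightarrow> 0"
        by (intro Lim_null_comparison[OF always_eventually[OF allI] tendsto_mult_left_zero[OF pw0]])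
      then have "(\<lambda>j. ?d j + x) \<longlonglongrightarrow> 0 + x" by (intro tendsto_add tendsto_const)
      moreover have "?d j + x = ?z j y" for j
        using l0 by (simp add: scaleR_right_distrib scaleR_right_diff_distrib)
      ultimately show ?thesis by simp
    qed
    have "(\<lambda>j. G j x) \<longlonglongrightarrow> (LINT y|lborel. f x * cnj (\<phi> y))"
      unfolding G_def s_def
    proof (rule integral_dominated_convergence)
      show "integrable lborel (\<lambda>y. B * cmod (\<phi> y))" using \<phi>1 by simp
      show "AE y in lborel. (\<lambda>j. f (?z j y) * cnj (\<phi> y)) \<longlonglongrightarrow> f x * cnj (\<phi> y)"
        by (intro AE_I2 tendsto_intros isCont_tendsto_compose[OF f_cont arg])
      show "AE y in lborel. norm (f (?z j y) * cnj (\<phi> y)) \<le> B * cmod (\<phi> y)" for j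
        using B by (auto simp: norm_mult intro!: mult_right_mono)
    qed measurable
    also have "(LINT y|lborel. f x * cnj (\<phi> y)) = f x * cnj (LINT y|lborel. \<phi> y)"
      by simp
    also have "(LINT y|lborel. \<phi> y) = 1" using one by (simp add: fourier_at_0)
    finally show ?thesis by simp
  qed
  \<comment> \<open>Domination needs a radius independent of j. As \<lambda>^j \<ge> 1, the terms S
    and n may be scaled along with R; the signs of R and S are not known, hence the absolute
    values.\<close>
  have G_supp: "G j x = 0" if "\<bar>R\<bar> + \<bar>S\<bar> + real CARD('n) < norm x" for j x
  proof (rule ccontr)
    assume "G j x \<noteq> 0"
    then have 1: "norm (ivec (vfloor (real lam ^ j *\<^sub>R x))) \<le> R * real lam ^ j + S"
      unfolding G_def by (rule s_supp)
    have p1: "1 \<le> real lam ^ j" using l1 by simp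
    have "norm (real lam ^ j *\<^sub>R x) \<le> norm (ivec (vfloor (real lam ^ j *\<^sub>R x))) + real CARD('n)"
      using norm_triangle_ineq4[of "ivec (vfloor (real lam ^ j *\<^sub>R x))"
          "ivec (vfloor (real lam ^ j *\<^sub>R x)) - real lam ^ j *\<^sub>R x"] norm_vfloor_diff_le[of "real lam ^ j *\<^sub>R x"] by simp
    then have "real lam ^ j * norm x \<le> R * real lam ^ j + S + real CARD('n)" using 1 by simp
    also have "\<dots> \<le> real lam ^ j * \<bar>R\<bar> + real lam ^ j * \<bar>S\<bar> + real lam ^ j * real CARD('n)"
    proof -
      have "R * real lam ^ j \<le> real lam ^ j * \<bar>R\<bar>"
        by (subst mult.commute) (intro mult_left_mono, auto)
      moreover have "1 * \<bar>S\<bar> \<le> real lam ^ j * \<bar>S\<bar>" using p1 by (intro mult_right_mono) auto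
      moreover have "1 * real CARD('n) \<le> real lam ^ j * real CARD('n)" using p1 by (intro mult_right_mono) auto
      ultimately show ?thesis by linarith
    qed
    also have "\<dots> = real lam ^ j * (\<bar>R\<bar> + \<bar>S\<bar> + real CARD('n))" by (simp add: algebra_simps)
    finally have "norm x \<le> \<bar>R\<bar> + \<bar>S\<bar> + real CARD('n)" using l0 by simp
    then show False using that by simp
  qed
  have "(\<lambda>j. LINT x|lborel. (cmod (G j x))\<^sup>2) \<longlonglongrightarrow> (LINT x|lborel. (cmod (f x))\<^sup>2)"
  proof (rule integral_dominated_convergence)
    let ?Q = "\<bar>R\<bar> + \<bar>S\<bar> + real CARD('n)"
    show "integrable lborel (\<lambda>x::real^'n. M\<^sup>2 * indicator (cball 0 ?Q) x)"
      by (intro integrable_mult_right integrable_indicator_cball)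
    show "AE x in lborel. (\<lambda>j. (cmod (G j x))\<^sup>2) \<longlonglongrightarrow> (cmod (f x))\<^sup>2"
      by (intro AE_I2 tendsto_intros G_lim)
    show "AE x in lborel. norm ((cmod (G j x))\<^sup>2) \<le> M\<^sup>2 * indicator (cball 0 ?Q) x" for j
    proof (rule AE_I2)
      fix x
      have "(cmod (G j x))\<^sup>2 \<le> M\<^sup>2" unfolding G_def by (rule power_mono[OF s_bound norm_ge_zero])
      then show "norm ((cmod (G j x))\<^sup>2) \<le> M\<^sup>2 * indicator (cball 0 ?Q) x"
        using G_supp[of x j] by (cases "?Q < norm x") auto
    qed
  qed measurable
  then show ?thesis by (simp only: energy_G L2_norm_fun_square)
qed

text \<open>At coarse scales the dilated test function concentrates at the origin, where the translates of
  \<open>\<phi>\<close> have little mass.\<close>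

lemma energy_coarse_scale:
  fixes f \<phi> :: "real^'n \<Rightarrow> complex"
  assumes lam: "lam \<ge> 2" and f: "cl2 f" and \<phi>: "cl2 \<phi>"
  shows "(\<lambda>j. energy (dilate lam (- int j) f) \<phi>) \<longlonglongrightarrow> 0"
proof -
  have l0: "lam > 0" and l1: "real lam > 1" using lam by auto
  obtain R where R: "\<And>x. R < norm x \<Longrightarrow> f x = 0" using f unfolding cl2_def by blast
  obtain S where S: "\<And>x. S < norm x \<Longrightarrow> \<phi> x = 0" using \<phi> unfolding cl2_def by blast
  have [measurable]: "\<phi> \<in> borel_measurable borel" using L2_fun_measurable cl2_L2[OF \<phi>] by auto
  let ?f = "\<lambda>j. dilate lam (- int j) f"
  let ?B = "\<lambda>j. {x::real^'n. real lam ^ j * norm x \<le> R}"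
  have f_supp: "?f j x = 0" if "x \<notin> ?B j" for j x
    using that R[of "real lam ^ j *\<^sub>R x"] by (simp add: dilate_def)
  \<comment> \<open>The dilated f lives on the ball of radius \<lambda>^(-j) R, so only this part of
    the translate of \<phi> meets it.\<close>
  define c where "c j k x = (if x \<in> ?B j then \<phi> (x - ivec k) else 0)" for j k x
  have L2t: "L2_fun (\<lambda>x. \<phi> (x - ivec k))" for k by (rule cl2_L2[OF cl2_translate[OF \<phi>]])
  have c_meas [measurable]: "c j k \<in> borel_measurable borel" for j k
    unfolding c_def by measurable
  have c_L2: "L2_fun (c j k)" for j k
    by (rule L2_fun_bound[OF L2_fun_integrable[OF L2t[of k]] c_meas]) (simp add: c_def)
  have coef_le: "(cmod (tr_coef (?f j) \<phi> k))\<^sup>2 \<le> (L2_norm_fun f)\<^sup>2 * (LINT x|lborel. (cmod (c j k x))\<^sup>2)" for j k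
  proof -
    have "(\<lambda>x. ?f j x * cnj (\<phi> (x - ivec k))) = (\<lambda>x. ?f j x * cnj (c j k x))"
      using f_supp by (auto simp: fun_eq_iff c_def)
    then have "tr_coef (?f j) \<phi> k = L2_inner (?f j) (c j k)"
      by (simp only: tr_coef_def L2_inner_def)
    then have "cmod (tr_coef (?f j) \<phi> k) \<le> L2_norm_fun f * L2_norm_fun (c j k)"
      using L2_Cauchy_Schwarz[OF cl2_L2[OF cl2_dilate[OF l0 f]] c_L2] by (simp add: L2_norm_dilate[OF l0])
    then have "(cmod (tr_coef (?f j) \<phi> k))\<^sup>2 \<le> (L2_norm_fun f * L2_norm_fun (c j k))\<^sup>2"
      by (simp add: power_mono)
    then show ?thesis by (simp only: power_mult_distrib L2_norm_fun_square)
  qed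
  have c_lim: "(\<lambda>j. LINT x|lborel. (cmod (c j k x))\<^sup>2) \<longlonglongrightarrow> 0" for k
  proof -
    have "(\<lambda>j. LINT x|lborel. (cmod (c j k x))\<^sup>2) \<longlonglongrightarrow> (LINT x|(lborel :: (real^'n) measure). 0)"
    proof (rule integral_dominated_convergence)
      show "integrable lborel (\<lambda>x. (cmod (\<phi> (x - ivec k)))\<^sup>2)" by (rule L2_fun_integrable[OF L2t])
      \<comment> \<open>The origin is the one point that the shrinking balls may keep, and it is a
        null set.\<close>
      have "AE x in lborel. x \<notin> {0::real^'n}" by (intro AE_not_in) (simp add: null_setsI)
      then show "AE x in lborel. (\<lambda>j. (cmod (c j k x))\<^sup>2) \<longlonglongrightarrow> 0"
      proof eventually_elim
        case (elim x)
        obtain m where m: "R / norm x < real lam ^ m" using real_arch_pow[OF l1] by blast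
        have "\<forall>\<^sub>F j in sequentially. R < real lam ^ j * norm x"
          using eventually_ge_at_top[of m]
        proof eventually_elim
          case (elim j)
          then have "real lam ^ m \<le> real lam ^ j" using l1 by (intro power_increasing) auto
          then show ?case using m \<open>x \<notin> {0}\<close> by (simp add: field_simps less_le_trans)
        qed
        then have "\<forall>\<^sub>F j in sequentially. (cmod (c j k x))\<^sup>2 = 0"
          by eventually_elim (simp add: c_def)
        then show ?case by (rule tendsto_eventually)
      qed
      show "AE x in lborel. norm ((cmod (c j k x))\<^sup>2) \<le> (cmod (\<phi> (x - ivec k)))\<^sup>2" for j
        by (rule AE_I2) (simp add: c_def)
    qed measurable
    then show ?thesis by simp
  qed
  \<comment> \<open>As \<lambda>^j \<ge> 1, all these balls lie in the one of radius |R|, so one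
    finite set of translates serves every scale.\<close>
  define K where "K = {k::int^'n. norm (ivec k) \<le> \<bar>R\<bar> + S}"
  have K: "finite K" unfolding K_def by (rule finite_ivec_norm_le)
  have out: "tr_coef (?f j) \<phi> k = 0" if "k \<notin> K" for j k
  proof -
    have zero: "?f j x * cnj (\<phi> (x - ivec k)) = 0" for x
    proof (cases "x \<in> ?B j")
      case True
      have "norm x \<le> \<bar>R\<bar>"
      proof -
        have "1 * norm x \<le> real lam ^ j * norm x" using l1 by (intro mult_right_mono) auto
        then show ?thesis using True by simp
      qed
      moreover have "norm (ivec k) \<le> norm x + norm (x - ivec k)"
        using norm_triangle_ineq4[of x "x - ivec k"] by simp
      ultimately have "S < norm (x - ivec k)" using that by (simp add: K_def)
      then show ?thesis using S by simp
    qed (simp add: f_supp)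
    show ?thesis unfolding tr_coef_def L2_inner_def zero by simp
  qed
  have energy_K: "energy (?f j) \<phi> = (\<Sum>k\<in>K. (cmod (tr_coef (?f j) \<phi> k))\<^sup>2)" for j
    unfolding energy_def
    by (rule infsumI, rule has_sum_finite_neutralI[OF K]) (auto simp: out)
  have "(\<lambda>j. \<Sum>k\<in>K. (cmod (tr_coef (?f j) \<phi> k))\<^sup>2) \<longlonglongrightarrow> (\<Sum>k\<in>K. 0)"
  proof (intro tendsto_sum)
    fix k
    have "(\<lambda>j. (L2_norm_fun f)\<^sup>2 * (LINT x|lborel. (cmod (c j k x))\<^sup>2)) \<longlonglongrightarrow> (L2_norm_fun f)\<^sup>2 * 0"
      by (intro tendsto_intros c_lim)
    then show "(\<lambda>j. (cmod (tr_coef (?f j) \<phi> k))\<^sup>2) \<longlonglongrightarrow> 0"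
      by (intro Lim_null_comparison[of "\<lambda>j. (cmod (tr_coef (?f j) \<phi> k))\<^sup>2"]) (auto intro!: always_eventually coef_le)
  qed
  then show ?thesis by (simp add: energy_K)
qed

subsection \<open>Telescoping\<close>

text \<open>Level j contributes T(j+1) - T(j), so the levels from -J to J-1 sum to T(J) - T(-J). The
  result is split into the two bounds on finite partial sums that the density argument takes
  up.\<close>

lemma frame_identity_cc:
  fixes \<psi> :: "'i \<Rightarrow> real^'n \<Rightarrow> complex"
  assumes lam: "lam \<ge> 2" and I: "finite I" and \<psi>: "\<And>i. i \<in> I \<Longrightarrow> cl2 (\<psi> i)"
    and \<phi>: "cl2 \<phi>" "fourier \<phi> 0 = 1"
    and step: "\<And>f. cl2 f \<Longrightarrow> (\<Sum>i\<in>I. energy f (\<psi> i)) + energy f \<phi> = energy (stretch lam f) \<phi>"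
    and f: "cc f"
  defines "a \<equiv> \<lambda>(i, j, k). (cmod (L2_inner f (wavelet lam (\<psi> i) j k)))\<^sup>2"
  shows "\<And>F. finite F \<Longrightarrow> F \<subseteq> I \<times> UNIV \<times> UNIV \<Longrightarrow> sum a F \<le> (L2_norm_fun f)\<^sup>2"
    and "\<And>e. e > 0 \<Longrightarrow> \<exists>F. finite F \<and> F \<subseteq> I \<times> UNIV \<times> UNIV \<and> (L2_norm_fun f)\<^sup>2 - e < sum a F"
proof -
  have l0: "lam > 0" using lam by simp
  define T where "T j = energy (dilate lam j f) \<phi>" for j :: int
  define W where "W j = (\<Sum>i\<in>I. energy (dilate lam j f) (\<psi> i))" for j :: int
  have cf: "cl2 (dilate lam j f)" for j by (rule cl2_dilate[OF l0 cc_cl2[OF f]])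
  have a_eq: "a (i, j, k) = (cmod (tr_coef (dilate lam j f) (\<psi> i) k))\<^sup>2" for i j k
    by (simp add: a_def inner_wavelet[OF l0])
  have a_nonneg: "0 \<le> a x" for x by (cases x) (simp add: a_eq)
  have energy_nonneg: "0 \<le> energy g u" for g u :: "real^'n \<Rightarrow> complex"
    unfolding energy_def by (rule infsum_nonneg) simp
  have W: "W j = T (j + 1) - T j" for j
    using step[OF cf[of j]] by (simp add: W_def T_def stretch_dilate[OF l0])
  have W_nonneg: "0 \<le> W j" for j
    unfolding W_def by (intro sum_nonneg energy_nonneg)
  have tele: "(\<Sum>j\<in>{- int J..<int J}. W j) = T (int J) - T (- int J)" for J
  proof (induction J)
    case (Suc J)
    have "{- int (Suc J)..<int (Suc J)} = insert (- int J - 1) (insert (int J) {- int J..<int J})"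
      by auto
    moreover have "- int J - 1 = - 1 - int J" "T (int J + 1) = T (1 + int J)"
      by (simp_all only: add.commute)
    ultimately show ?case using Suc by (simp add: W)
  qed simp
  have T_fine: "(\<lambda>J. T (int J)) \<longlonglongrightarrow> (L2_norm_fun f)\<^sup>2"
    unfolding T_def by (rule energy_fine_scale[OF lam f \<phi>])
  have T_coarse: "(\<lambda>J. T (- int J)) \<longlonglongrightarrow> 0"
    unfolding T_def by (rule energy_coarse_scale[OF lam cc_cl2[OF f] \<phi>(1)])
  have lim: "(\<lambda>J. \<Sum>j\<in>{- int J..<int J}. W j) \<longlonglongrightarrow> (L2_norm_fun f)\<^sup>2"
    using tendsto_diff[OF T_fine T_coarse] by (simp add: tele)
  have inc: "incseq (\<lambda>J. \<Sum>j\<in>{- int J..<int J}. W j)"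
    by (intro monoI sum_mono2 W_nonneg) auto
  show "sum a F \<le> (L2_norm_fun f)\<^sup>2" if F: "finite F" "F \<subseteq> I \<times> UNIV \<times> UNIV" for F
  proof -
    \<comment> \<open>Only finitely many levels occur in F; the successor is due to the half-open
      range of levels, the inserted 0 to a possibly empty F.\<close>
    define J where "J = Suc (Max (insert 0 ((\<lambda>(i, j, k). nat \<bar>j\<bar>) ` F)))"
    define K where "K = (\<lambda>(i, j, k). k) ` F"
    have K: "finite K" using F by (simp add: K_def)
    have "F \<subseteq> I \<times> {- int J..<int J} \<times> K"
    proof
      fix x assume x: "x \<in> F"
      obtain i j k where ijk: "x = (i, j, k)" by (cases x)
      have "i \<in> I" using x ijk F by auto
      moreover have "k \<in> K" using x ijk unfolding K_def by force
      moreover have "j \<in> {- int J..<int J}"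
      proof -
        have "nat \<bar>j\<bar> \<in> insert 0 ((\<lambda>(i, j, k). nat \<bar>j\<bar>) ` F)" using x ijk by force
        then have "nat \<bar>j\<bar> < J"
          unfolding J_def using F by (intro le_imp_less_Suc Max_ge) auto
        then show ?thesis by auto
      qed
      ultimately show "x \<in> I \<times> {- int J..<int J} \<times> K" by (simp add: ijk)
    qed
    then have "sum a F \<le> sum a (I \<times> {- int J..<int J} \<times> K)"
      using I K by (intro sum_mono2 a_nonneg) auto
    also have "\<dots> = (\<Sum>i\<in>I. \<Sum>j\<in>{- int J..<int J}. \<Sum>k\<in>K. (cmod (tr_coef (dilate lam j f) (\<psi> i) k))\<^sup>2)"
      by (simp only: sum.cartesian_product' a_eq)
    also have "\<dots> \<le> (\<Sum>i\<in>I. \<Sum>j\<in>{- int J..<int J}. energy (dilate lam j f) (\<psi> i))"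
      by (intro sum_mono finite_sum_le_has_sum[OF energy_has_sum[OF cf \<psi>]] K) auto
    also have "\<dots> = (\<Sum>j\<in>{- int J..<int J}. W j)"
      unfolding W_def by (rule sum.swap)
    also have "\<dots> \<le> (L2_norm_fun f)\<^sup>2" by (rule incseq_le[OF inc lim])
    finally show ?thesis .
  qed
  show "\<exists>F. finite F \<and> F \<subseteq> I \<times> UNIV \<times> UNIV \<and> (L2_norm_fun f)\<^sup>2 - e < sum a F" if "e > 0" for e
  proof -
    have "\<forall>\<^sub>F J in sequentially. (L2_norm_fun f)\<^sup>2 - e < (\<Sum>j\<in>{- int J..<int J}. W j)"
      using order_tendstoD(1)[OF lim, of "(L2_norm_fun f)\<^sup>2 - e"] that by simp
    then obtain J where J: "(L2_norm_fun f)\<^sup>2 - e < (\<Sum>j\<in>{- int J..<int J}. W j)"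
      using eventually_happens'[OF sequentially_bot] by blast
    define K where "K = (\<Union>i\<in>I. \<Union>j\<in>{- int J..<int J}. {k. tr_coef (dilate lam j f) (\<psi> i) k \<noteq> 0})"
    have K: "finite K"
      unfolding K_def using I \<psi> cf by (intro finite_UN_I tr_coef_finite) auto
    have en: "energy (dilate lam j f) (\<psi> i) = (\<Sum>k\<in>K. a (i, j, k))"
      if "i \<in> I" "j \<in> {- int J..<int J}" for i j
      unfolding energy_def a_eq
      by (rule infsumI, rule has_sum_finite_neutralI[OF K]) (use that in \<open>auto simp: K_def\<close>)
    have "(\<Sum>j\<in>{- int J..<int J}. W j) = (\<Sum>i\<in>I. \<Sum>j\<in>{- int J..<int J}. energy (dilate lam j f) (\<psi> i))"
      unfolding W_def by (rule sum.swap)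
    also have "\<dots> = (\<Sum>i\<in>I. \<Sum>j\<in>{- int J..<int J}. \<Sum>k\<in>K. a (i, j, k))"
      by (intro sum.cong refl en)
    also have "\<dots> = sum a (I \<times> {- int J..<int J} \<times> K)"
      by (simp only: sum.cartesian_product')
    finally show ?thesis
      using J I K by (intro exI[of _ "I \<times> {- int J..<int J} \<times> K"]) auto
  qed
qed

lemma L2_set_inner_diff_le:
  fixes f g :: "real^'n \<Rightarrow> complex"
  assumes f: "L2_fun f" and g: "L2_fun g" and w: "\<And>x. x \<in> F \<Longrightarrow> L2_fun (w x)"
  shows "L2_set (\<lambda>x. cmod (L2_inner f (w x))) F \<le>
    L2_set (\<lambda>x. cmod (L2_inner g (w x))) F + L2_set (\<lambda>x. cmod (L2_inner (\<lambda>y. f y - g y) (w x))) F"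
proof -
  have "L2_set (\<lambda>x. cmod (L2_inner f (w x))) F \<le>
      L2_set (\<lambda>x. cmod (L2_inner g (w x)) + cmod (L2_inner (\<lambda>y. f y - g y) (w x))) F"
  proof (rule L2_set_mono)
    fix x assume "x \<in> F"
    then have "L2_inner f (w x) = L2_inner g (w x) + L2_inner (\<lambda>y. f y - g y) (w x)"
      using f g w by (simp add: L2_inner_diff_left)
    then show "cmod (L2_inner f (w x)) \<le> cmod (L2_inner g (w x)) + cmod (L2_inner (\<lambda>y. f y - g y) (w x))"
      by (metis norm_triangle_ineq)
  qed simp
  also have "\<dots> \<le> L2_set (\<lambda>x. cmod (L2_inner g (w x))) F + L2_set (\<lambda>x. cmod (L2_inner (\<lambda>y. f y - g y) (w x))) F"
    by (rule L2_set_triangle_ineq)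
  finally show ?thesis .
qed

text \<open>Over a finite set of indices the coefficients depend continuously on the function, so
  the upper bound passes from \<open>cc\<close> to all of L^2. This bound, uniform in the index set,
  then controls the approximation error in the lower one.\<close>

lemma tight_frame_by_density:
  fixes w :: "'x \<Rightarrow> real^'n \<Rightarrow> complex"
  assumes w: "\<And>x. x \<in> X \<Longrightarrow> L2_fun (w x)"
    and upper: "\<And>g F. cc g \<Longrightarrow> finite F \<Longrightarrow> F \<subseteq> X \<Longrightarrow> (\<Sum>x\<in>F. (cmod (L2_inner g (w x)))\<^sup>2) \<le> (L2_norm_fun g)\<^sup>2"
    and lower: "\<And>g e. cc g \<Longrightarrow> e > 0 \<Longrightarrow>
      \<exists>F. finite F \<and> F \<subseteq> X \<and> (L2_norm_fun g)\<^sup>2 - e < (\<Sum>x\<in>F. (cmod (L2_inner g (w x)))\<^sup>2)"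
    and f: "L2_fun f"
  shows "((\<lambda>x. (cmod (L2_inner f (w x)))\<^sup>2) has_sum (L2_norm_fun f)\<^sup>2) X"
proof -
  define A where "A h F = L2_set (\<lambda>x. cmod (L2_inner h (w x))) F" for h F
  have A2: "(\<Sum>x\<in>F. (cmod (L2_inner h (w x)))\<^sup>2) = (A h F)\<^sup>2" for h F
    by (simp add: A_def L2_set_def sum_nonneg)
  have A_cc: "A g F \<le> L2_norm_fun g" if "cc g" "finite F" "F \<subseteq> X" for g F
    using upper[OF that] unfolding A2 by (rule power2_le_imp_le) simp
  have bound: "A h F \<le> L2_norm_fun h" if h: "L2_fun h" and F: "finite F" "F \<subseteq> X" for h F
  proof (rule field_le_epsilon)
    fix e :: real assume "e > 0"
    \<comment> \<open>A crude constant depending on F does no harm, since g is chosen after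
      F.\<close>
    define C where "C = (\<Sum>x\<in>F. L2_norm_fun (w x)) + 1"
    have C: "C > 0" unfolding C_def by (intro add_nonneg_pos sum_nonneg) auto
    have "e / (C + 1) > 0" using \<open>e > 0\<close> C by simp
    then obtain g where g: "cc g" "L2_norm_fun (\<lambda>x. h x - g x) < e / (C + 1)"
      using cc_dense_L2[OF h] by metis
    have gL2: "L2_fun g" using cl2_L2[OF cc_cl2[OF g(1)]] .
    have d: "L2_fun (\<lambda>x. h x - g x)" by (rule L2_fun_diff[OF h gL2])
    let ?d = "L2_norm_fun (\<lambda>x. h x - g x)"
    have "A (\<lambda>x. h x - g x) F \<le> (\<Sum>x\<in>F. cmod (L2_inner (\<lambda>y. h y - g y) (w x)))"
      unfolding A_def by (rule L2_set_le_sum) simp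
    also have "\<dots> \<le> (\<Sum>x\<in>F. ?d * L2_norm_fun (w x))"
      using F by (intro sum_mono L2_Cauchy_Schwarz d w) auto
    also have "\<dots> \<le> ?d * C" by (simp add: C_def sum_distrib_left[symmetric] mult_left_mono)
    finally have 1: "A (\<lambda>x. h x - g x) F \<le> ?d * C" .
    have "A h F \<le> A g F + A (\<lambda>x. h x - g x) F"
      unfolding A_def using F w by (intro L2_set_inner_diff_le h gL2) auto
    also have "\<dots> \<le> L2_norm_fun g + ?d * C" using 1 A_cc[OF g(1) F] by simp
    also have "L2_norm_fun g \<le> L2_norm_fun h + ?d"
      using L2_norm_fun_le_diff[OF gL2 h] unfolding L2_norm_fun_minus_commute[of g h] .
    also have "L2_norm_fun h + ?d + ?d * C = L2_norm_fun h + ?d * (C + 1)" by (simp add: algebra_simps)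
    also have "\<dots> \<le> L2_norm_fun h + e / (C + 1) * (C + 1)"
      using g(2) C by (intro add_left_mono mult_right_mono) auto
    also have "\<dots> = L2_norm_fun h + e" using C by simp
    finally show "A h F \<le> L2_norm_fun h + e" by simp
  qed
  let ?a = "\<lambda>x. (cmod (L2_inner f (w x)))\<^sup>2"
  have up: "sum ?a F \<le> (L2_norm_fun f)\<^sup>2" if "finite F" "F \<subseteq> X" for F
    unfolding A2 using bound[OF f that] by (intro power_mono) (auto simp: A_def)
  have "bdd_above (sum ?a ` {F. F \<subseteq> X \<and> finite F})"
    using up by (intro bdd_aboveI2[where M = "(L2_norm_fun f)\<^sup>2"]) auto
  then have summ: "?a summable_on X"
    by (intro nonneg_bdd_above_summable_on) auto
  have "infsum ?a X \<le> (L2_norm_fun f)\<^sup>2"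
    by (rule infsum_le_finite_sums[OF summ up])
  moreover have "L2_norm_fun f \<le> sqrt (infsum ?a X)"
  proof (rule field_le_epsilon)
    fix e :: real assume "e > 0"
    then obtain g where g: "cc g" "L2_norm_fun (\<lambda>x. f x - g x) < e / 3"
      using cc_dense_L2[OF f, of "e / 3"] by auto
    have gL2: "L2_fun g" using cl2_L2[OF cc_cl2[OF g(1)]] .
    let ?d = "L2_norm_fun (\<lambda>x. f x - g x)"
    \<comment> \<open>The tolerance is squared because the estimate is turned into one between
      norms, by a^2 + b^2 \<le> (a + b)^2 for a, b \<ge> 0.\<close>
    obtain F where F: "finite F" "F \<subseteq> X" and "(L2_norm_fun g)\<^sup>2 - (e / 3)\<^sup>2 < (\<Sum>x\<in>F. (cmod (L2_inner g (w x)))\<^sup>2)"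
      using lower[OF g(1), of "(e / 3)\<^sup>2"] \<open>e > 0\<close> by auto
    then have "(L2_norm_fun g)\<^sup>2 \<le> (A g F)\<^sup>2 + (e / 3)\<^sup>2" by (simp add: A2)
    also have "\<dots> \<le> (A g F + e / 3)\<^sup>2"
      using \<open>e > 0\<close> by (simp add: power2_sum A_def)
    finally have 1: "L2_norm_fun g \<le> A g F + e / 3"
      by (rule power2_le_imp_le) (use \<open>e > 0\<close> in \<open>simp add: A_def add_nonneg_nonneg\<close>)
    have 2: "A g F \<le> A f F + A (\<lambda>x. g x - f x) F"
      unfolding A_def using F w by (intro L2_set_inner_diff_le f gL2) auto
    have 3: "A (\<lambda>x. g x - f x) F \<le> ?d"
      using bound[OF L2_fun_diff[OF gL2 f] F] unfolding L2_norm_fun_minus_commute[of g f] .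
    have "(A f F)\<^sup>2 \<le> infsum ?a X"
      unfolding A2[symmetric] by (rule finite_sum_le_infsum[OF summ F]) simp
    then have 4: "A f F \<le> sqrt (infsum ?a X)" by (rule real_le_rsqrt)
    have "L2_norm_fun f \<le> L2_norm_fun g + ?d" by (rule L2_norm_fun_le_diff[OF f gL2])
    then show "L2_norm_fun f \<le> sqrt (infsum ?a X) + e"
      using 1 2 3 4 g(2) by linarith
  qed
  then have "(L2_norm_fun f)\<^sup>2 \<le> infsum ?a X"
    using infsum_nonneg[of X ?a] by (metis L2_norm_fun_nonneg power_mono real_sqrt_pow2 zero_le_power2)
  ultimately have "infsum ?a X = (L2_norm_fun f)\<^sup>2" by simp
  then show ?thesis using has_sum_infsum[OF summ] by simp
qed

lemma tight_wavelet_frameI: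
  fixes \<psi> :: "'i \<Rightarrow> real^'n \<Rightarrow> complex"
  assumes lam: "lam \<ge> 2" and I: "finite I" and \<psi>: "\<And>i. i \<in> I \<Longrightarrow> cl2 (\<psi> i)"
    and \<phi>: "cl2 \<phi>" "fourier \<phi> 0 = 1"
    and step: "\<And>f. cl2 f \<Longrightarrow> (\<Sum>i\<in>I. energy f (\<psi> i)) + energy f \<phi> = energy (stretch lam f) \<phi>"
  shows "tight_wavelet_frame lam I \<psi>"
  unfolding tight_wavelet_frame_def
proof (intro conjI ballI allI impI I)
  show "L2_fun (\<psi> i)" if "i \<in> I" for i using cl2_L2[OF \<psi>[OF that]] .
  fix f :: "real^'n \<Rightarrow> complex" assume f: "L2_fun f"
  let ?w = "\<lambda>(i, j, k). wavelet lam (\<psi> i) j k"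
  have eq: "(\<lambda>(i, j, k). (cmod (L2_inner g (wavelet lam (\<psi> i) j k)))\<^sup>2) = (\<lambda>x. (cmod (L2_inner g (?w x)))\<^sup>2)"
    for g by (simp add: fun_eq_iff)
  show "((\<lambda>(i, j, k). (cmod (L2_inner f (wavelet lam (\<psi> i) j k)))\<^sup>2) has_sum (L2_norm_fun f)\<^sup>2)
      (I \<times> UNIV \<times> UNIV)"
    unfolding eq
  proof (rule tight_frame_by_density[OF _ _ _ f])
    show "L2_fun (?w x)" if "x \<in> I \<times> UNIV \<times> UNIV" for x
      using that lam by (auto intro!: L2_fun_wavelet cl2_L2[OF \<psi>])
    show "(\<Sum>x\<in>F. (cmod (L2_inner g (?w x)))\<^sup>2) \<le> (L2_norm_fun g)\<^sup>2"
      if "cc g" "finite F" "F \<subseteq> I \<times> UNIV \<times> UNIV" for g F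
      using frame_identity_cc(1)[OF lam I \<psi> \<phi> step that(1) that(2,3)] unfolding eq .
    show "\<exists>F. finite F \<and> F \<subseteq> I \<times> UNIV \<times> UNIV \<and> (L2_norm_fun g)\<^sup>2 - e < (\<Sum>x\<in>F. (cmod (L2_inner g (?w x)))\<^sup>2)"
      if "cc g" "e > 0" for g e
      using frame_identity_cc(2)[OF lam I \<psi> \<phi> step that] unfolding eq .
  qed
qed

subsection \<open>The wavelet frame\<close>

text \<open>Dilation and translation preserve equality almost everywhere, so all coefficients agree;
  this extends the frame property to every choice of the mother wavelets.\<close>

lemma tight_wavelet_frame_cong_AE:
  fixes \<psi> \<psi>' :: "'i \<Rightarrow> real^'n \<Rightarrow> complex"
  assumes lam: "lam > 0" and frame: "tight_wavelet_frame lam I \<psi>"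
    and eq: "\<And>i. i \<in> I \<Longrightarrow> AE x in lborel. \<psi>' i x = \<psi> i x" and L2: "\<And>i. i \<in> I \<Longrightarrow> L2_fun (\<psi>' i)"
  shows "tight_wavelet_frame lam I \<psi>'"
proof -
  have inner: "L2_inner f (wavelet lam (\<psi>' i) j k) = L2_inner f (wavelet lam (\<psi> i) j k)"
    if f: "L2_fun f" and i: "i \<in> I" for f :: "real^'n \<Rightarrow> complex" and i j k
  proof (rule L2_inner_cong_AE)
    have "real lam powi j \<noteq> 0" using lam by simp
    from AE_affine[OF this eq[OF i], of "- ivec k"]
    show "AE x in lborel. wavelet lam (\<psi>' i) j k x = wavelet lam (\<psi> i) j k x"
      by eventually_elim (simp add: wavelet_def)
    have "L2_fun (\<psi> i)" using frame i by (simp add: tight_wavelet_frame_def)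
    then show "wavelet lam (\<psi> i) j k \<in> borel_measurable borel"
      by (rule L2_fun_measurable[OF L2_fun_wavelet[OF lam]])
    show "wavelet lam (\<psi>' i) j k \<in> borel_measurable borel"
      by (rule L2_fun_measurable[OF L2_fun_wavelet[OF lam L2[OF i]]])
    show "f \<in> borel_measurable borel" by (rule L2_fun_measurable[OF f])
  qed
  have "((\<lambda>(i, j, k). (cmod (L2_inner f (wavelet lam (\<psi>' i) j k)))\<^sup>2) has_sum (L2_norm_fun f)\<^sup>2)
      (I \<times> UNIV \<times> UNIV)" if f: "L2_fun f" for f :: "real^'n \<Rightarrow> complex"
  proof -
    have "((\<lambda>(i, j, k). (cmod (L2_inner f (wavelet lam (\<psi> i) j k)))\<^sup>2) has_sum (L2_norm_fun f)\<^sup>2)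
        (I \<times> UNIV \<times> UNIV)"
      using frame f by (simp add: tight_wavelet_frame_def)
    then show ?thesis
      by (rule has_sum_cong[THEN iffD1, rotated]) (auto simp: inner[OF f])
  qed
  then show ?thesis using frame L2 by (simp add: tight_wavelet_frame_def)
qed

lemma cl2_compactly_supported_AE:
  assumes "cl2 u" "AE x in lborel. v x = u x"
  shows "compactly_supported v"
proof -
  obtain R where R: "\<And>x. R < norm x \<Longrightarrow> u x = 0" using assms(1) unfolding cl2_def by blast
  from assms(2) have "AE x in lborel. x \<notin> cball 0 R \<longrightarrow> v x = 0"
    by eventually_elim (use R in auto)
  then show ?thesis unfolding compactly_supported_def using compact_cball by blast
qed

lemma bracket_cong_AE:
  fixes f u v :: "real^'n \<Rightarrow> complex"
  assumes ae: "AE x in lborel. u x = v x" and f: "cl2 f" and u: "cl2 u" and v: "cl2 v"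
  shows "bracket f u \<xi> = bracket f v \<xi>"
proof -
  have "tr_coef f u k = tr_coef f v k" for k
    unfolding tr_coef_def
    by (rule L2_inner_cong_AE)
      (use AE_affine[OF _ ae, of 1 "- ivec k"] in \<open>auto intro!: L2_fun_measurable cl2_L2 cl2_translate f u v\<close>)
  then show ?thesis by (simp add: bracket_def)
qed

text \<open>This is the unitary extension principle for the masks of the theorem, in polyphase form: \<open>C m\<close>
  are the brackets of the test function with the polyphase components, \<open>a\<close> is its bracket with the
  refinable function.\<close>

lemma unitary_extension_identity:
  fixes C P :: "nat \<Rightarrow> complex" and G :: "nat \<Rightarrow> nat \<Rightarrow> complex" and h :: real
  assumes "N \<le> D" and h: "h\<^sup>2 * real D = 1"
    and a: "a = of_real h * (\<Sum>m = 1..D. cnj (P m) * C m)"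
    and G: "\<And>l. l \<in> {1..N} \<Longrightarrow> 1 - (cmod (P l))\<^sup>2 = real D * (\<Sum>s = 1..r l. (cmod (G l s))\<^sup>2)"
    and P: "\<And>l. l \<in> {N + 1..D} \<Longrightarrow> (cmod (P l))\<^sup>2 = 1"
  shows "(\<Sum>l = 1..N. \<Sum>s = 1..r l. (cmod (G l s * a))\<^sup>2) + (\<Sum>m = 1..D. (cmod (C m - of_real h * P m * a))\<^sup>2)
    + (cmod a)\<^sup>2 = (\<Sum>m = 1..D. (cmod (C m))\<^sup>2)"
proof -
  define p2 where "p2 = (\<Sum>m = 1..D. (cmod (P m))\<^sup>2)"
  have "(\<Sum>l = 1..N. \<Sum>s = 1..r l. (cmod (G l s * a))\<^sup>2) = (\<Sum>l = 1..N. h\<^sup>2 * (1 - (cmod (P l))\<^sup>2) * (cmod a)\<^sup>2)"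
  proof (rule sum.cong[OF refl])
    fix l assume "l \<in> {1..N}"
    then have "h\<^sup>2 * (1 - (cmod (P l))\<^sup>2) = (h\<^sup>2 * real D) * (\<Sum>s = 1..r l. (cmod (G l s))\<^sup>2)"
      using G by simp
    then show "(\<Sum>s = 1..r l. (cmod (G l s * a))\<^sup>2) = h\<^sup>2 * (1 - (cmod (P l))\<^sup>2) * (cmod a)\<^sup>2"
      by (simp add: h norm_mult power_mult_distrib sum_distrib_right)
  qed
  \<comment> \<open>The terms beyond N vanish because |P_l| = 1 there.\<close>
  also have "\<dots> = (\<Sum>l = 1..D. h\<^sup>2 * (1 - (cmod (P l))\<^sup>2) * (cmod a)\<^sup>2)"
    using P \<open>N \<le> D\<close> by (intro sum.mono_neutral_left) auto
  also have "\<dots> = (h\<^sup>2 * real D) * (cmod a)\<^sup>2 - h\<^sup>2 * p2 * (cmod a)\<^sup>2"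
    unfolding p2_def sum_distrib_right[symmetric] sum_distrib_left[symmetric] sum_subtractf
    by (simp add: algebra_simps)
  finally have 1: "(\<Sum>l = 1..N. \<Sum>s = 1..r l. (cmod (G l s * a))\<^sup>2) = (cmod a)\<^sup>2 - h\<^sup>2 * p2 * (cmod a)\<^sup>2"
    by (simp add: h)
  have pt: "(cmod (C m - of_real h * P m * a))\<^sup>2 =
      (cmod (C m))\<^sup>2 - 2 * Re (of_real h * (cnj (P m) * C m) * cnj a) + h\<^sup>2 * (cmod (P m))\<^sup>2 * (cmod a)\<^sup>2" for m
  proof -
    have "(cmod (x - y))\<^sup>2 = (cmod x)\<^sup>2 - 2 * Re (x * cnj y) + (cmod y)\<^sup>2" for x y
      unfolding cmod_power2 by (simp add: power2_eq_square algebra_simps)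
    from this[of "C m" "of_real h * P m * a"] show ?thesis
      by (simp add: norm_mult power_mult_distrib mult_ac)
  qed
  have "(\<Sum>m = 1..D. (cmod (C m - of_real h * P m * a))\<^sup>2) =
      (\<Sum>m = 1..D. (cmod (C m))\<^sup>2) - 2 * Re (\<Sum>m = 1..D. of_real h * (cnj (P m) * C m) * cnj a) + h\<^sup>2 * p2 * (cmod a)\<^sup>2"
    unfolding pt p2_def
    by (simp add: sum.distrib sum_subtractf sum_distrib_left[symmetric] sum_distrib_right[symmetric] Re_sum)
  \<comment> \<open>The cross terms recombine into a itself, which leaves -2|a|^2.\<close>
  also have "(\<Sum>m = 1..D. of_real h * (cnj (P m) * C m) * cnj a) = a * cnj a"
  proof -
    have "(\<Sum>m = 1..D. of_real h * (cnj (P m) * C m) * cnj a) =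
        of_real h * (\<Sum>m = 1..D. cnj (P m) * C m) * cnj a"
      by (simp only: sum_distrib_left sum_distrib_right)
    then show ?thesis unfolding a[symmetric] .
  qed
  also have "Re (a * cnj a) = (cmod a)\<^sup>2"
    unfolding complex_norm_square[symmetric] by simp
  finally show ?thesis using 1 by simp
qed

section \<open>The mother wavelets and the one-step identity\<close>

context masks begin

text \<open>Explicit generators: finite combinations of translates of \<phi> and of its polyphase
  components, so that bounded support is immediate.\<close>

definition mother :: "(nat \<Rightarrow> nat \<Rightarrow> real^'n \<Rightarrow> complex) \<Rightarrow> (real^'n \<Rightarrow> complex) \<Rightarrow> (nat \<times> nat) + nat \<Rightarrow> real^'n \<Rightarrow> complex" where
  "mother g \<phi> = case_sum (\<lambda>(l, s). tp_op (\<lambda>\<xi>. cnj (g l s \<xi>)) \<phi>)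
     (\<lambda>m x. polyphase m \<phi> x -
       complex_of_real (real lam powr (- real CARD('n) / 2)) * tp_op (\<lambda>\<xi>. cnj (p m \<xi>)) \<phi> x)"

lemma cl2_mother: "cl2 \<phi> \<Longrightarrow> cl2 (mother g \<phi> i)"
  unfolding mother_def
  by (cases i) (auto intro!: cl2_tp_op cl2_diff cl2_cmult cl2_polyphase split: prod.splits)

text \<open>The bracket of a generator is a multiple of that of \<phi>, or a polyphase bracket minus
  such a multiple, so \<open>unitary_extension_identity\<close> applies at each \<xi>
  separately.\<close>

lemma one_step_identity:
  fixes g :: "nat \<Rightarrow> nat \<Rightarrow> real^'n \<Rightarrow> complex"
  assumes N: "N \<le> lam ^ CARD('n)"
    and g_poly: "\<And>l s. l \<in> {1..N} \<Longrightarrow> s \<in> {1..r l} \<Longrightarrow> trig_poly (g l s)"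
    and pg: "\<And>l \<xi>. l \<in> {1..N} \<Longrightarrow>
           1 - (cmod (p l \<xi>))\<^sup>2 = real lam ^ CARD('n) * (\<Sum>s = 1..r l. (cmod (g l s \<xi>))\<^sup>2)"
    and p1: "\<And>l \<xi>. l \<in> {N + 1..lam ^ CARD('n)} \<Longrightarrow> (cmod (p l \<xi>))\<^sup>2 = 1"
    and \<phi>: "cl2 \<phi>" and refine: "AE x in lborel. \<phi> x = cascade \<phi> x" and f: "cl2 f"
  defines "I \<equiv> (SIGMA l:{1..N}. {1..r l}) <+> {1..lam ^ CARD('n)}"
  shows "(\<Sum>i\<in>I. energy f (mother g \<phi> i)) + energy f \<phi> = energy (stretch lam f) \<phi>"
proof -
  let ?D = "lam ^ CARD('n)"
  let ?h = "real lam powr (- real CARD('n) / 2)"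
  let ?C = "\<lambda>m. bracket f (polyphase m \<phi>)"
  let ?a = "bracket f \<phi>"
  have finI: "finite I" by (auto simp: I_def)
  have a: "?a \<xi> = of_real ?h * (\<Sum>m = 1..?D. cnj (p m \<xi>) * ?C m \<xi>)" for \<xi>
    using bracket_cong_AE[OF refine f \<phi> cl2_cascade[OF \<phi>]] bracket_cascade[OF f \<phi>] by simp
  have b1: "bracket f (mother g \<phi> (Inl (l, s))) \<xi> = g l s \<xi> * ?a \<xi>" if "l \<in> {1..N}" "s \<in> {1..r l}" for l s \<xi>
    using bracket_tp_op[OF trig_poly_cnj[OF g_poly[OF that]] f \<phi>] by (simp add: mother_def)
  have b2: "bracket f (mother g \<phi> (Inr m)) \<xi> = ?C m \<xi> - of_real ?h * p m \<xi> * ?a \<xi>" if "m \<in> {1..?D}" for m \<xi>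
  proof -
    have "bracket f (mother g \<phi> (Inr m)) \<xi> = ?C m \<xi> -
        bracket f (\<lambda>x. of_real ?h * tp_op (\<lambda>\<xi>. cnj (p m \<xi>)) \<phi> x) \<xi>"
      by (simp add: mother_def bracket_diff[OF f cl2_polyphase[OF \<phi>] cl2_cmult[OF cl2_tp_op[OF \<phi>]]])
    also have "bracket f (\<lambda>x. of_real ?h * tp_op (\<lambda>\<xi>. cnj (p m \<xi>)) \<phi> x) \<xi> = of_real ?h * (p m \<xi> * ?a \<xi>)"
      using bracket_tp_op[OF trig_poly_cnj[OF p_poly[OF that]] f \<phi>]
      by (simp add: bracket_cmult[OF f cl2_tp_op[OF \<phi>]])
    finally show ?thesis by (simp add: mult.assoc)
  qed
  have h2: "?h\<^sup>2 * real ?D = 1"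
    using lam_pos by (simp add: powr_minus_half power_inverse powr_half_square)
  \<comment> \<open>\<phi> is adjoined as one more function under the index \<open>()\<close>, so
    that both sides are plain sums of squared brackets.\<close>
  have id: "(\<Sum>i\<in>I <+> {()}. (cmod (bracket f (case_sum (mother g \<phi>) (\<lambda>_. \<phi>) i) \<xi>))\<^sup>2) =
      (\<Sum>m = 1..?D. (cmod (?C m \<xi>))\<^sup>2)" for \<xi>
  proof -
    let ?b = "\<lambda>i. (cmod (bracket f (mother g \<phi> i) \<xi>))\<^sup>2"
    have "(\<Sum>i\<in>I. ?b i) =
        (\<Sum>(l, s)\<in>(SIGMA l:{1..N}. {1..r l}). ?b (Inl (l, s))) +
        (\<Sum>m = 1..?D. ?b (Inr m))"
      unfolding I_def by (subst sum.Plus) (auto simp: split_def intro!: sum.cong)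
    also have "(\<Sum>(l, s)\<in>(SIGMA l:{1..N}. {1..r l}). ?b (Inl (l, s))) =
        (\<Sum>l = 1..N. \<Sum>s = 1..r l. ?b (Inl (l, s)))"
      by (rule sum.Sigma[symmetric]) auto
    also have "\<dots> = (\<Sum>l = 1..N. \<Sum>s = 1..r l. (cmod (g l s \<xi> * ?a \<xi>))\<^sup>2)"
      by (intro sum.cong refl) (simp only: b1)
    also have "(\<Sum>m = 1..?D. ?b (Inr m)) =
        (\<Sum>m = 1..?D. (cmod (?C m \<xi> - of_real ?h * p m \<xi> * ?a \<xi>))\<^sup>2)"
      by (intro sum.cong refl) (simp only: b2)
    finally have "(\<Sum>i\<in>I. ?b i) + (cmod (?a \<xi>))\<^sup>2 =
        (\<Sum>m = 1..?D. (cmod (?C m \<xi>))\<^sup>2)"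
      using unitary_extension_identity[where r = r and G = "\<lambda>l s. g l s \<xi>" and P = "\<lambda>m. p m \<xi>"
          and C = "\<lambda>m. ?C m \<xi>", OF N h2 a[of \<xi>]] pg p1 by simp
    then show ?thesis using finI by (simp add: sum.Plus)
  qed
  have cl: "cl2 (case_sum (mother g \<phi>) (\<lambda>_. \<phi>) i)" for i
    by (cases i) (simp_all add: cl2_mother \<phi>)
  have "(\<Sum>i\<in>I <+> {()}. energy f (case_sum (mother g \<phi>) (\<lambda>_. \<phi>) i)) = (\<Sum>m = 1..?D. energy f (polyphase m \<phi>))"
    by (intro antisym energy_sum_le f cl cl2_polyphase \<phi>) (simp_all only: id order_refl, auto simp: finI)
  then show ?thesis using finI energy_polyphase[OF f \<phi>] by (simp add: sum.Plus)
qed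

lemma fourier_mother_Inl:
  assumes \<phi>: "cl2 \<phi>" and refine: "\<And>\<xi>. fourier \<phi> (real lam *\<^sub>R \<xi>) = \<tau> \<xi> * fourier \<phi> \<xi>"
    and g: "trig_poly (g l s)"
  shows "fourier (mother g \<phi> (Inl (l, s))) (real lam *\<^sub>R \<xi>) =
      \<tau> \<xi> * cnj (g l s (real lam *\<^sub>R \<xi>)) * fourier \<phi> \<xi>"
  using fourier_tp_op[OF trig_poly_cnj[OF g] cl2_L1[OF \<phi>]] by (simp add: mother_def refine)

lemma fourier_mother_Inr:
  assumes \<phi>: "cl2 \<phi>" and refine: "\<And>\<xi>. fourier \<phi> (real lam *\<^sub>R \<xi>) = \<tau> \<xi> * fourier \<phi> \<xi>"
    and m: "m \<in> {1..lam ^ CARD('n)}"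
  shows "fourier (mother g \<phi> (Inr m)) (real lam *\<^sub>R \<xi>) =
      complex_of_real (real lam powr (- real CARD('n) / 2)) *
      (exp (\<i> * complex_of_real (ivec (\<nu> m) \<bullet> \<xi>)) - \<tau> \<xi> * cnj (p m (real lam *\<^sub>R \<xi>))) * fourier \<phi> \<xi>"
proof -
  let ?h = "complex_of_real (real lam powr (- real CARD('n) / 2))"
  have "fourier (mother g \<phi> (Inr m)) (real lam *\<^sub>R \<xi>) = fourier (polyphase m \<phi>) (real lam *\<^sub>R \<xi>) -
      fourier (\<lambda>x. ?h * tp_op (\<lambda>\<xi>. cnj (p m \<xi>)) \<phi> x) (real lam *\<^sub>R \<xi>)"
    by (simp only: mother_def sum.case
        fourier_diff[OF cl2_L1[OF cl2_polyphase[OF \<phi>]] cl2_L1[OF cl2_cmult[OF cl2_tp_op[OF \<phi>]]]])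
  also have "\<dots> = ?h * exp (\<i> * complex_of_real (ivec (\<nu> m) \<bullet> \<xi>)) * fourier \<phi> \<xi> -
      ?h * (cnj (p m (real lam *\<^sub>R \<xi>)) * (\<tau> \<xi> * fourier \<phi> \<xi>))"
    by (simp only: fourier_polyphase fourier_cmult
        fourier_tp_op[OF trig_poly_cnj[OF p_poly[OF m]] cl2_L1[OF \<phi>]] refine)
  finally show ?thesis by (simp add: algebra_simps)
qed

text \<open>The first factor at \<lambda>\<xi> is \<tau>(\<xi>), the others form the product at
  \<xi>. Limits of partial products are indifferent to vanishing factors.\<close>

lemma refinable_equation:
  assumes "\<And>\<xi>. (\<lambda>j. \<tau> ((1 / real lam ^ Suc j) *\<^sub>R \<xi>)) has_prod P \<xi>"
  shows "P (real lam *\<^sub>R \<xi>) = \<tau> \<xi> * P \<xi>"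
proof -
  have "(\<lambda>m. \<Prod>j<Suc m. \<tau> ((1 / real lam ^ Suc j) *\<^sub>R real lam *\<^sub>R \<xi>)) \<longlonglongrightarrow> P (real lam *\<^sub>R \<xi>)"
    using has_prod_imp_tendsto'[OF assms] by (rule LIMSEQ_Suc)
  moreover have "(\<Prod>j<Suc m. \<tau> ((1 / real lam ^ Suc j) *\<^sub>R real lam *\<^sub>R \<xi>)) =
      \<tau> \<xi> * (\<Prod>j<m. \<tau> ((1 / real lam ^ Suc j) *\<^sub>R \<xi>))" for m
    using lam_pos by (simp add: prod.lessThan_Suc_shift del: prod.lessThan_Suc)
  ultimately have "(\<lambda>m. \<tau> \<xi> * (\<Prod>j<m. \<tau> ((1 / real lam ^ Suc j) *\<^sub>R \<xi>))) \<longlonglongrightarrow> P (real lam *\<^sub>R \<xi>)"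
    by simp
  moreover have "(\<lambda>m. \<tau> \<xi> * (\<Prod>j<m. \<tau> ((1 / real lam ^ Suc j) *\<^sub>R \<xi>))) \<longlonglongrightarrow> \<tau> \<xi> * P \<xi>"
    by (intro tendsto_mult tendsto_const has_prod_imp_tendsto' assms)
  ultimately show ?thesis by (rule LIMSEQ_unique)
qed

end

text \<open>The existence half keeps the claim about all families \<open>\<psi>\<close> from being
  vacuous; the latter makes the result independent of the choice of representatives.\<close>

theorem theorem3p1:
  fixes lam N :: nat
    and r :: "nat \<Rightarrow> nat"
    and p :: "nat \<Rightarrow> real^'n \<Rightarrow> complex"
    and g :: "nat \<Rightarrow> nat \<Rightarrow> real^'n \<Rightarrow> complex"
    and \<nu> :: "nat \<Rightarrow> int^'n"
    and \<tau> :: "real^'n \<Rightarrow> complex"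
    and q1 :: "nat \<Rightarrow> nat \<Rightarrow> real^'n \<Rightarrow> complex"
    and q2 :: "nat \<Rightarrow> real^'n \<Rightarrow> complex"
  assumes "lam \<ge> 2"
    and "1 \<le> N" and "N \<le> lam ^ CARD('n)"
    and "\<And>l. l \<in> {1..N} \<Longrightarrow> trig_poly (p l)"
    and "\<And>l s. l \<in> {1..N} \<Longrightarrow> s \<in> {1..r l} \<Longrightarrow> trig_poly (g l s)"
    and "\<And>l \<xi>. l \<in> {1..N} \<Longrightarrow>
           1 - (cmod (p l \<xi>))\<^sup>2 = real lam ^ CARD('n) * (\<Sum>s = 1..r l. (cmod (g l s \<xi>))\<^sup>2)"
    and "\<And>l. l \<in> {1..N} \<Longrightarrow> p l 0 = 1"
    and "\<And>l. l \<in> {N + 1..lam ^ CARD('n)} \<Longrightarrow> trig_poly (p l)"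
    and "\<And>l \<xi>. l \<in> {N + 1..lam ^ CARD('n)} \<Longrightarrow> (cmod (p l \<xi>))\<^sup>2 = 1"
    and "bij_betw \<nu> {1..lam ^ CARD('n)} {k. \<forall>i. 0 \<le> k $ i \<and> k $ i \<le> int lam - 1}"
    and "\<And>\<xi>. \<tau> \<xi> = (1 / of_nat lam ^ CARD('n)) *
           (\<Sum>l = 1..lam ^ CARD('n).
              p l (real lam *\<^sub>R \<xi>) * exp (\<i> * complex_of_real (ivec (\<nu> l) \<bullet> \<xi>)))"
    and "\<tau> 0 = 1"
    and "\<And>l s \<xi>. q1 l s \<xi> = \<tau> \<xi> * cnj (g l s (real lam *\<^sub>R \<xi>))"
    and "\<And>m \<xi>. q2 m \<xi> = complex_of_real (real lam powr (- real CARD('n) / 2)) *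
           (exp (\<i> * complex_of_real (ivec (\<nu> m) \<bullet> \<xi>)) - \<tau> \<xi> * cnj (p m (real lam *\<^sub>R \<xi>)))"
  defines "I \<equiv> (SIGMA l:{1..N}. {1..r l}) <+> {1..lam ^ CARD('n)}"
    and "q \<equiv> case_sum (\<lambda>(l, s). q1 l s) q2"
  shows "(\<exists>\<psi>. mother_wavelets lam \<tau> I q \<psi>) \<and>
         (\<forall>\<psi>. mother_wavelets lam \<tau> I q \<psi> \<longrightarrow>
            (\<forall>i\<in>I. compactly_supported (\<psi> i)) \<and> tight_wavelet_frame lam I \<psi>)"
proof -
  have cases_l: "l \<in> {1..N} \<or> l \<in> {N + 1..lam ^ CARD('n)}" if "l \<in> {1..lam ^ CARD('n)}" for l
    using that by auto
  have p_le: "cmod (p l \<xi>) \<le> 1" if "l \<in> {1..lam ^ CARD('n)}" for l \<xi>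
  proof -
    have "(cmod (p l \<xi>))\<^sup>2 \<le> 1"
      using cases_l[OF that]
    proof
      assume l: "l \<in> {1..N}"
      have "0 \<le> real lam ^ CARD('n) * (\<Sum>s = 1..r l. (cmod (g l s \<xi>))\<^sup>2)"
        by (intro mult_nonneg_nonneg sum_nonneg) auto
      then show ?thesis using assms(6)[OF l, of \<xi>] by linarith
    next
      assume "l \<in> {N + 1..lam ^ CARD('n)}"
      then show ?thesis using assms(9) by simp
    qed
    then show ?thesis by (simp add: power2_le_imp_le[of _ 1])
  qed
  interpret masks lam p \<nu> \<tau>
    by unfold_locales (use assms(1) assms(4,8) p_le assms(10-12) cases_l in \<open>blast+\<close>)
  obtain \<phi> where \<phi>: "cl2 \<phi>" and \<phi>_prod: "\<And>\<xi>. (\<lambda>j. \<tau> ((1 / real lam ^ Suc j) *\<^sub>R \<xi>)) has_prod fourier \<phi> \<xi>"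
    using refinable_exists by blast
  note refine = refinable_equation[OF \<phi>_prod]
  \<comment> \<open>The refinement equation is known for transforms and is brought back here to the
    space side, where the one-step identity uses it.\<close>
  have "AE x in lborel. \<phi> x = cascade \<phi> x"
  proof (rule fourier_inject[OF cl2_L1[OF \<phi>] cl2_L1[OF cl2_cascade[OF \<phi>]]])
    fix \<xi>
    have "fourier \<phi> (real lam *\<^sub>R (1 / real lam) *\<^sub>R \<xi>) = fourier (cascade \<phi>) (real lam *\<^sub>R (1 / real lam) *\<^sub>R \<xi>)"
      by (simp only: refine fourier_cascade[OF \<phi>])
    then show "fourier \<phi> \<xi> = fourier (cascade \<phi>) \<xi>" using lam_pos by simp
  qed
  note step = one_step_identity[OF assms(3,5,6,9) \<phi> this]
  \<comment> \<open>At 0 every factor is 1, so \<phi> has integral 1.\<close>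
  have "(\<lambda>j. \<tau> ((1 / real lam ^ Suc j) *\<^sub>R 0)) has_prod 1"
    by (simp add: assms(12))
  then have \<phi>0: "fourier \<phi> 0 = 1" by (rule has_prod_unique2[OF \<phi>_prod])
  have fourier_q: "fourier (mother g \<phi> i) (real lam *\<^sub>R \<xi>) = q i \<xi> * fourier \<phi> \<xi>" if "i \<in> I" for i \<xi>
    using that unfolding I_def q_def
    by (elim PlusE SigmaE) (auto simp: fourier_mother_Inl[OF \<phi> refine] fourier_mother_Inr[OF \<phi> refine] assms(5,13,14))
  have finI: "finite I" by (auto simp: I_def)
  have frame: "tight_wavelet_frame lam I (mother g \<phi>)"
    unfolding I_def
    by (rule tight_wavelet_frameI[OF lam _ cl2_mother[OF \<phi>] \<phi> \<phi>0 step]) auto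
  have "mother_wavelets lam \<tau> I q (mother g \<phi>)"
    unfolding mother_wavelets_def refinable_function_def
    using \<phi> cl2_L1 cl2_L2 \<phi>_prod cl2_mother fourier_q by blast
  moreover have "(\<forall>i\<in>I. compactly_supported (\<psi> i)) \<and> tight_wavelet_frame lam I \<psi>"
    if mw: "mother_wavelets lam \<tau> I q \<psi>" for \<psi>
  proof -
    obtain \<phi>' where \<phi>'_prod: "\<And>\<xi>. (\<lambda>j. \<tau> ((1 / real lam ^ Suc j) *\<^sub>R \<xi>)) has_prod fourier \<phi>' \<xi>"
      and \<psi>: "\<And>i. i \<in> I \<Longrightarrow> L1_fun (\<psi> i)" "\<And>i. i \<in> I \<Longrightarrow> L2_fun (\<psi> i)"
      and \<psi>q: "\<And>i \<xi>. i \<in> I \<Longrightarrow> fourier (\<psi> i) (real lam *\<^sub>R \<xi>) = q i \<xi> * fourier \<phi>' \<xi>"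
      using mw unfolding mother_wavelets_def refinable_function_def by blast
    \<comment> \<open>A convergent product has only one value, so any other refinable function has
      the same transform and leads to the same generators almost everywhere.\<close>
    have same: "fourier \<phi>' \<xi> = fourier \<phi> \<xi>" for \<xi>
      using \<phi>'_prod \<phi>_prod by (rule has_prod_unique2)
    have ae: "AE x in lborel. \<psi> i x = mother g \<phi> i x" if i: "i \<in> I" for i
    proof (rule fourier_inject[OF \<psi>(1)[OF i] cl2_L1[OF cl2_mother[OF \<phi>]]])
      fix \<xi>
      have "fourier (\<psi> i) (real lam *\<^sub>R (1 / real lam) *\<^sub>R \<xi>) =
          fourier (mother g \<phi> i) (real lam *\<^sub>R (1 / real lam) *\<^sub>R \<xi>)"
        by (simp only: \<psi>q[OF i] fourier_q[OF i] same)
      then show "fourier (\<psi> i) \<xi> = fourier (mother g \<phi> i) \<xi>" using lam_pos by simp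
    qed
    show ?thesis
      using cl2_compactly_supported_AE[OF cl2_mother[OF \<phi>] ae]
        tight_wavelet_frame_cong_AE[OF lam_pos(2) frame ae \<psi>(2)] by blast
  qed
  ultimately show ?thesis by blast
qed

end
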